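(* Let $H$ be an infinite-dimensional complex Hilbert space and let $m$ be a cardinal with $\aleph_0 < m \leq \dim H$ such that $m$ is countably cofinal. If $t \in \mathcal{C}_m(H)$ is normal (i.e. $t^*t = tt^*$), then there is a normal operator $T \in B(H)$ such that $\pi_m(T) = t$.
   Context: $B(H)$ is the C*-algebra of all bounded linear operators on $H$, and $\dim H$ is the Hilbert-space dimension (cardinality of an orthonormal basis). For an infinite cardinal $m$ with $\aleph_0 \leq m \leq \dim H$, let $\mathcal{F}_m(H) = \{T \in B(H) : \operatorname{rank} T < m\}$, where $\operatorname{rank} T = \dim \overline{T(H)}$, and let $\mathcal{K}_m(H)$ be the norm closure of $\mathcal{F}_m(H)$; it is a norm-closed two-sided ideal of $B(H)$. The $m$-Calkin algebra is the quotient C*-algebra $\mathcal{C}_m(H) = B(H)/\mathcal{K}_m(H)$, and $\pi_m : B(H) \to \mathcal{C}_m(H)$ is the quotient map. A cardinal $m$ is called countably cofinal if $m$ is the supremum of a countable collection of cardinals each strictly smaller than $m$. *)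

theory Defs
  imports
    "HOL-Analysis.Analysis"
    "HOL-Algebra.QuotRing"
begin

unbundle cardinal_syntax

text \<open>
  A complex inner product space is a real inner product space, with the same norm, that carries a
  compatible complex scalar multiplication and a sesquilinear form (linear in the first argument)
  whose real part is the real inner product. Norm, topology and completeness are thus the ones of
  the underlying real space.
\<close>

class complex_inner = real_inner +
  fixes scaleC :: "complex \<Rightarrow> 'a \<Rightarrow> 'a" (infixr "*\<^sub>C" 75)
    and cinner :: "'a \<Rightarrow> 'a \<Rightarrow> complex"
  assumes scaleC_add_right: "c *\<^sub>C (x + y) = c *\<^sub>C x + c *\<^sub>C y"
    and scaleC_add_left: "(c + d) *\<^sub>C x = c *\<^sub>C x + d *\<^sub>C x"
    and scaleC_scaleC: "c *\<^sub>C d *\<^sub>C x = (c * d) *\<^sub>C x"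
    and scaleR_scaleC: "r *\<^sub>R x = complex_of_real r *\<^sub>C x"
    and cinner_commute: "cinner x y = cnj (cinner y x)"
    and cinner_add_left: "cinner (x + y) z = cinner x z + cinner y z"
    and cinner_scaleC_left: "cinner (c *\<^sub>C x) y = c * cinner x y"
    and inner_eq_Re_cinner: "inner x y = Re (cinner x y)"

class complex_hilbert = complex_inner + banach

global_interpretation complex_vector: vector_space "scaleC :: complex \<Rightarrow> 'a \<Rightarrow> 'a::complex_inner"
  defines cspan = complex_vector.span
proof unfold_locales
  show "1 *\<^sub>C x = x" for x :: 'a
    using scaleR_scaleC[of 1 x] by simp
qed (auto simp: scaleC_add_right scaleC_add_left scaleC_scaleC)

definition is_onb :: "'a::complex_inner set \<Rightarrow> 'a set \<Rightarrow> bool" where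
  "is_onb S B \<longleftrightarrow> B \<subseteq> S \<and> (\<forall>x\<in>B. \<forall>y\<in>B. cinner x y = (if x = y then 1 else 0))
     \<and> closure (cspan B) = S"

text \<open>
  Cardinals are represented by cardinal orders. The following is used for closed complex subspaces
  of a Hilbert space; these have orthonormal bases, all of the same cardinality.
\<close>

definition hdim :: "'a::complex_inner set \<Rightarrow> 'a rel" where
  "hdim S = |SOME B. is_onb S B|"

text \<open>
  Every cardinal below a cardinal order on a type is represented on that same type, so it is no
  restriction that the members of the family and the competing upper bounds live on the type
  of \<open>m\<close>.
\<close>

definition countably_cofinal :: "'m rel \<Rightarrow> bool" where
  "countably_cofinal m \<longleftrightarrow>
     (\<exists>K :: 'm rel set. countable K \<and> (\<forall>k\<in>K. Card_order k \<and> k <o m) \<and>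
          (\<forall>c :: 'm rel. Card_order c \<and> (\<forall>k\<in>K. k \<le>o c) \<longrightarrow> m \<le>o c))"

text \<open>
  The library's bounded linear maps are only real-linear, so \<open>B(H)\<close> consists of those
  that respect complex scalars. The operator norm does not depend on the choice of scalars.
\<close>

definition bounded_ops :: "('a::complex_hilbert \<Rightarrow>\<^sub>L 'a) ring" where
  "bounded_ops =
     \<lparr>carrier = {T. \<forall>c x. blinfun_apply T (c *\<^sub>C x) = c *\<^sub>C blinfun_apply T x},
      mult = (o\<^sub>L), one = id_blinfun, zero = 0, add = (+)\<rparr>"

definition cadjoint :: "('a::complex_hilbert \<Rightarrow>\<^sub>L 'a) \<Rightarrow> ('a \<Rightarrow>\<^sub>L 'a)" where
  "cadjoint T = (THE S. S \<in> carrier bounded_ops \<and>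
     (\<forall>x y. cinner (blinfun_apply T x) y = cinner x (blinfun_apply S y)))"

definition rank_op :: "('a::complex_hilbert \<Rightarrow>\<^sub>L 'a) \<Rightarrow> 'a rel" where
  "rank_op T = hdim (closure (range (blinfun_apply T)))"

definition small_rank_ops :: "'m rel \<Rightarrow> ('a::complex_hilbert \<Rightarrow>\<^sub>L 'a) set" where
  "small_rank_ops m = {T \<in> carrier bounded_ops. rank_op T <o m}"

definition m_compact_ops :: "'m rel \<Rightarrow> ('a::complex_hilbert \<Rightarrow>\<^sub>L 'a) set" where
  "m_compact_ops m = closure (small_rank_ops m)"

text \<open>
  Elements of the \<open>m\<close>-Calkin algebra are cosets of \<open>m_compact_ops m\<close>. As this ideal is
  self-adjoint, the involution of the quotient, which sends the coset of \<open>T\<close> to the coset of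
  \<open>cadjoint T\<close>, is the elementwise adjoint.
\<close>

definition calkin :: "'m rel \<Rightarrow> ('a::complex_hilbert \<Rightarrow>\<^sub>L 'a) set ring" where
  "calkin m = bounded_ops Quot m_compact_ops m"

definition calkin_proj :: "'m rel \<Rightarrow> ('a::complex_hilbert \<Rightarrow>\<^sub>L 'a) \<Rightarrow> ('a \<Rightarrow>\<^sub>L 'a) set" where
  "calkin_proj m T = m_compact_ops m +>\<^bsub>bounded_ops\<^esub> T"

definition calkin_star :: "('a::complex_hilbert \<Rightarrow>\<^sub>L 'a) set \<Rightarrow> ('a \<Rightarrow>\<^sub>L 'a) set" where
  "calkin_star t = cadjoint ` t"

lemma ring_bounded_ops: "ring (bounded_ops :: ('a::complex_hilbert \<Rightarrow>\<^sub>L 'a) ring)"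
proof (intro ringI abelian_groupI monoidI)
  fix S :: "'a \<Rightarrow>\<^sub>L 'a"
  assume "S \<in> carrier bounded_ops"
  then show "\<exists>T\<in>carrier bounded_ops. T \<oplus>\<^bsub>bounded_ops\<^esub> S = \<zero>\<^bsub>bounded_ops\<^esub>"
    by (intro bexI[of _ "- S"])
       (auto simp: bounded_ops_def blinfun.minus_left complex_vector.scale_minus_right)
qed (auto simp: bounded_ops_def blinfun.add_left blinfun.add_right scaleC_add_right
       intro!: blinfun_eqI)

end

theory Submission
  imports Defs
begin

text \<open>
  Write \<open>\<doteq>\<close> for congruence modulo the ideal of \<open>m\<close>-compact operators, and call an operator
  essentially normal if it is normal modulo that ideal. An essentially normal Fredholm operator
  has no index obstruction when \<open>m\<close> is uncountable: one can work with reducing subspaces generated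
  by countable families of operators, and either only countably many meet the approximate kernel,
  which is then negligible, or the kernel and the cokernel have the same dimension. Hence there is a
  unitary polar decomposition, and the spectral projections of the unitary part are genuine
  projections that separate the joint spectrum of the real and imaginary parts.

  Such projections, combined over a fine ladder of levels, yield a cut that separates the imaginary
  part at a given level and almost commutes with the real part. Pinching the real part by a nested
  sequence of these cuts gives a normal operator that is essentially close to \<open>T\<close>. Finally, normal
  approximants of increasing accuracy are glued to one normal operator congruent to \<open>T\<close>, using
  that the exceptional subspaces can be chosen small and reducing for all approximants at once.
\<close>

section \<open>Hilbert spaces\<close>

text \<open>Two obstacles shape the construction. A countable union of small sets need not be small,
  so a negligible operator cannot in general be made to vanish off a single small subspace; all
  estimates hold up to some e off a small set, and the final limit runs along an increasing sequence
  of such sets. Moreover, spectral projections are discontinuous, so those of two operators that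
  commute modulo the ideal need not commute modulo the ideal. The unitary helps because its real and
  imaginary parts commute exactly, and so do their spectral projections. A level cut glues one such
  projection per rung of a ladder by means of a partition of unity, so that each has to commute only
  with the projection of its own rung. The commutator of the cut with the rescaled real part is then
  bounded by 4, however many rungs there are. Hence the scale of the real part may be chosen after
  the number of levels of the imaginary part, which keeps the total pinching error small.\<close>

lemma orthogonal_decomposition:
  fixes x :: "'a::{real_inner,banach}"
  assumes S: "subspace S" "closed S"
  obtains y where "y \<in> S" "\<And>z. z \<in> S \<Longrightarrow> (x - y) \<bullet> z = 0"
proof -
  define D where "D = (INF y\<in>S. (norm (x - y))\<^sup>2)"
  have bdd: "bdd_below ((\<lambda>y. (norm (x - y))\<^sup>2) ` S)"
    by (rule bdd_belowI[of _ 0]) auto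
  have ne: "S \<noteq> {}" using S subspace_0 by blast
  have D_le: "D \<le> (norm (x - y))\<^sup>2" if "y \<in> S" for y
    unfolding D_def using that bdd by (rule cINF_lower[rotated])
  have "\<exists>y\<in>S. (norm (x - y))\<^sup>2 < D + e" if "e > 0" for e
  proof -
    have "(INF y\<in>S. (norm (x - y))\<^sup>2) < D + e" using that by (simp add: D_def)
    then show ?thesis using cINF_less_iff[OF ne bdd] by blast
  qed
  then have "\<exists>y. \<forall>n. y n \<in> S \<and> (norm (x - y n))\<^sup>2 < D + inverse (real (Suc n))"
    by (intro choice) (metis inverse_positive_iff_positive of_nat_0_less_iff zero_less_Suc)
  then obtain y where yS: "\<And>n. y n \<in> S"
    and yD: "\<And>n. (norm (x - y n))\<^sup>2 < D + inverse (real (Suc n))" by blast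
  \<comment> \<open>Parallelogram law; the midpoint of two points of S is in S, so its squared
    distance from x is at least D.\<close>
  have para: "(norm (y m - y n))\<^sup>2 \<le> 2 * (inverse (real (Suc m)) + inverse (real (Suc n)))" for m n
  proof -
    let ?w = "(1/2) *\<^sub>R (y m + y n)"
    have "?w \<in> S" using yS S by (intro subspace_scale subspace_add)
    then have "D \<le> (norm (x - ?w))\<^sup>2" by (rule D_le)
    moreover have "(norm (y m - y n))\<^sup>2 = 2 * (norm (x - y m))\<^sup>2 + 2 * (norm (x - y n))\<^sup>2 - 4 * (norm (x - ?w))\<^sup>2"
      by (simp add: power2_norm_eq_inner inner_diff inner_add inner_commute algebra_simps)
    ultimately show ?thesis using yD[of m] yD[of n] by simp
  qed
  have "Cauchy y"
  proof (rule metric_CauchyI)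
    fix e :: real assume "e > 0"
    then obtain M where M: "inverse (real (Suc M)) < e\<^sup>2 / 4"
      using reals_Archimedean[of "e\<^sup>2/4"] by auto
    have "dist (y m) (y n) < e" if "m \<ge> M" "n \<ge> M" for m n
    proof -
      have "inverse (real (Suc m)) \<le> inverse (real (Suc M))" "inverse (real (Suc n)) \<le> inverse (real (Suc M))"
        using that by (auto intro!: le_imp_inverse_le)
      then have "2 * (inverse (real (Suc m)) + inverse (real (Suc n))) < e\<^sup>2"
        using M by argo
      then have "(norm (y m - y n))\<^sup>2 < e\<^sup>2" using para[of m n] by (rule le_less_trans[rotated])
      then have "norm (y m - y n) < e" by (rule power2_less_imp_less) (use \<open>e > 0\<close> in simp)
      then show ?thesis by (simp add: dist_norm)
    qed
    then show "\<exists>M. \<forall>m\<ge>M. \<forall>n\<ge>M. dist (y m) (y n) < e" by blast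
  qed
  then obtain l where l: "y \<longlonglongrightarrow> l" using Cauchy_convergent_iff convergent_def by blast
  have lS: "l \<in> S" using closed_sequentially[OF S(2)] yS l by blast
  have "(\<lambda>n. (norm (x - y n))\<^sup>2) \<longlonglongrightarrow> (norm (x - l))\<^sup>2"
    by (intro tendsto_intros l)
  moreover have "(\<lambda>n. D + inverse (real (Suc n))) \<longlonglongrightarrow> D + 0"
    by (intro tendsto_intros LIMSEQ_inverse_real_of_nat)
  ultimately have lD: "(norm (x - l))\<^sup>2 \<le> D"
    using yD by (intro tendsto_le[OF sequentially_bot, of "\<lambda>n. D + inverse (real (Suc n))" "D"]) (auto intro!: always_eventually less_imp_le)
  have "(x - l) \<bullet> z = 0" if z: "z \<in> S" for z
  proof (cases "z = 0")
    case False
    \<comment> \<open>The minimiser of the distance from x to l + t z over real t.\<close>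
    define t where "t = ((x - l) \<bullet> z) / (z \<bullet> z)"
    have "l + t *\<^sub>R z \<in> S" using S lS z by (simp add: subspace_add subspace_scale)
    then have "(norm (x - l))\<^sup>2 \<le> (norm (x - (l + t *\<^sub>R z)))\<^sup>2" using D_le lD order_trans by blast
    also have "\<dots> = (norm (x - l))\<^sup>2 - 2 * t * ((x - l) \<bullet> z) + t * t * (z \<bullet> z)"
      by (simp add: power2_norm_eq_inner inner_diff inner_add inner_commute algebra_simps)
    also have "t * t * (z \<bullet> z) = t * ((x - l) \<bullet> z)" using False by (simp add: t_def)
    finally have "t * ((x - l) \<bullet> z) \<le> 0" by simp
    then have "((x - l) \<bullet> z)\<^sup>2 / (z \<bullet> z) \<le> 0" by (simp add: t_def power2_eq_square)
    moreover have "z \<bullet> z > 0" using False by simp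
    ultimately have "((x - l) \<bullet> z)\<^sup>2 \<le> 0" by (simp add: divide_le_0_iff)
    then show ?thesis by simp
  qed simp
  then show thesis using that lS by blast
qed

lemma riesz:
  fixes f :: "'a::{real_inner,banach} \<Rightarrow> real"
  assumes f: "bounded_linear f"
  obtains y where "\<And>x. f x = x \<bullet> y"
proof (cases "\<forall>x. f x = 0")
  case True then show ?thesis using that[of 0] by simp
next
  case False
  then obtain x0 where x0: "f x0 \<noteq> 0" by blast
  interpret bounded_linear f by (rule f)
  have S: "subspace {x. f x = 0}" by (simp add: subspace_def add scaleR zero)
  have cl: "closed {x. f x = 0}"
    by (intro closed_Collect_eq linear_continuous_on f continuous_on_const)
  obtain p where p: "f p = 0" and orth: "\<And>z. f z = 0 \<Longrightarrow> (x0 - p) \<bullet> z = 0"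
    using orthogonal_decomposition[OF S cl, of x0] by auto
  define u where "u = x0 - p"
  have fu: "f u \<noteq> 0" using x0 p by (simp add: u_def diff)
  then have uu: "u \<bullet> u \<noteq> 0" using zero by auto
  have "f x = x \<bullet> ((f u / (u \<bullet> u)) *\<^sub>R u)" for x
  proof -
    have "f (x - (f x / f u) *\<^sub>R u) = 0" using fu by (simp add: diff scaleR)
    then have "u \<bullet> (x - (f x / f u) *\<^sub>R u) = 0" using orth u_def by blast
    then have "u \<bullet> x = (f x / f u) * (u \<bullet> u)" by (simp add: inner_diff_right)
    then show ?thesis using fu uu by (simp add: inner_commute)
  qed
  then show thesis using that by blast
qed

section \<open>Complex scalars in terms of the real inner product\<close>

lemma scaleC_i_i [simp]: "\<i> *\<^sub>C \<i> *\<^sub>C x = - (x::'a::complex_inner)"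
  by (simp add: scaleC_scaleC)

lemma scaleC_decompose: "c *\<^sub>C x = Re c *\<^sub>R x + Im c *\<^sub>R \<i> *\<^sub>C (x::'a::complex_inner)"
  by (subst complex_eq[of c]) (simp only: scaleC_add_left scaleR_scaleC scaleC_scaleC mult.commute)

lemma cinner_scaleC_right: "cinner x (c *\<^sub>C y) = cnj c * cinner x (y::'a::complex_inner)"
  by (metis cinner_commute cinner_scaleC_left complex_cnj_mult)

lemma inner_i_left: "(\<i> *\<^sub>C x) \<bullet> y = - (x \<bullet> (\<i> *\<^sub>C (y::'a::complex_inner)))"
  by (simp add: inner_eq_Re_cinner cinner_scaleC_left cinner_scaleC_right)

lemma inner_scaleC_left: "(c *\<^sub>C x) \<bullet> y = Re c * (x \<bullet> y) + Im c * ((\<i> *\<^sub>C x) \<bullet> (y::'a::complex_inner))"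
  by (subst scaleC_decompose) (simp add: inner_add_left)

lemma inner_scaleC_right: "x \<bullet> (c *\<^sub>C y) = Re c * (x \<bullet> y) - Im c * ((\<i> *\<^sub>C x) \<bullet> (y::'a::complex_inner))"
  by (subst scaleC_decompose) (simp add: inner_add_right inner_i_left)

text \<open>Reduces complex orthogonality and adjoints to the real inner product together with
  multiplication by i.\<close>

lemma cinner_eq: "cinner x y = Complex (x \<bullet> y) (x \<bullet> (\<i> *\<^sub>C (y::'a::complex_inner)))"
  by (simp add: complex_eq_iff inner_eq_Re_cinner cinner_scaleC_right)

lemma norm_i [simp]: "norm (\<i> *\<^sub>C x) = norm (x::'a::complex_inner)"
  by (simp add: norm_eq_sqrt_inner inner_i_left)

lemma bounded_linear_i: "bounded_linear (\<lambda>x::'a::complex_inner. \<i> *\<^sub>C x)"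
  by (intro bounded_linear_intro[where K=1])
     (auto simp: scaleC_add_right scaleR_scaleC scaleC_scaleC mult.commute)

lemma bounded_linear_scaleC: "bounded_linear (\<lambda>x::'a::complex_inner. c *\<^sub>C x)"
  by (rule subst[of _ _ bounded_linear, OF ext[OF scaleC_decompose[symmetric]]])
     (intro bounded_linear_add bounded_linear_compose[OF bounded_linear_scaleR_right] bounded_linear_ident bounded_linear_i)

section \<open>Closed complex subspaces and orthogonal complements\<close>

definition closed_csub :: "'a::complex_hilbert set \<Rightarrow> bool" where
  "closed_csub S \<longleftrightarrow> complex_vector.subspace S \<and> closed S"

lemma csub_imp_subspace: "complex_vector.subspace S \<Longrightarrow> subspace S"
  unfolding complex_vector.subspace_def subspace_def by (simp add: scaleR_scaleC)

lemma closed_csubD: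
  assumes "closed_csub S"
  shows "subspace S" "closed S" "x \<in> S \<Longrightarrow> c *\<^sub>C x \<in> S" "0 \<in> S"
    "x \<in> S \<Longrightarrow> y \<in> S \<Longrightarrow> x + y \<in> S" "x \<in> S \<Longrightarrow> y \<in> S \<Longrightarrow> x - y \<in> S"
  using assms csub_imp_subspace unfolding closed_csub_def
  by (auto simp: complex_vector.subspace_scale complex_vector.subspace_0 complex_vector.subspace_add complex_vector.subspace_diff)

lemma closed_csub_closure_cspan [simp]: "closed_csub (closure (cspan X))"
proof -
  let ?S = "closure (cspan X)"
  have sub: "complex_vector.subspace (cspan X)" by (rule complex_vector.subspace_span)
  have c: "subspace ?S"
  proof -
    have "x + y \<in> ?S" if xy: "x \<in> ?S" "y \<in> ?S" for x y
    proof -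
      obtain f g where "\<And>n. f n \<in> cspan X" "\<And>n. g n \<in> cspan X" "f \<longlonglongrightarrow> x" "g \<longlonglongrightarrow> y"
        using xy unfolding closure_sequential by blast
      then show ?thesis unfolding closure_sequential
        by (intro exI[of _ "\<lambda>n. f n + g n"]) (auto intro!: tendsto_add complex_vector.span_add)
    qed
    moreover have "c *\<^sub>R x \<in> ?S" if x: "x \<in> ?S" for c x
    proof -
      obtain f where "\<And>n. f n \<in> cspan X" "f \<longlonglongrightarrow> x"
        using x unfolding closure_sequential by blast
      then show ?thesis unfolding closure_sequential
        by (intro exI[of _ "\<lambda>n. c *\<^sub>R f n"]) (use csub_imp_subspace[OF sub] in \<open>auto intro!: tendsto_scaleR subspace_scale\<close>)
    qed
    moreover have "0 \<in> ?S" using closure_subset complex_vector.span_zero by blast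
    ultimately show ?thesis by (simp add: subspace_def)
  qed
  have "c *\<^sub>C x \<in> ?S" if "x \<in> ?S" for c x
  proof -
    have "(\<lambda>x. c *\<^sub>C x) ` ?S \<subseteq> closure ((\<lambda>x. c *\<^sub>C x) ` cspan X)"
      by (rule closure_bounded_linear_image_subset[OF bounded_linear_scaleC])
    also have "\<dots> \<subseteq> ?S" by (intro closure_mono) (auto intro: complex_vector.span_scale)
    finally show ?thesis using that by blast
  qed
  then show ?thesis using c unfolding closed_csub_def complex_vector.subspace_def
    by (auto simp: subspace_0 subspace_add)
qed

lemma closure_cspan_superset: "X \<subseteq> closure (cspan X)"
  using complex_vector.span_superset closure_subset by blast

lemma closure_cspan_minimal: "X \<subseteq> S \<Longrightarrow> closed_csub S \<Longrightarrow> closure (cspan X) \<subseteq> S"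
  by (simp add: closed_csub_def closure_minimal complex_vector.span_minimal)

lemma closed_csub_orthogonal:
  assumes "\<And>x. x \<in> X \<Longrightarrow> \<i> *\<^sub>C x \<in> X"
  shows "closed_csub {v. \<forall>x\<in>X. x \<bullet> v = 0}"
proof -
  have "closed {v. \<forall>x\<in>X. x \<bullet> v = 0}"
    unfolding Collect_ball_eq by (intro closed_INT ballI closed_Collect_eq continuous_intros)
  moreover have "x \<bullet> (c *\<^sub>C v) = 0" if "\<forall>x\<in>X. x \<bullet> v = 0" "x \<in> X" for c v x
    using that assms[of x] by (simp add: inner_scaleC_right)
  ultimately show ?thesis
    unfolding closed_csub_def complex_vector.subspace_def by (auto simp: inner_add_right)
qed

definition corth :: "'a::complex_inner set \<Rightarrow> 'a set" where
  "corth X = {v. \<forall>x\<in>X. cinner x v = 0}"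

lemma corth_iff: "v \<in> corth X \<longleftrightarrow> (\<forall>x\<in>X. x \<bullet> v = 0 \<and> (\<i> *\<^sub>C x) \<bullet> v = 0)"
  by (auto simp: corth_def cinner_eq complex_eq_iff inner_i_left)

text \<open>Rewrites \<open>corth\<close> as a real orthogonal complement of a set stable under i,
  the form that \<open>closed_csub_orthogonal\<close> needs.\<close>

lemma corth_conv: "corth (X :: 'a::complex_inner set) = {v. \<forall>x\<in>{c *\<^sub>C x |c x. x \<in> X}. x \<bullet> v = 0}" (is "_ = {v. \<forall>x\<in>?Y. _}")
proof (intro subset_antisym subsetI)
  fix v assume "v \<in> corth X"
  then have "(c *\<^sub>C x) \<bullet> v = 0" if "x \<in> X" for c x
    using that by (simp add: corth_iff inner_scaleC_left[of c])
  then show "v \<in> {v. \<forall>x\<in>?Y. x \<bullet> v = 0}" by blast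
next
  fix v assume "v \<in> {v. \<forall>x\<in>?Y. x \<bullet> v = 0}"
  then have "(c *\<^sub>C x) \<bullet> v = 0" if "x \<in> X" for c x using that by blast
  from this[of _ 1] this[of _ \<i>] show "v \<in> corth X" by (simp add: corth_iff)
qed

lemma closed_csub_corth: "closed_csub (corth (X::'a::complex_hilbert set))"
  unfolding corth_conv by (rule closed_csub_orthogonal) (auto simp: scaleC_scaleC, blast)

lemma corth_antimono: "X \<subseteq> Y \<Longrightarrow> corth Y \<subseteq> corth X"
  by (auto simp: corth_def)

lemma corth_Un: "corth (X \<union> Y) = corth X \<inter> corth Y"
  by (auto simp: corth_def)

lemma corth_sym: "Y \<subseteq> corth X \<longleftrightarrow> X \<subseteq> corth Y"
proof -
  have "cinner x y = 0 \<longleftrightarrow> cinner y x = 0" for x y :: 'a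
    by (subst cinner_commute) simp
  then show ?thesis by (auto simp: corth_def)
qed

lemma corth_closure_cspan [simp]: "corth (closure (cspan X)) = corth (X::'a::complex_hilbert set)"
proof
  show "corth (closure (cspan X)) \<subseteq> corth X" using closure_cspan_superset by (rule corth_antimono)
  have "X \<subseteq> corth (corth X)" using corth_sym by blast
  then have "closure (cspan X) \<subseteq> corth (corth X)"
    by (rule closure_cspan_minimal[OF _ closed_csub_corth])
  then show "corth X \<subseteq> corth (closure (cspan X))" using corth_sym by blast
qed

section \<open>The algebra of bounded operators\<close>

text \<open>A type of its own for the carrier makes the complex-linear operators a complete real
  normed algebra, so that limits, sums and powers come from type classes.\<close>

typedef (overloaded) 'a bop = "carrier (bounded_ops :: ('a::complex_hilbert \<Rightarrow>\<^sub>L 'a) ring)"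
  morphisms blin Bop
  by (intro exI[of _ 0]) (simp add: bounded_ops_def)

setup_lifting type_definition_bop

lemma carrier_bounded_ops: "T \<in> carrier bounded_ops \<longleftrightarrow> (\<forall>c x. blinfun_apply T (c *\<^sub>C x) = c *\<^sub>C blinfun_apply T x)"
  by (simp add: bounded_ops_def)

lift_definition app :: "'a::complex_hilbert bop \<Rightarrow> 'a \<Rightarrow> 'a" (infixr "\<cdot>" 75) is blinfun_apply .

lemma bop_eqI: "(\<And>x. S \<cdot> x = T \<cdot> x) \<Longrightarrow> S = T"
  by transfer (rule blinfun_eqI)

lemma bounded_linear_app: "bounded_linear (app T)"
  by transfer (rule blinfun.bounded_linear_right)

lemma app_scaleC: "T \<cdot> (c *\<^sub>C x) = c *\<^sub>C T \<cdot> x"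
  by transfer (simp add: carrier_bounded_ops)

lemmas app_add = linear_add[OF bounded_linear.linear[OF bounded_linear_app]]
  and app_diff = linear_diff[OF bounded_linear.linear[OF bounded_linear_app]]
  and app_minus = linear_neg[OF bounded_linear.linear[OF bounded_linear_app]]
  and app_scaleR = linear_scale[OF bounded_linear.linear[OF bounded_linear_app]]
  and app_sum = linear_sum[OF bounded_linear.linear[OF bounded_linear_app]]

lemma app_0 [simp]: "T \<cdot> 0 = 0"
  by (rule linear_0[OF bounded_linear.linear[OF bounded_linear_app]])

lemma closed_carrier_bounded_ops: "closed (carrier (bounded_ops :: ('a::complex_hilbert \<Rightarrow>\<^sub>L 'a) ring))"
proof -
  have "closed {T :: 'a \<Rightarrow>\<^sub>L 'a. blinfun_apply T (c *\<^sub>C x) = c *\<^sub>C blinfun_apply T x}" for c x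
  proof (rule closed_Collect_eq)
    show "continuous_on UNIV (\<lambda>T. c *\<^sub>C blinfun_apply T x)"
      by (intro linear_continuous_on bounded_linear_compose[OF bounded_linear_scaleC] blinfun.bounded_linear_left)
  qed (intro linear_continuous_on blinfun.bounded_linear_left)
  then have "closed (\<Inter>c. \<Inter>x. {T :: 'a \<Rightarrow>\<^sub>L 'a. blinfun_apply T (c *\<^sub>C x) = c *\<^sub>C blinfun_apply T x})"
    by (intro closed_INT ballI)
  moreover have "carrier (bounded_ops :: ('a \<Rightarrow>\<^sub>L 'a) ring) = (\<Inter>c. \<Inter>x. {T :: 'a \<Rightarrow>\<^sub>L 'a. blinfun_apply T (c *\<^sub>C x) = c *\<^sub>C blinfun_apply T x})"
    by (auto simp: carrier_bounded_ops)
  ultimately show ?thesis by simp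
qed

instantiation bop :: (complex_hilbert) real_normed_vector
begin

lift_definition zero_bop :: "'a bop" is 0 by (simp add: carrier_bounded_ops)
lift_definition plus_bop :: "'a bop \<Rightarrow> 'a bop \<Rightarrow> 'a bop" is "(+)"
  by (simp add: carrier_bounded_ops blinfun.add_left scaleC_add_right)
lift_definition minus_bop :: "'a bop \<Rightarrow> 'a bop \<Rightarrow> 'a bop" is "(-)"
  by (simp add: carrier_bounded_ops blinfun.diff_left complex_vector.scale_right_diff_distrib)
lift_definition uminus_bop :: "'a bop \<Rightarrow> 'a bop" is "uminus"
  by (simp add: carrier_bounded_ops blinfun.minus_left)
lift_definition scaleR_bop :: "real \<Rightarrow> 'a bop \<Rightarrow> 'a bop" is "scaleR"
  by (simp add: carrier_bounded_ops blinfun.scaleR_left scaleR_scaleC scaleC_scaleC mult.commute)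
lift_definition norm_bop :: "'a bop \<Rightarrow> real" is norm .
lift_definition dist_bop :: "'a bop \<Rightarrow> 'a bop \<Rightarrow> real" is dist .
definition "sgn (T :: 'a bop) = inverse (norm T) *\<^sub>R T"
definition "uniformity = (INF e\<in>{0<..}. principal {(x, y :: 'a bop). dist x y < e})"
definition "open (U :: 'a bop set) \<longleftrightarrow> (\<forall>x\<in>U. \<forall>\<^sub>F (x', y) in uniformity. x' = x \<longrightarrow> y \<in> U)"

instance
proof
  fix a b c :: "'a bop" and r s :: real
  show "a + b + c = a + (b + c)" by transfer (rule add.assoc)
  show "a + b = b + a" by transfer (rule add.commute)
  show "0 + a = a" by transfer simp
  show "- a + a = 0" by transfer simp
  show "a - b = a + - b" by transfer simp
  show "r *\<^sub>R (a + b) = r *\<^sub>R a + r *\<^sub>R b" by transfer (rule scaleR_add_right)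
  show "(r + s) *\<^sub>R a = r *\<^sub>R a + s *\<^sub>R a" by transfer (rule scaleR_add_left)
  show "r *\<^sub>R s *\<^sub>R a = (r * s) *\<^sub>R a" by transfer simp
  show "1 *\<^sub>R a = a" by transfer simp
  show "dist a b = norm (a - b)" by transfer (rule dist_norm)
  show "(norm a = 0) = (a = 0)" by transfer simp
  show "norm (a + b) \<le> norm a + norm b" by transfer (rule norm_triangle_ineq)
  show "norm (r *\<^sub>R a) = \<bar>r\<bar> * norm a" by transfer simp
  show "sgn a = inverse (norm a) *\<^sub>R a" by (rule sgn_bop_def)
qed (fact uniformity_bop_def open_bop_def)+

end

instantiation bop :: (complex_hilbert) real_normed_algebra
begin

lift_definition times_bop :: "'a bop \<Rightarrow> 'a bop \<Rightarrow> 'a bop" is "(o\<^sub>L)"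
  by (simp add: carrier_bounded_ops)

instance
  by (standard; transfer)
     (auto intro!: blinfun_eqI simp: blinfun.bilinear_simps norm_blinfun_compose)

end

instantiation bop :: (complex_hilbert) monoid_mult
begin

lift_definition one_bop :: "'a bop" is id_blinfun
  by (simp add: carrier_bounded_ops)

instance
  by (standard; transfer) (auto intro!: blinfun_eqI)

end

lemma app_simps [simp]:
  "0 \<cdot> x = 0" "1 \<cdot> x = x" "(S * T) \<cdot> x = S \<cdot> T \<cdot> x" "(S + T) \<cdot> x = S \<cdot> x + T \<cdot> x"
  "(S - T) \<cdot> x = S \<cdot> x - T \<cdot> x" "(- S) \<cdot> x = - (S \<cdot> x)" "(r *\<^sub>R S) \<cdot> x = r *\<^sub>R S \<cdot> x"
  by (transfer; simp add: blinfun.bilinear_simps)+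

lemma blin_simps:
  "blin 0 = 0" "blin 1 = id_blinfun" "blin (S * T) = blin S o\<^sub>L blin T" "blin (S + T) = blin S + blin T"
  "blin (S - T) = blin S - blin T" "blinfun_apply (blin S) x = S \<cdot> x" "norm (blin S) = norm S"
  by (transfer; simp)+

lemma norm_app: "norm (T \<cdot> x) \<le> norm T * norm x"
  by transfer (rule norm_blinfun)

lemma norm_bop_bound: "0 \<le> c \<Longrightarrow> (\<And>x. norm (T \<cdot> x) \<le> c * norm x) \<Longrightarrow> norm T \<le> c"
  by transfer (rule norm_blinfun_bound)

text \<open>Only an inequality, since the space may be zero.\<close>

lemma norm_1_le: "norm (1 :: 'a::complex_hilbert bop) \<le> 1"
  by (rule norm_bop_bound) simp_all

instance bop :: (complex_hilbert) banach
proof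
  fix X :: "nat \<Rightarrow> 'a bop" assume X: "Cauchy X"
  have "Cauchy (\<lambda>n. blin (X n))"
    using X unfolding Cauchy_def by (simp add: dist_bop.rep_eq)
  then obtain L where L: "(\<lambda>n. blin (X n)) \<longlonglongrightarrow> L"
    using Cauchy_convergent_iff convergent_def by blast
  have "L \<in> carrier bounded_ops"
    using closed_sequentially[OF closed_carrier_bounded_ops _ L] blin by blast
  then have "blin (Bop L) = L" by (rule Bop_inverse)
  then have "X \<longlonglongrightarrow> Bop L" using L
    by (simp add: tendsto_iff dist_bop.rep_eq)
  then show "convergent X" by (auto simp: convergent_def)
qed

lemma bounded_linear_app_left: "bounded_linear (\<lambda>T. T \<cdot> x)"
  by (rule bounded_linear_intro[where K="norm x"]) (auto simp: norm_app)

definition bop_of :: "('a::complex_hilbert \<Rightarrow> 'a) \<Rightarrow> 'a bop" where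
  "bop_of f = Bop (Blinfun f)"

lemma bop_of_app:
  assumes "bounded_linear f" "\<And>x. f (\<i> *\<^sub>C x) = \<i> *\<^sub>C f x"
  shows "bop_of f \<cdot> x = f x"
proof -
  interpret bounded_linear f by fact
  have "f (c *\<^sub>C x) = c *\<^sub>C f x" for c x
    by (subst scaleC_decompose, subst (2) scaleC_decompose) (simp add: add scaleR assms(2))
  then have "Blinfun f \<in> carrier bounded_ops"
    using assms(1) by (simp add: carrier_bounded_ops bounded_linear_Blinfun_apply)
  then show ?thesis
    by (simp add: bop_of_def app.rep_eq Bop_inverse bounded_linear_Blinfun_apply assms(1))
qed

text \<open>Scalars on \<open>bop\<close> are real. Complex ones enter through this central operator
  with square -1.\<close>

lift_definition ii :: "'a::complex_hilbert bop" is "Blinfun (\<lambda>x. \<i> *\<^sub>C x)"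
  by (simp add: carrier_bounded_ops bounded_linear_Blinfun_apply bounded_linear_i scaleC_scaleC mult.commute)

lemma ii_app [simp]: "ii \<cdot> x = \<i> *\<^sub>C x"
  by transfer (simp add: bounded_linear_Blinfun_apply bounded_linear_i)

lemma ii_ii: "ii * ii = (-1 :: 'a::complex_hilbert bop)"
  by (rule bop_eqI) simp

lemma ii_commute: "ii * T = T * ii"
  by (rule bop_eqI) (simp add: app_scaleC)

subsection \<open>Adjoints\<close>

lemma inner_eqI: "(\<And>x. x \<bullet> a = x \<bullet> b) \<Longrightarrow> a = (b :: 'a::real_inner)"
  by (metis inner_diff_right inner_eq_zero_iff right_minus_eq)

lemma adj_ex: "\<exists>S. \<forall>x y. (T \<cdot> x) \<bullet> y = x \<bullet> (S \<cdot> y)"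
proof -
  have "\<exists>z. \<forall>x. (T \<cdot> x) \<bullet> y = x \<bullet> z" for y
  proof -
    have "bounded_linear (\<lambda>x. (T \<cdot> x) \<bullet> y)"
      by (intro bounded_linear_inner_left_comp bounded_linear_app)
    from riesz[OF this] show ?thesis by metis
  qed
  then obtain g where g: "\<And>x y. (T \<cdot> x) \<bullet> y = x \<bullet> g y" by metis
  note eqI = inner_eqI
  have bl: "bounded_linear g"
  proof (rule bounded_linear_intro[where K="norm T"])
    show "g (x + y) = g x + g y" for x y by (rule eqI) (simp add: g[symmetric] inner_add_right)
    show "g (r *\<^sub>R x) = r *\<^sub>R g x" for r x by (rule eqI) (simp add: g[symmetric])
    show "norm (g y) \<le> norm y * norm T" for y
    proof -
      have "(norm (g y))\<^sup>2 = (T \<cdot> g y) \<bullet> y" by (simp add: g power2_norm_eq_inner)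
      also have "\<dots> \<le> norm (T \<cdot> g y) * norm y" by (rule norm_cauchy_schwarz)
      also have "\<dots> \<le> (norm T * norm (g y)) * norm y" by (intro mult_right_mono norm_app) auto
      finally have "norm (g y) * norm (g y) \<le> norm (g y) * (norm y * norm T)"
        by (simp add: power2_eq_square mult_ac)
      then show ?thesis
        by (cases "norm (g y) = 0") (auto simp: mult_le_cancel_left)
    qed
  qed
  moreover have "g (\<i> *\<^sub>C y) = \<i> *\<^sub>C g y" for y
  proof (rule eqI)
    fix x
    have "x \<bullet> g (\<i> *\<^sub>C y) = - ((\<i> *\<^sub>C T \<cdot> x) \<bullet> y)" by (simp add: inner_i_left g)
    also have "\<dots> = - ((\<i> *\<^sub>C x) \<bullet> g y)" by (simp flip: g app_scaleC)
    finally show "x \<bullet> g (\<i> *\<^sub>C y) = x \<bullet> (\<i> *\<^sub>C g y)" by (simp add: inner_i_left)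
  qed
  ultimately have "bop_of g \<cdot> y = g y" for y by (rule bop_of_app)
  then show ?thesis using g by metis
qed

text \<open>Formed with the real inner product; on complex-linear operators it is the usual adjoint,
  by \<open>adj_cinner\<close>.\<close>

definition adj :: "'a::complex_hilbert bop \<Rightarrow> 'a bop" where
  "adj T = (SOME S. \<forall>x y. (T \<cdot> x) \<bullet> y = x \<bullet> (S \<cdot> y))"

lemma adj_inner: "(T \<cdot> x) \<bullet> y = x \<bullet> (adj T \<cdot> y)"
  using someI_ex[OF adj_ex[of T]] unfolding adj_def by blast

lemma adj_inner': "(adj T \<cdot> x) \<bullet> y = x \<bullet> (T \<cdot> y)"
  by (metis adj_inner inner_commute)

lemma adj_unique:
  assumes "\<And>x y. (T \<cdot> x) \<bullet> y = x \<bullet> (S \<cdot> y)"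
  shows "adj T = S"
proof (rule bop_eqI, rule inner_eqI)
  fix x y show "x \<bullet> (adj T \<cdot> y) = x \<bullet> (S \<cdot> y)"
    by (rule trans[OF adj_inner[symmetric] assms])
qed

lemma adj_adj [simp]: "adj (adj T) = T"
  by (rule adj_unique) (rule adj_inner')

lemma adj_simps [simp]:
  "adj 0 = 0" "adj 1 = 1" "adj (S + T) = adj S + adj T" "adj (S - T) = adj S - adj T"
  "adj (- T) = - adj T" "adj (r *\<^sub>R T) = r *\<^sub>R adj T" "adj (S * T) = adj T * adj S" "adj ii = - ii"
  by (rule adj_unique; simp add: adj_inner inner_add_left inner_add_right inner_diff_left
        inner_diff_right inner_i_left)+

lemma adj_sum: "adj (sum f A) = (\<Sum>x\<in>A. adj (f x))"
  by (induction A rule: infinite_finite_induct) auto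

lemma norm_adj [simp]: "norm (adj T) = norm T"
proof -
  have "norm (adj T) \<le> norm T" for T :: "'a bop"
  proof (rule norm_bop_bound)
    fix x
    have "(norm (adj T \<cdot> x))\<^sup>2 = (T \<cdot> adj T \<cdot> x) \<bullet> x" by (simp add: adj_inner power2_norm_eq_inner)
    also have "\<dots> \<le> norm (T \<cdot> adj T \<cdot> x) * norm x" by (rule norm_cauchy_schwarz)
    also have "\<dots> \<le> (norm T * norm (adj T \<cdot> x)) * norm x" by (intro mult_right_mono norm_app) auto
    finally have "norm (adj T \<cdot> x) * norm (adj T \<cdot> x) \<le> norm (adj T \<cdot> x) * (norm T * norm x)"
      by (simp add: power2_eq_square mult_ac)
    then show "norm (adj T \<cdot> x) \<le> norm T * norm x"
      by (cases "norm (adj T \<cdot> x) = 0") (auto simp: mult_le_cancel_left)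
  qed simp
  from this[of T] this[of "adj T"] show ?thesis by simp
qed

lemma bounded_linear_adj: "bounded_linear adj"
  by (rule bounded_linear_intro[where K=1]) simp_all

subsection \<open>Positive operators\<close>

definition pos :: "'a::complex_hilbert bop \<Rightarrow> bool" where
  "pos T \<longleftrightarrow> adj T = T \<and> (\<forall>x. 0 \<le> (T \<cdot> x) \<bullet> x)"

lemma pos_adj: "pos T \<Longrightarrow> adj T = T" by (simp add: pos_def)

lemma pos_0 [simp]: "pos 0" by (simp add: pos_def)
lemma pos_1 [simp]: "pos 1" by (simp add: pos_def)
lemma pos_add: "pos S \<Longrightarrow> pos T \<Longrightarrow> pos (S + T)" by (simp add: pos_def inner_add_left)
lemma pos_scaleR: "pos T \<Longrightarrow> 0 \<le> r \<Longrightarrow> pos (r *\<^sub>R T)" by (simp add: pos_def)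
lemma pos_sum: "(\<And>i. i \<in> A \<Longrightarrow> pos (f i)) \<Longrightarrow> pos (sum f A)"
  by (induction A rule: infinite_finite_induct) (auto intro: pos_add)

lemma pos_conj: "pos T \<Longrightarrow> pos (adj S * T * S)"
  by (simp add: pos_def mult.assoc adj_inner')

lemma pos_conj_sa: "pos T \<Longrightarrow> adj S = S \<Longrightarrow> pos (S * T * S)"
  using pos_conj[of T S] by simp

lemma pos_adj_mult: "pos (adj S * S)"
  using pos_conj[of 1 S] by simp

lemma pos_lim: "X \<longlonglongrightarrow> L \<Longrightarrow> (\<And>n. pos (X n)) \<Longrightarrow> pos L"
proof -
  assume X: "X \<longlonglongrightarrow> L" and p: "\<And>n. pos (X n)"
  have "(\<lambda>n. adj (X n)) \<longlonglongrightarrow> adj L" by (rule bounded_linear.tendsto[OF bounded_linear_adj X])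
  then have "X \<longlonglongrightarrow> adj L" using p by (simp add: pos_adj)
  then have "adj L = L" using X by (rule LIMSEQ_unique)
  moreover have "0 \<le> (L \<cdot> x) \<bullet> x" for x
  proof (rule tendsto_lowerbound)
    show "(\<lambda>n. (X n \<cdot> x) \<bullet> x) \<longlonglongrightarrow> (L \<cdot> x) \<bullet> x"
      by (intro tendsto_inner tendsto_const bounded_linear.tendsto[OF bounded_linear_app_left X])
  qed (use p in \<open>auto simp: pos_def\<close>)
  ultimately show ?thesis by (simp add: pos_def)
qed

text \<open>Polarisation: for the multiple y of T x that has the norm of x, the product of T x and y
  is a difference of values of the quadratic form of T at x + y and x - y.\<close>

lemma norm_le_of_pos:
  assumes "pos (c *\<^sub>R 1 - T)" "pos (c *\<^sub>R 1 + T)" "0 \<le> c"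
  shows "norm T \<le> c"
proof (rule norm_bop_bound[OF \<open>0 \<le> c\<close>])
  have sa: "adj T = T" using pos_adj[OF assms(2)] by simp
  have up: "(T \<cdot> v) \<bullet> v \<le> c * (v \<bullet> v)" and lo: "- (c * (v \<bullet> v)) \<le> (T \<cdot> v) \<bullet> v" for v
    using assms(1,2) by (auto simp: pos_def inner_diff_left inner_add_left) (metis add.commute neg_le_iff_le le_add_same_cancel2 minus_le_iff le_minus_iff add_le_cancel_left diff_ge_0_iff_ge diff_minus_eq_add)
  fix x
  show "norm (T \<cdot> x) \<le> c * norm x"
  proof (cases "T \<cdot> x = 0 \<or> x = 0")
    case False
    define a where "a = norm x / norm (T \<cdot> x)"
    define y where "y = a *\<^sub>R T \<cdot> x"
    have a: "a > 0" using False by (simp add: a_def)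
    have ny: "norm y = norm x" using False by (simp add: y_def a_def)
    have "4 * ((T \<cdot> x) \<bullet> y) = (T \<cdot> (x + y)) \<bullet> (x + y) - (T \<cdot> (x - y)) \<bullet> (x - y)"
      using adj_inner[of T y x] sa
      by (simp add: app_add app_diff inner_add_left inner_add_right inner_diff_left inner_diff_right inner_commute)
    also have "\<dots> \<le> c * ((x + y) \<bullet> (x + y)) + c * ((x - y) \<bullet> (x - y))"
      using up[of "x + y"] lo[of "x - y"] by linarith
    also have "\<dots> = 2 * c * (x \<bullet> x) + 2 * c * (y \<bullet> y)"
      by (simp add: inner_add_left inner_add_right inner_diff_left inner_diff_right inner_commute algebra_simps)
    also have "y \<bullet> y = x \<bullet> x" using ny by (simp flip: power2_norm_eq_inner)
    finally have "(T \<cdot> x) \<bullet> y \<le> c * (norm x)\<^sup>2" by (simp add: power2_norm_eq_inner)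
    moreover have "(T \<cdot> x) \<bullet> y = norm x * norm (T \<cdot> x)"
      using False by (simp add: y_def a_def power2_norm_eq_inner[symmetric] power2_eq_square)
    ultimately show ?thesis using False by (simp add: power2_eq_square mult_ac)
  qed (auto simp: assms(3))
qed

lemma pos_norm_diff: "adj T = T \<Longrightarrow> norm T \<le> c \<Longrightarrow> pos (c *\<^sub>R 1 - T)"
  unfolding pos_def
proof (intro conjI allI)
  fix x assume T: "adj T = T" "norm T \<le> c"
  have "(T \<cdot> x) \<bullet> x \<le> norm (T \<cdot> x) * norm x" by (rule norm_cauchy_schwarz)
  also have "\<dots> \<le> (c * norm x) * norm x"
    using norm_app[of T x] mult_right_mono[OF T(2), of "norm x"] by (intro mult_right_mono) auto
  finally show "0 \<le> ((c *\<^sub>R 1 - T) \<cdot> x) \<bullet> x"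
    by (simp add: inner_diff_left power2_eq_square power2_norm_eq_inner[symmetric])
qed auto

lemma pos_norm_add: "adj T = T \<Longrightarrow> norm T \<le> c \<Longrightarrow> pos (c *\<^sub>R 1 + T)"
  using pos_norm_diff[of "-T" c] by simp

subsection \<open>Projections\<close>

definition isproj :: "'a::complex_hilbert bop \<Rightarrow> bool" where
  "isproj P \<longleftrightarrow> adj P = P \<and> P * P = P"

lemma isproj_0 [simp]: "isproj 0" and isproj_1 [simp]: "isproj 1"
  by (simp_all add: isproj_def)

lemma isproj_adj: "isproj P \<Longrightarrow> adj P = P" and isproj_idem: "isproj P \<Longrightarrow> P * P = P"
  by (simp_all add: isproj_def)

lemma isproj_compl: "isproj P \<Longrightarrow> isproj (1 - P)"
  by (simp add: isproj_def algebra_simps)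

lemma isproj_pos: "isproj P \<Longrightarrow> pos P"
  using pos_adj_mult[of P] by (simp add: isproj_def)

lemma isproj_norm: assumes "isproj P" shows "norm P \<le> 1"
  by (rule norm_le_of_pos) (use isproj_pos[OF assms] isproj_pos[OF isproj_compl[OF assms]] in \<open>auto intro: pos_add\<close>)

definition proj :: "'a::complex_hilbert set \<Rightarrow> 'a bop" where
  "proj S = bop_of (\<lambda>x. THE y. y \<in> S \<and> (\<forall>z\<in>S. (x - y) \<bullet> z = 0))"

lemma proj_props:
  assumes S: "closed_csub S"
  shows proj_in: "proj S \<cdot> x \<in> S" and proj_orth: "z \<in> S \<Longrightarrow> (x - proj S \<cdot> x) \<bullet> z = 0"
proof -
  define f where "f x = (THE y. y \<in> S \<and> (\<forall>z\<in>S. (x - y) \<bullet> z = 0))" for x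
  have uniq: "y = y'" if "y \<in> S" "\<forall>z\<in>S. (x - y) \<bullet> z = 0" "y' \<in> S" "\<forall>z\<in>S. (x - y') \<bullet> z = 0" for x y y'
  proof -
    have "y - y' \<in> S" using that closed_csubD(6)[OF S] by blast
    then have "(x - y') \<bullet> (y - y') - (x - y) \<bullet> (y - y') = 0" using that by simp
    then have "(y - y') \<bullet> (y - y') = 0" by (simp add: inner_diff_left algebra_simps)
    then show ?thesis by simp
  qed
  have f: "f x \<in> S \<and> (\<forall>z\<in>S. (x - f x) \<bullet> z = 0)" for x
    unfolding f_def
  proof (rule theI')
    show "\<exists>!y. y \<in> S \<and> (\<forall>z\<in>S. (x - y) \<bullet> z = 0)"
      using orthogonal_decomposition[OF closed_csubD(1,2)[OF S], of x] uniq by metis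
  qed
  have f_eqI: "f x = y" if "y \<in> S" "\<And>z. z \<in> S \<Longrightarrow> (x - y) \<bullet> z = 0" for x y
    using uniq that f by blast
  have bl: "bounded_linear f"
  proof (rule bounded_linear_intro[where K=1])
    show "f (x + y) = f x + f y" for x y
    proof (rule f_eqI)
      fix z assume "z \<in> S"
      then have "(x - f x) \<bullet> z = 0" "(y - f y) \<bullet> z = 0" using f by auto
      then show "(x + y - (f x + f y)) \<bullet> z = 0" by (simp add: inner_diff_left inner_add_left)
    qed (use f closed_csubD(5)[OF S] in blast)
    show "f (r *\<^sub>R x) = r *\<^sub>R f x" for r x
    proof (rule f_eqI)
      fix z assume "z \<in> S"
      then have "(x - f x) \<bullet> z = 0" using f by auto
      then show "(r *\<^sub>R x - (r *\<^sub>R f x)) \<bullet> z = 0" by (simp add: inner_diff_left)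
    qed (use f closed_csubD(1)[OF S] in \<open>auto intro: subspace_scale\<close>)
    show "norm (f x) \<le> norm x * 1" for x
    proof -
      have "(norm (f x))\<^sup>2 = x \<bullet> f x" using f[of x] by (simp add: power2_norm_eq_inner inner_diff_left)
      also have "\<dots> \<le> norm x * norm (f x)" by (rule norm_cauchy_schwarz)
      finally show ?thesis by (cases "f x = 0") (auto simp: power2_eq_square mult_le_cancel_right)
    qed
  qed
  have fi: "f (\<i> *\<^sub>C x) = \<i> *\<^sub>C f x" for x
  proof (rule f_eqI)
    fix z assume "z \<in> S"
    then have "(x - f x) \<bullet> (\<i> *\<^sub>C z) = 0" using f closed_csubD(3)[OF S] by blast
    then show "(\<i> *\<^sub>C x - \<i> *\<^sub>C f x) \<bullet> z = 0"
      by (simp add: inner_diff_left inner_i_left)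
  qed (use f closed_csubD(3)[OF S] in blast)
  have "proj S \<cdot> x = f x" unfolding proj_def f_def[symmetric] by (rule bop_of_app[OF bl fi])
  then show "proj S \<cdot> x \<in> S" "z \<in> S \<Longrightarrow> (x - proj S \<cdot> x) \<bullet> z = 0" using f by auto
qed

lemma proj_eqI:
  assumes S: "closed_csub S" and "y \<in> S" "\<And>z. z \<in> S \<Longrightarrow> (x - y) \<bullet> z = 0"
  shows "proj S \<cdot> x = y"
proof -
  let ?y = "proj S \<cdot> x"
  have "y - ?y \<in> S" using assms proj_in[OF S] closed_csubD(6)[OF S] by blast
  then have "(x - ?y) \<bullet> (y - ?y) - (x - y) \<bullet> (y - ?y) = 0" using assms proj_orth[OF S] by simp
  then have "(y - ?y) \<bullet> (y - ?y) = 0" by (simp add: inner_diff_left algebra_simps)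
  then show ?thesis by simp
qed

lemma proj_id: "closed_csub S \<Longrightarrow> x \<in> S \<Longrightarrow> proj S \<cdot> x = x"
  by (rule proj_eqI) auto

lemma proj_fix_iff: "closed_csub S \<Longrightarrow> proj S \<cdot> x = x \<longleftrightarrow> x \<in> S"
  by (metis proj_id proj_in)

lemma isproj_proj: assumes S: "closed_csub S" shows "isproj (proj S)"
proof -
  have "adj (proj S) = proj S"
  proof (rule adj_unique)
    fix x y
    show "(proj S \<cdot> x) \<bullet> y = x \<bullet> (proj S \<cdot> y)"
      using proj_orth[OF S proj_in[OF S], of x y] proj_orth[OF S proj_in[OF S], of y x]
      by (simp add: inner_diff_left inner_diff_right inner_commute)
  qed
  moreover have "proj S * proj S = proj S"
    by (rule bop_eqI) (simp add: proj_id[OF S proj_in[OF S]])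
  ultimately show ?thesis by (simp add: isproj_def)
qed

lemma proj_0_iff: assumes S: "closed_csub S" shows "proj S \<cdot> x = 0 \<longleftrightarrow> x \<in> corth S"
proof
  assume "proj S \<cdot> x = 0"
  then have "z \<bullet> x = 0" if "z \<in> S" for z using proj_orth[OF S that, of x] by (simp add: inner_commute)
  then show "x \<in> corth S" using closed_csubD(3)[OF S] by (auto simp: corth_iff)
next
  assume "x \<in> corth S"
  then show "proj S \<cdot> x = 0"
    by (intro proj_eqI[OF S]) (auto simp: closed_csubD(4)[OF S] corth_iff inner_commute)
qed

lemma proj_cong_app: "closed_csub S \<Longrightarrow> proj S * T = T \<longleftrightarrow> (\<forall>x. T \<cdot> x \<in> S)"
  by (metis app_simps(3) bop_eqI proj_fix_iff)

lemma closed_csub_ker: "closed_csub {x. T \<cdot> x = 0}"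
proof -
  have "closed {x. T \<cdot> x = 0}"
    by (intro closed_Collect_eq continuous_on_const linear_continuous_on bounded_linear_app)
  then show ?thesis
    by (auto simp: closed_csub_def complex_vector.subspace_def app_add app_scaleC)
qed

lemma closed_csub_fix: "closed_csub {x. P \<cdot> x = x}"
  using closed_csub_ker[of "P - 1"] by simp

text \<open>Both sides equal \<open>proj S * T * proj S'\<close>: one by the invariance under T, the
  other by taking adjoints in the invariance under \<open>adj T\<close>.\<close>

lemma proj_commute:
  assumes S: "closed_csub S" "closed_csub S'"
    and T: "\<And>x. x \<in> S' \<Longrightarrow> T \<cdot> x \<in> S" "\<And>x. x \<in> S \<Longrightarrow> adj T \<cdot> x \<in> S'"
  shows "proj S * T = T * proj S'"
proof -
  have 1: "proj S * (T * proj S') = T * proj S'"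
    using T(1) proj_in[OF S(2)] by (simp add: proj_cong_app[OF S(1)])
  have "proj S' * (adj T * proj S) = adj T * proj S"
    using T(2) proj_in[OF S(1)] by (simp add: proj_cong_app[OF S(2)])
  then have "adj (proj S' * (adj T * proj S)) = adj (adj T * proj S)" by simp
  then have "proj S * T * proj S' = proj S * T"
    using isproj_adj[OF isproj_proj[OF S(1)]] isproj_adj[OF isproj_proj[OF S(2)]] by simp
  with 1 show ?thesis by (simp add: mult.assoc)
qed

section \<open>Continuous functional calculus\<close>

text \<open>De Casteljau's recursion for the Bernstein sum with weights binomial(n,k) A^k (1 -
  A)^(n-k). It needs no binomial coefficients, and operator-valued F allow sums to be
  nested.\<close>

fun bern :: "'a::complex_hilbert bop \<Rightarrow> nat \<Rightarrow> (nat \<Rightarrow> 'a bop) \<Rightarrow> 'a bop" where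
  "bern A 0 F = F 0"
| "bern A (Suc n) F = A * bern A n (\<lambda>k. F (Suc k)) + (1 - A) * bern A n F"

lemma bern_cong: "(\<And>k. k \<le> n \<Longrightarrow> F k = G k) \<Longrightarrow> bern A n F = bern A n G"
proof (induction n arbitrary: F G)
  case (Suc n)
  have "bern A n (\<lambda>k. F (Suc k)) = bern A n (\<lambda>k. G (Suc k))" "bern A n F = bern A n G"
    by (rule Suc.IH; simp add: Suc.prems)+
  then show ?case by simp
qed simp

lemma bern_add: "bern A n (\<lambda>k. F k + G k) = bern A n F + bern A n G"
  by (induction n arbitrary: F G) (simp_all add: algebra_simps)

lemma bern_scaleR: "bern A n (\<lambda>k. r *\<^sub>R F k) = r *\<^sub>R bern A n F"
  by (induction n arbitrary: F) (simp_all add: algebra_simps)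

lemma bern_minus: "bern A n (\<lambda>k. - F k) = - bern A n F"
  using bern_scaleR[of A n "-1" F] by simp

lemma bern_diff: "bern A n (\<lambda>k. F k - G k) = bern A n F - bern A n G"
  using bern_add[of A n F "\<lambda>k. - G k"] by (simp add: bern_minus)

lemma bern_mult_right: "bern A n (\<lambda>k. F k * G) = bern A n F * G"
  by (induction n arbitrary: F) (simp_all add: algebra_simps)

lemma bern_1: "bern A n (\<lambda>k. 1) = 1"
  by (induction n) simp_all

lemma bern_const: "bern A n (\<lambda>k. G) = G"
  using bern_mult_right[of A n "\<lambda>k. 1" G] by (simp add: bern_1)

text \<open>With \<open>bern_moment2\<close>: the first two moments of a binomial variable whose
  success probability is the operator A.\<close>

lemma bern_moment1: "bern A n (\<lambda>k. real k *\<^sub>R 1) = real n *\<^sub>R A"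
proof (induction n)
  case (Suc n)
  have "(\<lambda>k. real (Suc k) *\<^sub>R (1 :: 'a bop)) = (\<lambda>k. real k *\<^sub>R 1 + 1)"
    by (simp add: fun_eq_iff scaleR_left_distrib)
  then have "bern A n (\<lambda>k. real (Suc k) *\<^sub>R 1) = real n *\<^sub>R A + 1"
    by (simp only: bern_add Suc bern_1)
  then show ?case by (simp only: bern.simps Suc) (simp add: algebra_simps)
qed simp

lemma bern_moment2: "bern A n (\<lambda>k. (real k)\<^sup>2 *\<^sub>R 1) = real n *\<^sub>R A + (real n * (real n - 1)) *\<^sub>R (A * A)"
proof (induction n)
  case (Suc n)
  have "(\<lambda>k. (real (Suc k))\<^sup>2 *\<^sub>R 1) = (\<lambda>k. (real k)\<^sup>2 *\<^sub>R 1 + (2 *\<^sub>R (real k *\<^sub>R 1) + (1 :: 'a bop)))"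
    by (rule ext) (simp add: power2_eq_square scaleR_left_distrib distrib_left distrib_right scaleR_2)
  then have "bern A n (\<lambda>k. (real (Suc k))\<^sup>2 *\<^sub>R 1) =
      real n *\<^sub>R A + (real n * (real n - 1)) *\<^sub>R (A * A) + 2 *\<^sub>R real n *\<^sub>R A + 1"
    by (simp only: bern_add bern_scaleR bern_moment1 bern_1 Suc add.assoc)
  moreover have "(real n * 2) *\<^sub>R (A * A) = real n *\<^sub>R (A * A) + real n *\<^sub>R (A * A)"
    by (simp flip: scaleR_left_distrib)
  ultimately show ?case
    by (simp only: bern.simps Suc)
       (simp add: algebra_simps)
qed simp

subsection \<open>The cone generated by two complementary positive operators\<close>

text \<open>Polynomials in a and b with nonnegative coefficients, generated by left multiplication
  to match the recursion of \<open>bern\<close>.\<close>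

inductive_set cone :: "'a::complex_hilbert bop \<Rightarrow> 'a bop \<Rightarrow> 'a bop set" for a b where
  cone_scale: "0 \<le> r \<Longrightarrow> r *\<^sub>R 1 \<in> cone a b"
| cone_add: "x \<in> cone a b \<Longrightarrow> y \<in> cone a b \<Longrightarrow> x + y \<in> cone a b"
| cone_a: "0 \<le> r \<Longrightarrow> x \<in> cone a b \<Longrightarrow> r *\<^sub>R (a * x) \<in> cone a b"
| cone_b: "0 \<le> r \<Longrightarrow> x \<in> cone a b \<Longrightarrow> r *\<^sub>R (b * x) \<in> cone a b"

text \<open>Since a + b is scalar, a and b commute. Conjugation by a or b lowers an exponent of a
  monomial by 2, which leaves the exponents at most 1; there ab = (aba + bab)/c is positive.\<close>

lemma cone_pos:
  assumes a: "pos a" and b: "pos b" and ab: "a + b = c *\<^sub>R 1" "c > 0" and x: "x \<in> cone a b"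
  shows "pos x"
proof -
  have b_eq: "b = c *\<^sub>R 1 - a" using ab(1) by (simp add: algebra_simps)
  have comm: "a * b = b * a" by (simp add: b_eq algebra_simps)
  have comm': "b * a ^ i = a ^ i * b" for i
    by (induction i) (simp_all add: comm mult.assoc flip: comm, metis comm mult.assoc)
  have "pos (a ^ i * b ^ j)" for i j
  proof (induction "i + j" arbitrary: i j rule: less_induct)
    case less
    consider (a) i' where "i = Suc (Suc i')" | (b) j' where "j = Suc (Suc j')" | (c) "i \<le> 1" "j \<le> 1"
      by (metis One_nat_def Suc_le_mono le0 not0_implies_Suc)
    then show ?case
    proof cases
      case a
      have *: "a * b ^ j = b ^ j * a" by (induction j) (simp_all add: comm, metis comm mult.assoc)
      have "pos (a * (a ^ i' * b ^ j) * a)" using less a \<open>pos a\<close> by (intro pos_conj_sa) (auto simp: pos_adj)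
      also have "a * (a ^ i' * b ^ j) * a = a ^ i * b ^ j"
        using a * by (simp add: mult.assoc power_commutes; metis mult.assoc power_commutes)
      finally show ?thesis .
    next
      case b
      have "pos (b * (a ^ i * b ^ j') * b)" using less b \<open>pos b\<close> by (intro pos_conj_sa) (auto simp: pos_adj)
      also have "b * (a ^ i * b ^ j') * b = a ^ i * b ^ j"
        using b comm'[of i] by (simp add: mult.assoc power_commutes; metis mult.assoc power_commutes)
      finally show ?thesis .
    next
      case c
      have "pos (a * b)"
      proof -
        have "pos ((1/c) *\<^sub>R (a * b * a + b * a * b))"
          using a b ab by (intro pos_scaleR pos_add pos_conj_sa) (auto simp: pos_adj)
        also have "a * b * a + b * a * b = a * b * (a + b)"
          by (simp add: distrib_left mult.assoc comm; metis comm mult.assoc)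
        also have "(1/c) *\<^sub>R \<dots> = a * b" using ab by simp
        finally show ?thesis .
      qed
      then show ?thesis using c a b by (auto simp: le_Suc_eq)
    qed
  qed
  then have ij: "pos (a ^ i * b ^ j)" for i j .
  \<comment> \<open>The monomial prefix strengthens the induction: multiplying by a or b merely
    raises an exponent.\<close>
  have "pos (a ^ i * (b ^ j * x))" for i j using x
  proof (induction arbitrary: i j)
    case (cone_scale r)
    then show ?case using ij[of i j] by (simp add: pos_scaleR)
  next
    case (cone_add x y)
    then show ?case by (simp add: distrib_left pos_add)
  next
    case (cone_a r x)
    have "b ^ j * (a * x) = a * (b ^ j * x)" for j
      by (induction j) (simp_all add: mult.assoc, metis comm mult.assoc)
    then have "a ^ i * (b ^ j * (a * x)) = a ^ Suc i * (b ^ j * x)"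
      by (simp add: mult.assoc power_commutes; metis mult.assoc power_commutes)
    then show ?case using cone_a(1) cone_a.IH[of "Suc i" j] by (simp add: pos_scaleR)
  next
    case (cone_b r x)
    have "b ^ j * (b * x) = b ^ Suc j * x" by (simp add: power_commutes flip: mult.assoc)
    then show ?case using cone_b(1) cone_b.IH[of i "Suc j"] by (simp add: pos_scaleR)
  qed
  from this[of 0 0] show ?thesis by simp
qed

text \<open>The shifts s and s' admit an interval larger than the one that defines a and b, so that
  Bernstein sums over two nested intervals lie in one cone.\<close>

lemma bern_cone:
  assumes "A = r *\<^sub>R (a + s *\<^sub>R 1)" "1 - A = r' *\<^sub>R (b + s' *\<^sub>R 1)" "0 \<le> r" "0 \<le> r'" "0 \<le> s" "0 \<le> s'"
    and "\<And>k. k \<le> n \<Longrightarrow> F k \<in> cone a b"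
  shows "bern A n F \<in> cone a b"
  using assms(7)
proof (induction n arbitrary: F)
  case (Suc n)
  have scale: "t *\<^sub>R x \<in> cone a b" if "x \<in> cone a b" "0 \<le> t" for t x
    using that by (induction) (auto simp: scaleR_right.add scaleR_scaleR intro: cone.intros simp del: scaleR_scaleR
        simp flip: scaleR_scaleR, (metis cone.intros mult_nonneg_nonneg scaleR_scaleR)+)
  have 1: "bern A n (\<lambda>k. F (Suc k)) \<in> cone a b" "bern A n F \<in> cone a b" using Suc by auto
  have eq: "A * x = r *\<^sub>R (a * x) + (r * s) *\<^sub>R x" "(1 - A) * x = r' *\<^sub>R (b * x) + (r' * s') *\<^sub>R x" for x
    by (simp add: assms(1) algebra_simps) (simp only: assms(2), simp add: algebra_simps)
  show ?case unfolding bern.simps eq using 1 assms(3-6)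
    by (intro cone.cone_add cone.cone_a cone.cone_b scale mult_nonneg_nonneg) auto
qed simp

subsection \<open>Bernstein approximations\<close>

definition spec_in :: "real \<Rightarrow> real \<Rightarrow> 'a::complex_hilbert bop \<Rightarrow> bool" where
  "spec_in lo hi A \<longleftrightarrow> pos (A - lo *\<^sub>R 1) \<and> pos (hi *\<^sub>R 1 - A)"

definition unit_scale :: "real \<Rightarrow> real \<Rightarrow> 'a::complex_hilbert bop \<Rightarrow> 'a bop" where
  "unit_scale lo hi A = (1 / (hi - lo)) *\<^sub>R (A - lo *\<^sub>R 1)"

definition bnode :: "real \<Rightarrow> real \<Rightarrow> nat \<Rightarrow> nat \<Rightarrow> real" where
  "bnode lo hi n k = lo + (hi - lo) * (real k / real n)"

definition bapprox :: "real \<Rightarrow> real \<Rightarrow> nat \<Rightarrow> (real \<Rightarrow> real) \<Rightarrow> 'a::complex_hilbert bop \<Rightarrow> 'a bop" where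
  "bapprox lo hi n f A = bern (unit_scale lo hi A) n (\<lambda>k. f (bnode lo hi n k) *\<^sub>R 1)"

lemma bnode_in: "k \<le> n \<Longrightarrow> lo < hi \<Longrightarrow> bnode lo hi n k \<in> {lo..hi}"
proof -
  assume "k \<le> n" "lo < hi"
  then have "0 \<le> real k / real n" "real k / real n \<le> 1" by (auto simp: divide_le_eq_1)
  then have "0 \<le> (hi - lo) * (real k / real n)" "(hi - lo) * (real k / real n) \<le> (hi - lo) * 1"
    using \<open>lo < hi\<close> by (auto intro!: mult_left_mono mult_nonneg_nonneg simp del: times_divide_eq_right mult_1_right)
  then show ?thesis by (simp add: bnode_def)
qed

lemma spec_in_adj: "spec_in lo hi A \<Longrightarrow> adj A = A"
  by (auto simp: spec_in_def dest: pos_adj)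

lemma spec_in_norm: "adj A = A \<Longrightarrow> norm A \<le> c \<Longrightarrow> spec_in (- c) c A"
  using pos_norm_add[of A c] pos_norm_diff[of A c] by (simp add: spec_in_def add.commute)

text \<open>The correction in the second identity is the variance of the node under the binomial
  weights; its factor 1/n drives every convergence below.\<close>

lemma bapprox_moments:
  fixes A :: "'a::complex_hilbert bop"
  assumes "lo < hi" "n > 0"
  shows "bapprox lo hi n (\<lambda>x. x) A = A"
    and "bapprox lo hi n (\<lambda>x. x\<^sup>2) A = A * A + ((hi - lo)\<^sup>2 / n) *\<^sub>R (unit_scale lo hi A - unit_scale lo hi A * unit_scale lo hi A)"
proof -
  define U where "U = unit_scale lo hi A"
  define c where "c = hi - lo"
  have A: "A = lo *\<^sub>R 1 + c *\<^sub>R U" using assms by (simp add: U_def c_def unit_scale_def)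
  have b1: "bnode lo hi n k = lo + (c / n) * k" for k
    by (simp add: bnode_def c_def)
  have n1: "bnode lo hi n k *\<^sub>R (1 :: 'a bop) = lo *\<^sub>R 1 + (c / n) *\<^sub>R (real k *\<^sub>R 1)" for k
    unfolding b1 scaleR_left_distrib by simp
  have "bapprox lo hi n (\<lambda>x. x) A = lo *\<^sub>R 1 + (c / n) *\<^sub>R real n *\<^sub>R U"
    unfolding bapprox_def n1 bern_add bern_scaleR[of _ _ "c / n"] bern_moment1 bern_const U_def ..
  also have "\<dots> = A" using assms by (simp add: A)
  finally show "bapprox lo hi n (\<lambda>x. x) A = A" .
  have "(bnode lo hi n k)\<^sup>2 = lo\<^sup>2 + (2 * lo * c / n) * k + (c\<^sup>2 / (real n)\<^sup>2) * (real k)\<^sup>2" for k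
    using assms(2) by (simp add: b1 power2_eq_square field_simps)
  then have n2: "(bnode lo hi n k)\<^sup>2 *\<^sub>R (1 :: 'a bop) = lo\<^sup>2 *\<^sub>R 1 + (2 * lo * c / n) *\<^sub>R (real k *\<^sub>R 1)
      + (c\<^sup>2 / (real n)\<^sup>2) *\<^sub>R ((real k)\<^sup>2 *\<^sub>R 1)" for k
    by (simp only: scaleR_left_distrib scaleR_scaleR)
  have "bapprox lo hi n (\<lambda>x. x\<^sup>2) A = lo\<^sup>2 *\<^sub>R 1 + (2 * lo * c / n) *\<^sub>R real n *\<^sub>R U
      + (c\<^sup>2 / (real n)\<^sup>2) *\<^sub>R (real n *\<^sub>R U + (real n * (real n - 1)) *\<^sub>R (U * U))"
    unfolding bapprox_def n2 bern_add bern_scaleR[of _ _ "2 * lo * c / n"]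
      bern_scaleR[of _ _ "c\<^sup>2 / (real n)\<^sup>2"] bern_moment1 bern_moment2 bern_const U_def ..
  also have "\<dots> = lo\<^sup>2 *\<^sub>R 1 + (2 * lo * c) *\<^sub>R U + ((c\<^sup>2 / n) *\<^sub>R U + (c\<^sup>2 - c\<^sup>2 / n) *\<^sub>R (U * U))"
  proof -
    have e: "c\<^sup>2 / (real n)\<^sup>2 * real n = c\<^sup>2 / n"
      "c\<^sup>2 / (real n)\<^sup>2 * (real n * (real n - 1)) = c\<^sup>2 - c\<^sup>2 / n"
      "2 * lo * c / n * real n = 2 * lo * c"
      using assms(2) by (simp_all add: field_simps power2_eq_square)
    show ?thesis by (simp only: scaleR_right_distrib scaleR_scaleR e)
  qed
  also have "\<dots> = A * A + (c\<^sup>2 / n) *\<^sub>R (U - U * U)"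
  proof -
    have "A * A = (lo *\<^sub>R 1 + c *\<^sub>R U) * (lo *\<^sub>R 1 + c *\<^sub>R U)" by (simp only: A[symmetric])
    also have "\<dots> = lo\<^sup>2 *\<^sub>R 1 + ((lo * c) *\<^sub>R U + (lo * c) *\<^sub>R U) + c\<^sup>2 *\<^sub>R (U * U)"
      by (simp add: distrib_left distrib_right scaleR_right_distrib power2_eq_square mult.commute[of c lo] add.assoc)
    also have "(lo * c) *\<^sub>R U + (lo * c) *\<^sub>R U = (2 * lo * c) *\<^sub>R U"
      by (simp flip: scaleR_left_distrib)
    finally show ?thesis by (simp add: scaleR_left_diff_distrib scaleR_right_diff_distrib)
  qed
  finally show "bapprox lo hi n (\<lambda>x. x\<^sup>2) A = A * A + ((hi - lo)\<^sup>2 / n) *\<^sub>R (unit_scale lo hi A - unit_scale lo hi A * unit_scale lo hi A)"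
    by (simp add: U_def c_def)
qed

text \<open>Joint Bernstein sums over a pair of intervals: the analogue of Chebyshev's inequality in
  Bernstein's proof of the Weierstrass theorem. Two intervals are needed to see that the functional
  calculus does not depend on the interval.\<close>

lemma bern_double_bound:
  assumes A: "spec_in lo hi A" and I: "lo < hi" "lo' \<le> lo" "hi \<le> hi'" and nm: "n > 0" "m > 0"
    and h: "\<And>k l. k \<le> n \<Longrightarrow> l \<le> m \<Longrightarrow> \<bar>h k l\<bar> \<le> e + K * (bnode lo hi n k - bnode lo' hi' m l)\<^sup>2"
    and eK: "0 \<le> e" "0 \<le> K"
  shows "norm (bern (unit_scale lo hi A) n (\<lambda>k. bern (unit_scale lo' hi' A) m (\<lambda>l. h k l *\<^sub>R 1)))
    \<le> e + K * ((hi - lo)\<^sup>2 * norm (unit_scale lo hi A - unit_scale lo hi A * unit_scale lo hi A) / n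
      + (hi' - lo')\<^sup>2 * norm (unit_scale lo' hi' A - unit_scale lo' hi' A * unit_scale lo' hi' A) / m)"
proof -
  let ?U = "unit_scale lo hi A" and ?V = "unit_scale lo' hi' A"
  let ?a = "A - lo *\<^sub>R 1" and ?b = "hi *\<^sub>R 1 - A"
  define B where "B g = bern ?U n (\<lambda>k. bern ?V m (\<lambda>l. g k l *\<^sub>R 1))" for g :: "nat \<Rightarrow> nat \<Rightarrow> real"
  have ab: "?a + ?b = (hi - lo) *\<^sub>R 1" by (simp add: scaleR_left.diff)
  have U: "?U = (1 / (hi - lo)) *\<^sub>R (?a + 0 *\<^sub>R 1)" "1 - ?U = (1 / (hi - lo)) *\<^sub>R (?b + 0 *\<^sub>R 1)"
  proof -
    have "(1 / (hi - lo)) *\<^sub>R (?a + ?b) = 1" unfolding ab using I by simp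
    then show "1 - ?U = (1 / (hi - lo)) *\<^sub>R (?b + 0 *\<^sub>R 1)"
      by (simp add: unit_scale_def scaleR_right.add algebra_simps)
  qed (simp add: unit_scale_def)
  have V: "?V = (1 / (hi' - lo')) *\<^sub>R (?a + (lo - lo') *\<^sub>R 1)" "1 - ?V = (1 / (hi' - lo')) *\<^sub>R (?b + (hi' - hi) *\<^sub>R 1)"
  proof -
    have "(1 / (hi' - lo')) *\<^sub>R ((A - lo' *\<^sub>R 1) + (hi' *\<^sub>R 1 - A)) = 1"
      using I by (simp flip: scaleR_left.diff)
    then show "1 - ?V = (1 / (hi' - lo')) *\<^sub>R (?b + (hi' - hi) *\<^sub>R 1)"
      by (simp add: unit_scale_def scaleR_right.add algebra_simps)
  qed (simp add: unit_scale_def algebra_simps)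
  have Bpos: "pos (B g)" if "\<And>k l. k \<le> n \<Longrightarrow> l \<le> m \<Longrightarrow> 0 \<le> g k l" for g
  proof (rule cone_pos[OF _ _ ab])
    show "B g \<in> cone ?a ?b" unfolding B_def
      by (rule bern_cone[OF U], use I in simp, use I in simp, simp, simp,
          rule bern_cone[OF V], use I in simp, use I in simp, use I in simp, use I in simp,
          rule cone.cone_scale, rule that)
  qed (use A I in \<open>auto simp: spec_in_def\<close>)
  have Badd: "B (\<lambda>k l. g k l + g' k l) = B g + B g'" for g g'
    by (simp add: B_def scaleR_left.add bern_add)
  have Bmul: "B (\<lambda>k l. r * g k l) = r *\<^sub>R B g" for r g
  proof -
    have "B (\<lambda>k l. r * g k l) = bern ?U n (\<lambda>k. bern ?V m (\<lambda>l. r *\<^sub>R (g k l *\<^sub>R 1)))" by (simp add: B_def)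
    then show ?thesis unfolding bern_scaleR[of _ _ r] B_def .
  qed
  have prod: "B (\<lambda>k l. f k * g l) = bern ?U n (\<lambda>k. f k *\<^sub>R 1) * bern ?V m (\<lambda>l. g l *\<^sub>R 1)" for f g
  proof -
    have "bern ?V m (\<lambda>l. (f k * g l) *\<^sub>R 1) = (f k *\<^sub>R 1) * bern ?V m (\<lambda>l. g l *\<^sub>R 1)" for k
      using bern_scaleR[of ?V m "f k" "\<lambda>l. g l *\<^sub>R 1"] by simp
    then show ?thesis unfolding B_def by (simp only: bern_mult_right)
  qed
  let ?x = "bnode lo hi n" and ?y = "bnode lo' hi' m"
  let ?W = "((hi - lo)\<^sup>2 / n) *\<^sub>R (?U - ?U * ?U)" and ?W' = "((hi' - lo')\<^sup>2 / m) *\<^sub>R (?V - ?V * ?V)"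
  have lh': "lo' < hi'" using I by simp
  have 1: "bern ?V m (\<lambda>l. 1 *\<^sub>R 1) = 1" "bern ?U n (\<lambda>l. 1 *\<^sub>R 1) = 1" by (simp_all add: bern_1)
  \<comment> \<open>The two second moments and the mixed term cancel up to the two
    variances.\<close>
  have "B (\<lambda>k l. (?x k - ?y l)\<^sup>2) = B (\<lambda>k l. (?x k)\<^sup>2 * 1 + ((-2) * (?x k * ?y l) + 1 * (?y l)\<^sup>2))"
    by (rule arg_cong[of _ _ B]) (simp add: fun_eq_iff power2_eq_square algebra_simps)
  also have "\<dots> = B (\<lambda>k l. (?x k)\<^sup>2 * 1) + ((-2) *\<^sub>R B (\<lambda>k l. ?x k * ?y l) + B (\<lambda>k l. 1 * (?y l)\<^sup>2))"
    by (simp only: Badd Bmul)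
  also have "\<dots> = A * A + ?W + ((-2) *\<^sub>R (A * A) + (A * A + ?W'))"
    unfolding prod 1 using bapprox_moments[OF I(1) nm(1), of A] bapprox_moments[OF lh' nm(2), of A]
    by (simp add: bapprox_def)
  also have "\<dots> = ?W + ?W'" by (simp add: scaleR_2)
  finally have var: "B (\<lambda>k l. (?x k - ?y l)\<^sup>2) = ?W + ?W'" .
  define c where "c = (hi - lo)\<^sup>2 * norm (?U - ?U * ?U) / n + (hi' - lo')\<^sup>2 * norm (?V - ?V * ?V) / m"
  have "norm (?W + ?W') \<le> norm ?W + norm ?W'" by (rule norm_triangle_ineq)
  also have "\<dots> = c" by (simp add: c_def)
  finally have nW: "norm (?W + ?W') \<le> c" .
  have "0 \<le> c" using norm_ge_zero nW by (rule order_trans)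
  have posW: "pos (?W + ?W')" unfolding var[symmetric] by (rule Bpos) simp
  have Bone: "B (\<lambda>k l. r) = r *\<^sub>R 1" for r by (simp add: B_def bern_const)
  have pW: "pos (K *\<^sub>R (c *\<^sub>R 1 - (?W + ?W')))"
    by (intro pos_scaleR pos_norm_diff pos_adj[OF posW] nW eK)
  have "pos (B (\<lambda>k l. e + K * (?x k - ?y l)\<^sup>2 + s * h k l))" if "\<bar>s\<bar> = 1" for s
  proof (rule Bpos)
    fix k l assume "k \<le> n" "l \<le> m"
    from h[OF this] that show "0 \<le> e + K * (?x k - ?y l)\<^sup>2 + s * h k l"
      by (cases "s \<ge> 0") (auto simp: abs_if split: if_splits)
  qed
  then have "pos (e *\<^sub>R 1 + K *\<^sub>R (?W + ?W') + s *\<^sub>R B h)" if "\<bar>s\<bar> = 1" for s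
    using that by (simp only: Badd Bmul Bone var)
  from pos_add[OF this pW] have p: "pos ((e + K * c) *\<^sub>R 1 + s *\<^sub>R B h)" if "\<bar>s\<bar> = 1" for s
    using that by (simp add: algebra_simps)
  have "norm (B h) \<le> e + K * c"
    by (rule norm_le_of_pos) (use p[of 1] p[of "-1"] \<open>0 \<le> c\<close> eK in auto)
  then show ?thesis by (simp add: B_def c_def)
qed

text \<open>At distance less than d uniform continuity gives e; at distance at least d the quadratic
  term alone covers the oscillation, at most twice the bound M of f, which explains the choice of
  K.\<close>

lemma continuous_quadratic_modulus:
  fixes f :: "real \<Rightarrow> real"
  assumes f: "continuous_on UNIV f" and "e > 0"
  obtains K where "K \<ge> 0" "\<And>x y. x \<in> {lo..hi} \<Longrightarrow> y \<in> {lo..hi} \<Longrightarrow> \<bar>f x - f y\<bar> \<le> e + K * (x - y)\<^sup>2"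
proof -
  have c: "continuous_on {lo..hi} f" using f continuous_on_subset by blast
  have "uniformly_continuous_on {lo..hi} f"
    by (rule compact_uniformly_continuous[OF c]) simp
  then obtain d where d: "d > 0" "\<And>x y. x \<in> {lo..hi} \<Longrightarrow> y \<in> {lo..hi} \<Longrightarrow> dist x y < d \<Longrightarrow> dist (f x) (f y) < e"
    using \<open>e > 0\<close> unfolding uniformly_continuous_on_def by metis
  have "bounded (f ` {lo..hi})"
    by (intro compact_imp_bounded compact_continuous_image c) simp
  then obtain M where "\<forall>y\<in>f ` {lo..hi}. \<bar>y\<bar> \<le> M" by (auto simp only: bounded_iff real_norm_def)
  then have M: "\<bar>f x\<bar> \<le> M" if "x \<in> {lo..hi}" for x using that by blast
  define K where "K = 2 * \<bar>M\<bar> / d\<^sup>2"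
  have "\<bar>f x - f y\<bar> \<le> e + K * (x - y)\<^sup>2" if xy: "x \<in> {lo..hi}" "y \<in> {lo..hi}" for x y
  proof (cases "dist x y < d")
    case True
    then have "\<bar>f x - f y\<bar> < e" using d(2)[OF xy] by (simp add: dist_real_def)
    moreover have "0 \<le> K * (x - y)\<^sup>2" by (simp add: K_def)
    ultimately show ?thesis by simp
  next
    case False
    then have "d\<^sup>2 \<le> (x - y)\<^sup>2" using d(1) by (simp add: dist_real_def abs_le_square_iff[symmetric])
    then have "K * d\<^sup>2 \<le> K * (x - y)\<^sup>2" by (intro mult_left_mono) (auto simp: K_def)
    moreover have "K * d\<^sup>2 = 2 * \<bar>M\<bar>" using d(1) by (simp add: K_def)
    ultimately show ?thesis using M[OF xy(1)] M[OF xy(2)] \<open>e > 0\<close> by linarith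
  qed
  moreover have "K \<ge> 0" by (simp add: K_def)
  ultimately show thesis using that by blast
qed

lemma real_archimedean_divide:
  fixes c e :: real
  assumes "e > 0" obtains N :: nat where "N > 0" "\<And>n. n \<ge> N \<Longrightarrow> c / n \<le> e"
proof -
  obtain N :: nat where N: "N > 0" "c / e \<le> N"
    by (metis gr0I less_imp_le of_nat_0 of_nat_0_less_iff order.trans real_arch_simple reals_Archimedean2 le_less_linear)
  have "c / n \<le> e" if "n \<ge> N" for n
  proof -
    have "c / e \<le> n" using N that by linarith
    then show ?thesis using N that \<open>e > 0\<close> by (simp add: field_simps)
  qed
  then show thesis using that N by blast
qed

text \<open>Equal intervals give the Cauchy property, nested ones the independence of the
  interval.\<close>

lemma bapprox_difference:
  assumes A: "spec_in lo hi A" and I: "lo < hi" "lo' \<le> lo" "hi \<le> hi'" and f: "continuous_on UNIV f" and "e > 0"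
  obtains N where "\<And>n m. n \<ge> N \<Longrightarrow> m \<ge> N \<Longrightarrow> norm (bapprox lo hi n f A - bapprox lo' hi' m f A) \<le> e"
proof -
  let ?U = "unit_scale lo hi A" and ?V = "unit_scale lo' hi' A"
  let ?x = "bnode lo hi" and ?y = "bnode lo' hi'"
  have "e / 2 > 0" using \<open>e > 0\<close> by simp
  then obtain K where K: "K \<ge> 0" "\<And>x y. x \<in> {lo'..hi'} \<Longrightarrow> y \<in> {lo'..hi'} \<Longrightarrow> \<bar>f x - f y\<bar> \<le> e / 2 + K * (x - y)\<^sup>2"
    using continuous_quadratic_modulus[OF f] by metis
  define C where "C = (hi - lo)\<^sup>2 * norm (?U - ?U * ?U)"
  define C' where "C' = (hi' - lo')\<^sup>2 * norm (?V - ?V * ?V)"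
  have e4: "e / 4 > 0" using \<open>e > 0\<close> by simp
  obtain N1 where N1: "N1 > 0" "\<And>n. n \<ge> N1 \<Longrightarrow> K * C / real n \<le> e / 4" using real_archimedean_divide[OF e4] by metis
  obtain N2 where N2: "N2 > 0" "\<And>n. n \<ge> N2 \<Longrightarrow> K * C' / real n \<le> e / 4" using real_archimedean_divide[OF e4] by metis
  have "norm (bapprox lo hi n f A - bapprox lo' hi' m f A) \<le> e" if n: "n \<ge> max N1 N2" and m: "m \<ge> max N1 N2" for n m
  proof -
    have nm: "n > 0" "m > 0" using n m N1 N2 by auto
    have "norm (bern ?U n (\<lambda>k. bern ?V m (\<lambda>l. (f (?x n k) - f (?y m l)) *\<^sub>R 1))) \<le> e / 2 + K * (C / n + C' / m)"
      unfolding C_def C'_def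
    proof (rule bern_double_bound[OF A I nm])
      fix k l assume "k \<le> n" "l \<le> m"
      then show "\<bar>f (?x n k) - f (?y m l)\<bar> \<le> e / 2 + K * (?x n k - ?y m l)\<^sup>2"
        using K(2) bnode_in[of k n lo hi] bnode_in[of l m lo' hi'] I by auto
    qed (use K \<open>e > 0\<close> in auto)
    also have "\<dots> = e / 2 + (K * C / n + K * C' / m)" by (simp add: distrib_left)
    also have "\<dots> \<le> e / 2 + (e / 4 + e / 4)" using N1(2)[of n] N2(2)[of m] n m by (intro add_mono) auto
    finally show ?thesis
      by (simp add: scaleR_left_diff_distrib bern_diff bern_const bapprox_def)
  qed
  then show thesis using that by blast
qed

text \<open>The difference is the double Bernstein sum of g(x_k) (f(x_k) - f(x_l)), to which the
  Chebyshev bound applies.\<close>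

lemma bapprox_mult:
  assumes A: "spec_in lo hi A" and I: "lo < hi" and f: "continuous_on UNIV f" and g: "continuous_on UNIV g"
  shows "(\<lambda>n. bapprox lo hi n (\<lambda>x. g x * f x) A - bapprox lo hi n g A * bapprox lo hi n f A) \<longlonglongrightarrow> 0"
proof (rule LIMSEQ_I)
  fix e :: real assume "e > 0"
  let ?U = "unit_scale lo hi A" and ?x = "bnode lo hi"
  have "bounded (g ` {lo..hi})"
    by (intro compact_imp_bounded compact_continuous_image continuous_on_subset[OF g]) auto
  then obtain M where "\<forall>y\<in>g ` {lo..hi}. \<bar>y\<bar> \<le> M" by (auto simp only: bounded_iff real_norm_def)
  then have M: "\<bar>g x\<bar> \<le> \<bar>M\<bar> + 1" if "x \<in> {lo..hi}" for x using that by force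
  define B where "B = \<bar>M\<bar> + 1"
  have "B > 0" by (simp add: B_def)
  then have "e / (3 * B) > 0" using \<open>e > 0\<close> by simp
  then obtain K where K: "K \<ge> 0" "\<And>x y. x \<in> {lo..hi} \<Longrightarrow> y \<in> {lo..hi} \<Longrightarrow> \<bar>f x - f y\<bar> \<le> e / (3 * B) + K * (x - y)\<^sup>2"
    using continuous_quadratic_modulus[OF f] by metis
  define C where "C = (hi - lo)\<^sup>2 * norm (?U - ?U * ?U)"
  have "e / 3 > 0" using \<open>e > 0\<close> by simp
  then obtain N where N: "N > 0" "\<And>n. n \<ge> N \<Longrightarrow> (2 * B * K * C) / real n \<le> e / 3" using real_archimedean_divide by metis
  have "norm (bapprox lo hi n (\<lambda>x. g x * f x) A - bapprox lo hi n g A * bapprox lo hi n f A - 0) < e" if n: "n \<ge> N" for n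
  proof -
    have n0: "n > 0" using n N by auto
    have "norm (bern ?U n (\<lambda>k. bern ?U n (\<lambda>l. (g (?x n k) * (f (?x n k) - f (?x n l))) *\<^sub>R 1)))
       \<le> e / 3 + (B * K) * (C / n + C / n)"
      unfolding C_def
    proof (rule bern_double_bound[OF A I order_refl order_refl n0 n0])
      fix k l assume kl: "k \<le> n" "l \<le> n"
      have "\<bar>g (?x n k) * (f (?x n k) - f (?x n l))\<bar> \<le> B * (e / (3 * B) + K * (?x n k - ?x n l)\<^sup>2)"
        unfolding abs_mult using K(2) M bnode_in[OF kl(1) I] bnode_in[OF kl(2) I] \<open>B > 0\<close>
        by (intro mult_mono) (auto simp: B_def)
      also have "\<dots> = e / 3 + B * K * (?x n k - ?x n l)\<^sup>2" using \<open>B > 0\<close> by (simp add: distrib_left)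
      finally show "\<bar>g (?x n k) * (f (?x n k) - f (?x n l))\<bar> \<le> e / 3 + B * K * (?x n k - ?x n l)\<^sup>2" .
    qed (use K \<open>e > 0\<close> \<open>B > 0\<close> in auto)
    also have "\<dots> = e / 3 + 2 * B * K * C / n" by (simp add: algebra_simps)
    also have "\<dots> < e" using N(2)[OF n] \<open>e > 0\<close> by linarith
    finally have *: "norm (bern ?U n (\<lambda>k. bern ?U n (\<lambda>l. (g (?x n k) * (f (?x n k) - f (?x n l))) *\<^sub>R 1))) < e" .
    have "bern ?U n (\<lambda>l. (g (?x n k) * (f (?x n k) - f (?x n l))) *\<^sub>R 1)
      = (g (?x n k) * f (?x n k)) *\<^sub>R 1 - (g (?x n k) *\<^sub>R 1) * bapprox lo hi n f A" for k
      using bern_scaleR[of ?U n "g (?x n k)" "\<lambda>l. f (?x n l) *\<^sub>R 1"]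
      by (simp add: right_diff_distrib scaleR_left_diff_distrib bern_diff bern_const bapprox_def)
    with * show ?thesis by (simp only: bern_diff bern_mult_right) (simp add: bapprox_def)
  qed
  then show "\<exists>no. \<forall>n\<ge>no. norm (bapprox lo hi n (\<lambda>x. g x * f x) A - bapprox lo hi n g A * bapprox lo hi n f A - 0) < e"
    by blast
qed

subsection \<open>The functional calculus\<close>

text \<open>The margin 1 keeps the interval nondegenerate for A = 0. By \<open>fc_lim\<close> every
  interval that contains the spectrum yields the same operator.\<close>

definition fc :: "'a::complex_hilbert bop \<Rightarrow> (real \<Rightarrow> real) \<Rightarrow> 'a bop" where
  "fc A f = lim (\<lambda>n. bapprox (- (norm A + 1)) (norm A + 1) n f A)"

lemma fc_lim:
  assumes A: "spec_in lo hi A" and "lo < hi" and f: "continuous_on UNIV f"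
  shows "(\<lambda>n. bapprox lo hi n f A) \<longlonglongrightarrow> fc A f"
proof -
  define N where "N = norm A + 1"
  \<comment> \<open>A common larger interval, with which the given one and the one in the definition
    of \<open>fc\<close> are both compared.\<close>
  define lo' where "lo' = min lo (- N)"
  define hi' where "hi' = max hi N"
  have N: "spec_in (- N) N A" using spec_in_adj[OF A] by (intro spec_in_norm) (auto simp: N_def)
  have "N > 0" by (simp add: N_def add_nonneg_pos)
  then have NN: "- N < N" by simp
  have diff: "(\<lambda>n. bapprox l h n f A - bapprox lo' hi' n f A) \<longlonglongrightarrow> 0"
    if s: "spec_in l h A" and lh: "l < h" "lo' \<le> l" "h \<le> hi'" for l h
  proof (rule LIMSEQ_I)
    fix e :: real assume "e > 0"
    then have e2: "e / 2 > 0" by simp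
    obtain M where "\<And>n m. n \<ge> M \<Longrightarrow> m \<ge> M \<Longrightarrow> norm (bapprox l h n f A - bapprox lo' hi' m f A) \<le> e / 2"
      using bapprox_difference[OF s lh f e2] by blast
    then have "norm (bapprox l h n f A - bapprox lo' hi' n f A - 0) < e" if "n \<ge> M" for n
      using that \<open>e > 0\<close> by fastforce
    then show "\<exists>no. \<forall>n\<ge>no. norm (bapprox l h n f A - bapprox lo' hi' n f A - 0) < e" by blast
  qed
  have "Cauchy (\<lambda>n. bapprox (- N) N n f A)"
  proof (rule metric_CauchyI)
    fix e :: real assume "e > 0"
    then have e2: "e / 2 > 0" by simp
    obtain M where "\<And>n m. n \<ge> M \<Longrightarrow> m \<ge> M \<Longrightarrow> norm (bapprox (- N) N n f A - bapprox (- N) N m f A) \<le> e / 2"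
      using bapprox_difference[OF N NN order_refl order_refl f e2] by blast
    then have "dist (bapprox (- N) N n f A) (bapprox (- N) N m f A) < e" if "n \<ge> M" "m \<ge> M" for n m
      using that \<open>e > 0\<close> unfolding dist_norm by fastforce
    then show "\<exists>M. \<forall>m\<ge>M. \<forall>n\<ge>M. dist (bapprox (- N) N m f A) (bapprox (- N) N n f A) < e" by blast
  qed
  then have lim: "(\<lambda>n. bapprox (- N) N n f A) \<longlonglongrightarrow> fc A f"
    unfolding fc_def N_def[symmetric] using Cauchy_convergent_iff convergent_LIMSEQ_iff by blast
  have d1: "(\<lambda>n. bapprox lo hi n f A - bapprox lo' hi' n f A) \<longlonglongrightarrow> 0"
    using assms by (intro diff) (auto simp: lo'_def hi'_def)
  have d2: "(\<lambda>n. bapprox (- N) N n f A - bapprox lo' hi' n f A) \<longlonglongrightarrow> 0"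
    using N NN by (intro diff) (auto simp: lo'_def hi'_def)
  show ?thesis using tendsto_add[OF tendsto_diff[OF d1 d2] lim] by simp
qed

lemma adj_spec: "adj A = A \<Longrightarrow> spec_in (- (norm A + 1)) (norm A + 1) A"
  by (rule spec_in_norm) auto

lemma norm_interval: "- (norm A + 1) < norm A + (1::real)"
  using norm_ge_zero[of A] by linarith

lemmas fc_lim' = fc_lim[OF adj_spec norm_interval]

lemma fc_eqI:
  assumes "adj A = A" "continuous_on UNIV f" "(\<lambda>n. bapprox (- (norm A + 1)) (norm A + 1) n f A) \<longlonglongrightarrow> L"
  shows "fc A f = L"
  using fc_lim'[OF assms(1,2)] assms(3) by (rule LIMSEQ_unique)

lemma fc_const: assumes "adj A = A" shows "fc A (\<lambda>_. c) = c *\<^sub>R 1"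
  by (rule fc_eqI[OF assms]) (simp_all add: bapprox_def bern_const)

lemma fc_id: assumes "adj A = A" shows "fc A (\<lambda>x. x) = A"
proof (rule fc_eqI[OF assms])
  have "\<forall>\<^sub>F n in sequentially. bapprox (- (norm A + 1)) (norm A + 1) n (\<lambda>x. x) A = A"
    using eventually_gt_at_top[of 0] by eventually_elim (rule bapprox_moments(1)[OF norm_interval])
  then show "(\<lambda>n. bapprox (- (norm A + 1)) (norm A + 1) n (\<lambda>x. x) A) \<longlonglongrightarrow> A"
    by (rule tendsto_eventually)
qed auto

lemma fc_add:
  assumes "adj A = A" "continuous_on UNIV f" "continuous_on UNIV g"
  shows "fc A (\<lambda>x. f x + g x) = fc A f + fc A g"
proof (rule fc_eqI[OF assms(1)])
  show "(\<lambda>n. bapprox (- (norm A + 1)) (norm A + 1) n (\<lambda>x. f x + g x) A) \<longlonglongrightarrow> fc A f + fc A g"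
    using tendsto_add[OF fc_lim'[OF assms(1,2)] fc_lim'[OF assms(1,3)]]
    by (simp add: bapprox_def scaleR_left_distrib bern_add)
qed (intro continuous_intros assms)

lemma fc_scaleR:
  assumes "adj A = A" "continuous_on UNIV f"
  shows "fc A (\<lambda>x. r * f x) = r *\<^sub>R fc A f"
proof (rule fc_eqI[OF assms(1)])
  have "bapprox l h n (\<lambda>x. r * f x) A = r *\<^sub>R bapprox l h n f A" for l h n
    using bern_scaleR[of _ n r "\<lambda>k. f (bnode l h n k) *\<^sub>R 1"] by (simp add: bapprox_def)
  then show "(\<lambda>n. bapprox (- (norm A + 1)) (norm A + 1) n (\<lambda>x. r * f x) A) \<longlonglongrightarrow> r *\<^sub>R fc A f"
    using tendsto_scaleR[OF tendsto_const fc_lim'[OF assms]] by simp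
qed (intro continuous_intros assms)

lemma fc_diff:
  assumes "adj A = A" "continuous_on UNIV f" "continuous_on UNIV g"
  shows "fc A (\<lambda>x. f x - g x) = fc A f - fc A g"
  using fc_add[OF assms(1,2), of "\<lambda>x. (-1) * g x"] fc_scaleR[OF assms(1,3), of "-1"] assms(3)
  by (simp add: continuous_on_minus)

lemma fc_mult:
  assumes "adj A = A" "continuous_on UNIV f" "continuous_on UNIV g"
  shows "fc A (\<lambda>x. f x * g x) = fc A f * fc A g"
proof (rule fc_eqI[OF assms(1)])
  show "(\<lambda>n. bapprox (- (norm A + 1)) (norm A + 1) n (\<lambda>x. f x * g x) A) \<longlonglongrightarrow> fc A f * fc A g"
    using tendsto_add[OF bapprox_mult[OF adj_spec[OF assms(1)] norm_interval assms(3,2)]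
        tendsto_mult[OF fc_lim'[OF assms(1,2)] fc_lim'[OF assms(1,3)]]]
    by simp
qed (intro continuous_intros assms)

lemma bapprox_pos:
  assumes A: "spec_in lo hi A" and I: "lo < hi" and f: "\<And>x. x \<in> {lo..hi} \<Longrightarrow> 0 \<le> f x"
  shows "pos (bapprox lo hi n f A)"
proof -
  let ?a = "A - lo *\<^sub>R 1" and ?b = "hi *\<^sub>R 1 - A"
  have ab: "?a + ?b = (hi - lo) *\<^sub>R 1" by (simp add: scaleR_left.diff)
  have U: "unit_scale lo hi A = (1 / (hi - lo)) *\<^sub>R (?a + 0 *\<^sub>R 1)" "1 - unit_scale lo hi A = (1 / (hi - lo)) *\<^sub>R (?b + 0 *\<^sub>R 1)"
  proof -
    have "(1 / (hi - lo)) *\<^sub>R (?a + ?b) = 1" unfolding ab using I by simp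
    then show "1 - unit_scale lo hi A = (1 / (hi - lo)) *\<^sub>R (?b + 0 *\<^sub>R 1)"
      by (simp add: unit_scale_def scaleR_right.add algebra_simps)
  qed (simp add: unit_scale_def)
  show ?thesis
  proof (rule cone_pos[OF _ _ ab])
    show "bapprox lo hi n f A \<in> cone ?a ?b" unfolding bapprox_def
      by (rule bern_cone[OF U], use I in simp, use I in simp, simp, simp,
          rule cone.cone_scale, rule f, rule bnode_in[OF _ I])
  qed (use A I in \<open>auto simp: spec_in_def\<close>)
qed

lemma fc_pos:
  assumes "spec_in lo hi A" "lo < hi" "continuous_on UNIV f" "\<And>x. x \<in> {lo..hi} \<Longrightarrow> 0 \<le> f x"
  shows "pos (fc A f)"
  using fc_lim[OF assms(1-3)] bapprox_pos[OF assms(1,2,4)] by (rule pos_lim)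

lemma fc_pos': "adj A = A \<Longrightarrow> continuous_on UNIV f \<Longrightarrow> (\<And>x. 0 \<le> f x) \<Longrightarrow> pos (fc A f)"
  by (rule fc_pos[OF adj_spec norm_interval])

text \<open>Bernstein approximations on [lo, hi] evaluate the function at nodes of that interval
  only.\<close>

lemma fc_cong:
  assumes A: "spec_in lo hi A" "lo < hi" and f: "continuous_on UNIV f" "continuous_on UNIV g"
    and eq: "\<And>x. x \<in> {lo..hi} \<Longrightarrow> f x = g x"
  shows "fc A f = fc A g"
proof -
  have "bapprox lo hi n f A = bapprox lo hi n g A" for n
    unfolding bapprox_def using eq bnode_in[OF _ A(2)] by (intro bern_cong) simp
  then show ?thesis using fc_lim[OF A f(1)] fc_lim[OF A f(2)] LIMSEQ_unique by simp
qed

text \<open>Positivity includes self-adjointness, so it suffices to split f into a difference of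
  nonnegative functions.\<close>

lemma fc_adj:
  assumes A: "adj A = A" and f: "continuous_on UNIV f"
  shows "adj (fc A f) = fc A f"
proof -
  have "continuous_on UNIV (\<lambda>x. max (f x) 0)" "continuous_on UNIV (\<lambda>x. max (- f x) 0)"
    by (intro continuous_intros f)+
  note c = this
  have "fc A f = fc A (\<lambda>x. max (f x) 0 - max (- f x) 0)"
    by (rule arg_cong[of _ _ "fc A"]) (auto simp: fun_eq_iff max_def)
  also have "\<dots> = fc A (\<lambda>x. max (f x) 0) - fc A (\<lambda>x. max (- f x) 0)" by (rule fc_diff[OF A c])
  finally show ?thesis using fc_pos'[OF A c(1)] fc_pos'[OF A c(2)] by (simp add: pos_adj)
qed

lemma fc_norm:
  assumes A: "spec_in lo hi A" "lo < hi" and f: "continuous_on UNIV f" and c: "\<And>x. x \<in> {lo..hi} \<Longrightarrow> \<bar>f x\<bar> \<le> c"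
  shows "norm (fc A f) \<le> c"
proof (rule norm_le_of_pos)
  note sa = spec_in_adj[OF A(1)]
  have "0 \<le> c - f x" "0 \<le> c + f x" if "x \<in> {lo..hi}" for x using c[OF that] by linarith+
  then have "pos (fc A (\<lambda>x. c - f x))" "pos (fc A (\<lambda>x. c + f x))"
    by (intro fc_pos[OF A] continuous_intros f; blast)+
  then show "pos (c *\<^sub>R 1 - fc A f)" "pos (c *\<^sub>R 1 + fc A f)"
    using f by (simp_all add: fc_diff[OF sa] fc_add[OF sa] fc_const[OF sa])
  show "0 \<le> c" using c[of lo] A(2) by auto
qed

subsection \<open>Intertwining modulo a closed ideal\<close>

definition op_ideal :: "'a::complex_hilbert bop set \<Rightarrow> bool" where
  "op_ideal I \<longleftrightarrow> closed I \<and> 0 \<in> I \<and> (\<forall>x\<in>I. \<forall>y\<in>I. x + y \<in> I) \<and> (\<forall>x\<in>I. \<forall>T. T * x \<in> I \<and> x * T \<in> I)"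

lemma op_ideal_zero: "op_ideal {0}"
  by (simp add: op_ideal_def)

lemma op_idealD:
  assumes "op_ideal I"
  shows "closed I" "0 \<in> I" "x \<in> I \<Longrightarrow> y \<in> I \<Longrightarrow> x + y \<in> I" "x \<in> I \<Longrightarrow> T * x \<in> I" "x \<in> I \<Longrightarrow> x * T \<in> I"
    "x \<in> I \<Longrightarrow> - x \<in> I" "x \<in> I \<Longrightarrow> y \<in> I \<Longrightarrow> x - y \<in> I" "x \<in> I \<Longrightarrow> r *\<^sub>R x \<in> I"
proof -
  show 1: "closed I" "0 \<in> I" "x \<in> I \<Longrightarrow> y \<in> I \<Longrightarrow> x + y \<in> I" "x \<in> I \<Longrightarrow> T * x \<in> I" "x \<in> I \<Longrightarrow> x * T \<in> I" for x y T
    using assms by (auto simp: op_ideal_def)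
  show 2: "x \<in> I \<Longrightarrow> r *\<^sub>R x \<in> I" for r x using 1(4)[of x "r *\<^sub>R 1"] by simp
  show 3: "x \<in> I \<Longrightarrow> - x \<in> I" for x using 2[of x "-1"] by simp
  show "x \<in> I \<Longrightarrow> y \<in> I \<Longrightarrow> x - y \<in> I" using 1(3)[of x "- y"] 3 by simp
qed

text \<open>The relation passes to Bernstein polynomials through their recursion and to the limit
  because I is closed. In applications V is a test operator that singles out a part of the joint
  spectrum on which X looks like Y.\<close>

lemma fc_intertwine:
  assumes I: "op_ideal I" and X: "adj X = X" and Y: "adj Y = Y" and f: "continuous_on UNIV f"
    and XY: "X * V - V * Y \<in> I"
  shows "fc X f * V - V * fc Y f \<in> I"
proof -
  \<comment> \<open>One interval for both operators, so that their Bernstein sums have the same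
    coefficients.\<close>
  define c where "c = max (norm X) (norm Y) + 1"
  have "c > 0" by (simp add: c_def add_nonneg_pos le_max_iff_disj)
  then have cc: "- c < c" by simp
  have sX: "spec_in (- c) c X" and sY: "spec_in (- c) c Y"
    by (intro spec_in_norm X Y; simp add: c_def)+
  let ?U = "unit_scale (- c) c X" and ?W = "unit_scale (- c) c Y"
  have "?U * V - V * ?W = (1 / (2 * c)) *\<^sub>R (X * V - V * Y)"
    by (simp add: unit_scale_def algebra_simps)
  then have UW: "?U * V - V * ?W \<in> I" using op_idealD(8)[OF I XY] by simp
  have "bern ?U n (\<lambda>k. h k *\<^sub>R 1) * V - V * bern ?W n (\<lambda>k. h k *\<^sub>R 1) \<in> I" for n h
  proof (induction n arbitrary: h)
    case 0
    then show ?case using op_idealD(2)[OF I] by simp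
  next
    case (Suc n)
    let ?P = "\<lambda>h. bern ?U n (\<lambda>k. h k *\<^sub>R 1)" and ?Q = "\<lambda>h. bern ?W n (\<lambda>k. h k *\<^sub>R 1)"
    let ?h = "\<lambda>k. h (Suc k)"
    have "bern ?U (Suc n) (\<lambda>k. h k *\<^sub>R 1) * V - V * bern ?W (Suc n) (\<lambda>k. h k *\<^sub>R 1)
      = ?U * (?P ?h * V - V * ?Q ?h) + (?U * V - V * ?W) * ?Q ?h + ((1 - ?U) * (?P h * V - V * ?Q h) - (?U * V - V * ?W) * ?Q h)"
      by (simp add: algebra_simps)
    moreover have "\<dots> \<in> I"
      by (rule op_idealD(3)[OF I op_idealD(3)[OF I op_idealD(4)[OF I Suc.IH] op_idealD(5)[OF I UW]]
            op_idealD(7)[OF I op_idealD(4)[OF I Suc.IH] op_idealD(5)[OF I UW]]])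
    ultimately show ?case by simp
  qed
  then have "bapprox (- c) c n f X * V - V * bapprox (- c) c n f Y \<in> I" for n by (simp add: bapprox_def)
  moreover have "(\<lambda>n. bapprox (- c) c n f X * V - V * bapprox (- c) c n f Y) \<longlonglongrightarrow> fc X f * V - V * fc Y f"
    by (intro tendsto_intros fc_lim[OF sX cc f] fc_lim[OF sY cc f])
  ultimately show ?thesis by (rule closed_sequentially[OF op_idealD(1)[OF I]])
qed

lemma fc_intertwine_exact:
  assumes "adj X = X" "adj Y = Y" "continuous_on UNIV f" "X * V = V * Y"
  shows "fc X f * V = V * fc Y f"
  using fc_intertwine[OF op_ideal_zero assms(1-3), of V] assms(4) by simp

section \<open>Spectral projections\<close>

definition pospart :: "'a::complex_hilbert bop \<Rightarrow> 'a bop" where "pospart X = fc X (\<lambda>t. max t 0)"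
definition negpart :: "'a::complex_hilbert bop \<Rightarrow> 'a bop" where "negpart X = fc X (\<lambda>t. max (- t) 0)"

text \<open>The spectral projection of a self-adjoint operator for the interval from minus infinity to 0.\<close>

definition neg :: "'a::complex_hilbert bop \<Rightarrow> 'a bop" where "neg X = proj {x. pospart X \<cdot> x = 0}"

lemma isproj_neg [simp]: "isproj (neg X)"
  by (simp add: neg_def isproj_proj closed_csub_ker)

lemma adj_neg [simp]: "adj (neg X) = neg X"
  by (rule isproj_adj) simp

lemma neg_neg [simp]: "neg X * neg X = neg X"
  by (rule isproj_idem) simp

lemma continuous_parts: "continuous_on UNIV (\<lambda>t::real. max t 0)" "continuous_on UNIV (\<lambda>t::real. max (- t) 0)"
  by (intro continuous_intros)+

text \<open>The product of the positive and the negative part is 0, so the range of the negative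
  part lies in the kernel of the positive part.\<close>

lemma neg_props:
  assumes X: "adj X = X"
  shows "adj (pospart X) = pospart X" "adj (negpart X) = negpart X"
    "X * (1 - neg X) = pospart X" "(1 - neg X) * X = pospart X" "X * neg X = - negpart X" "neg X * X = - negpart X"
proof -
  let ?p = "pospart X" and ?n = "negpart X"
  show p: "adj ?p = ?p" and n: "adj ?n = ?n"
    by (simp_all add: pospart_def negpart_def fc_adj[OF X] continuous_parts)
  have "X = fc X (\<lambda>t. max t 0 - max (- t) 0)"
    by (subst fc_id[OF X, symmetric]) (rule arg_cong[of _ _ "fc X"], auto simp: fun_eq_iff max_def)
  then have X_eq: "X = ?p - ?n"
    by (simp add: fc_diff[OF X continuous_parts] pospart_def negpart_def)
  have "?p * ?n = fc X (\<lambda>t. max t 0 * max (- t) 0)"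
    by (simp add: fc_mult[OF X continuous_parts] pospart_def negpart_def)
  also have "(\<lambda>t::real. max t 0 * max (- t) 0) = (\<lambda>_. 0)" by (auto simp: fun_eq_iff max_def)
  finally have pn: "?p * ?n = 0" using fc_const[OF X, of 0] by simp
  have 1: "neg X * ?n = ?n"
    unfolding neg_def proj_cong_app[OF closed_csub_ker]
    using arg_cong[OF pn, of "\<lambda>T. T \<cdot> _"] by simp
  have 2: "?p * neg X = 0"
    by (rule bop_eqI) (use proj_in[OF closed_csub_ker[of ?p]] in \<open>simp add: neg_def\<close>)
  have 3: "?n * neg X = ?n" using arg_cong[OF 1, of adj] n by simp
  have 4: "neg X * ?p = 0" using arg_cong[OF 2, of adj] p by simp
  show "X * (1 - neg X) = pospart X" "(1 - neg X) * X = pospart X" "X * neg X = - negpart X" "neg X * X = - negpart X"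
    by (subst X_eq, simp add: algebra_simps 1 2 3 4)+
qed

text \<open>V and \<open>adj V\<close> intertwine the positive parts, hence map the two kernels into
  each other.\<close>

lemma neg_intertwine:
  assumes X: "adj X = X" and Y: "adj Y = Y" and XY: "X * V = V * Y"
  shows "neg X * V = V * neg Y"
  unfolding neg_def
proof (rule proj_commute[OF closed_csub_ker closed_csub_ker])
  have 1: "pospart X * V = V * pospart Y"
    unfolding pospart_def by (rule fc_intertwine_exact[OF X Y continuous_parts(1) XY])
  then have 2: "pospart Y * adj V = adj V * pospart X"
    by (metis adj_simps(7) neg_props(1)[OF X] neg_props(1)[OF Y])
  show "V \<cdot> x \<in> {x. pospart X \<cdot> x = 0}" if "x \<in> {x. pospart Y \<cdot> x = 0}" for x
    using that arg_cong[OF 1, of "\<lambda>T. T \<cdot> x"] by simp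
  show "adj V \<cdot> x \<in> {x. pospart Y \<cdot> x = 0}" if "x \<in> {x. pospart X \<cdot> x = 0}" for x
    using that arg_cong[OF 2, of "\<lambda>T. T \<cdot> x"] by simp
qed

lemma neg_commute: "adj X = X \<Longrightarrow> X * V = V * X \<Longrightarrow> neg X * V = V * neg X"
  by (rule neg_intertwine)

lemma neg_commute_neg: "adj X = X \<Longrightarrow> adj Y = Y \<Longrightarrow> X * Y = Y * X \<Longrightarrow> neg X * neg Y = neg Y * neg X"
  by (metis neg_commute)

lemma neg_pos: assumes X: "adj X = X" shows "pos (X * (1 - neg X))" "pos (- (X * neg X))"
  using fc_pos'[OF X continuous_parts(1)] fc_pos'[OF X continuous_parts(2)]
  unfolding neg_props[OF X] by (simp_all add: pospart_def negpart_def)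

text \<open>P intertwines X with the operator 0, whose positive part vanishes.\<close>

lemma neg_of_zero:
  fixes X :: "'a::complex_hilbert bop"
  assumes X: "adj X = X" and "X * P = 0" shows "neg X * P = P"
proof -
  have sp: "spec_in (- 1) 0 (0 :: 'a bop)" by (simp add: spec_in_def)
  have "fc (0 :: 'a bop) (\<lambda>t. max t 0) = fc 0 (\<lambda>_. 0)"
    by (rule fc_cong[OF sp]) (auto intro: continuous_parts)
  also have "\<dots> = 0" using fc_const[of "0 :: 'a bop" 0] by simp
  finally have 0: "pospart X * P = 0"
    using fc_intertwine_exact[OF X adj_simps(1) continuous_parts(1), of P] assms(2) by (simp add: pospart_def)
  show ?thesis unfolding neg_def proj_cong_app[OF closed_csub_ker]
    using arg_cong[OF 0, of "\<lambda>T. T \<cdot> _"] by simp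
qed

section \<open>Congruence modulo a closed self-adjoint ideal\<close>

locale closed_ideal =
  fixes I :: "'a::complex_hilbert bop set"
  assumes ideal: "op_ideal I" and star: "x \<in> I \<Longrightarrow> adj x \<in> I"
begin

definition cong (infix "\<doteq>" 50) where "x \<doteq> y \<longleftrightarrow> x - y \<in> I"

lemmas I_rules = op_idealD[OF ideal]

lemma cong_refl [simp]: "x \<doteq> x"
  by (simp add: cong_def I_rules(2))

lemma cong_sym: "x \<doteq> y \<Longrightarrow> y \<doteq> x"
  using I_rules(6)[of "x - y"] by (simp add: cong_def)

lemma cong_trans [trans]: "x \<doteq> y \<Longrightarrow> y \<doteq> z \<Longrightarrow> x \<doteq> z"
  using I_rules(3)[of "x - y" "y - z"] by (simp add: cong_def)

lemma cong_add: "x \<doteq> y \<Longrightarrow> x' \<doteq> y' \<Longrightarrow> x + x' \<doteq> y + y'"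
  using I_rules(3)[of "x - y" "x' - y'"] by (simp add: cong_def algebra_simps)

lemma cong_diff: "x \<doteq> y \<Longrightarrow> x' \<doteq> y' \<Longrightarrow> x - x' \<doteq> y - y'"
  using I_rules(7)[of "x - y" "x' - y'"] by (simp add: cong_def algebra_simps)

lemma cong_minus: "x \<doteq> y \<Longrightarrow> - x \<doteq> - y"
  using cong_diff[of 0 0 x y] by simp

lemma cong_mult_left: "x \<doteq> y \<Longrightarrow> T * x \<doteq> T * y"
  using I_rules(4)[of "x - y" T] by (simp add: cong_def algebra_simps)

lemma cong_mult_right: "x \<doteq> y \<Longrightarrow> x * T \<doteq> y * T"
  using I_rules(5)[of "x - y" T] by (simp add: cong_def algebra_simps)

lemma cong_mult: "x \<doteq> y \<Longrightarrow> x' \<doteq> y' \<Longrightarrow> x * x' \<doteq> y * y'"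
  using cong_mult_left cong_mult_right cong_trans by blast

lemma cong_scaleR: "x \<doteq> y \<Longrightarrow> r *\<^sub>R x \<doteq> r *\<^sub>R y"
  using I_rules(8)[of "x - y" r] by (simp add: cong_def algebra_simps)

lemma cong_sum: "(\<And>i. i \<in> A \<Longrightarrow> f i \<doteq> g i) \<Longrightarrow> sum f A \<doteq> sum g A"
  by (induction A rule: infinite_finite_induct) (auto intro: cong_add)

lemma cong_adj: "x \<doteq> y \<Longrightarrow> adj x \<doteq> adj y"
  using star[of "x - y"] by (simp add: cong_def)

lemma cong_0_iff: "x \<doteq> 0 \<longleftrightarrow> x \<in> I"
  by (simp add: cong_def)

lemma cong_iff_diff: "x \<doteq> y \<longleftrightarrow> x - y \<doteq> 0"
  by (simp add: cong_def)

lemma cong_fc: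
  "adj X = X \<Longrightarrow> adj Y = Y \<Longrightarrow> continuous_on UNIV f \<Longrightarrow> X * V \<doteq> V * Y \<Longrightarrow> fc X f * V \<doteq> V * fc Y f"
  unfolding cong_def by (rule fc_intertwine[OF ideal])

text \<open>\<open>neg\<close> is discontinuous, so a congruence cannot be pushed through it.
  Instead, Y has an inverse Z, whence V is congruent to X V Z; there 1 - neg X turns X into its
  positive part, which is continuous in X and therefore kills V modulo the ideal.\<close>

lemma sign_neg:
  assumes X: "adj X = X" and Y: "adj Y = Y" and XY: "X * V \<doteq> V * Y"
    and k: "k > 0" "pos (- k *\<^sub>R 1 - Y)"
  shows "neg X * V \<doteq> V"
proof -
  define N where "N = max (norm Y) k + 1"
  have "N > k" by (simp add: N_def max_def)
  have "pos (N *\<^sub>R 1 + Y)" using Y by (intro pos_norm_add) (auto simp: N_def)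
  then have sp: "spec_in (- N) (- k) Y" using k by (simp add: spec_in_def add.commute)
  have lt: "- N < - k" using \<open>N > k\<close> by simp
  \<comment> \<open>Equals 1/t on the spectrum of Y and is continuous on the whole line.\<close>
  have c: "continuous_on UNIV (\<lambda>t::real. 1 / min t (- k))"
    using k(1) by (intro continuous_intros) (auto simp: min_def)
  define Z where "Z = fc Y (\<lambda>t. 1 / min t (- k))"
  have "Y * Z = fc Y (\<lambda>t. t * (1 / min t (- k)))"
    unfolding Z_def by (subst fc_mult[OF Y _ c]) (auto simp: fc_id[OF Y])
  also have "\<dots> = fc Y (\<lambda>_. 1)"
    using k(1) by (intro fc_cong[OF sp lt] continuous_on_mult continuous_on_id c continuous_on_const) auto
  finally have YZ: "Y * Z = 1" using fc_const[OF Y, of 1] by simp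
  have "pospart Y = fc Y (\<lambda>_. 0)"
    unfolding pospart_def using k(1) by (intro fc_cong[OF sp lt] continuous_parts) auto
  then have pY: "pospart Y = 0" using fc_const[OF Y, of 0] by simp
  have pV: "pospart X * V \<doteq> 0"
    using cong_fc[OF X Y continuous_parts(1) XY] pY by (simp add: pospart_def)
  have "V = V * Y * Z" using YZ by (simp add: mult.assoc)
  also have "\<dots> \<doteq> X * V * Z" by (intro cong_mult_right cong_sym[OF XY])
  finally have "(1 - neg X) * V \<doteq> (1 - neg X) * (X * V * Z)" by (rule cong_mult_left)
  also have "\<dots> = pospart X * V * Z" by (simp add: neg_props(4)[OF X, symmetric] mult.assoc)
  also have "\<dots> \<doteq> 0 * Z" by (intro cong_mult_right pV)
  finally have "(1 - neg X) * V \<doteq> 0" by simp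
  then have "V - neg X * V \<doteq> 0" by (simp add: left_diff_distrib)
  then show ?thesis using cong_iff_diff cong_sym by blast
qed

lemma sign_pos:
  assumes X: "adj X = X" and Y: "adj Y = Y" and XY: "X * V \<doteq> V * Y"
    and k: "k > 0" "pos (Y - k *\<^sub>R 1)"
  shows "neg X * V \<doteq> 0"
proof -
  define N where "N = max (norm Y) k + 1"
  have "N > k" by (simp add: N_def max_def)
  have "pos (N *\<^sub>R 1 - Y)" using Y by (intro pos_norm_diff) (auto simp: N_def)
  then have sp: "spec_in k N Y" using k by (simp add: spec_in_def)
  have c: "continuous_on UNIV (\<lambda>t::real. 1 / max t k)"
    using k(1) by (intro continuous_intros) (auto simp: max_def)
  define Z where "Z = fc Y (\<lambda>t. 1 / max t k)"
  have "Y * Z = fc Y (\<lambda>t. t * (1 / max t k))"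
    unfolding Z_def by (subst fc_mult[OF Y _ c]) (auto simp: fc_id[OF Y])
  also have "\<dots> = fc Y (\<lambda>_. 1)"
    using k(1) by (intro fc_cong[OF sp \<open>N > k\<close>] continuous_on_mult continuous_on_id c continuous_on_const) auto
  finally have YZ: "Y * Z = 1" using fc_const[OF Y, of 1] by simp
  have "negpart Y = fc Y (\<lambda>_. 0)"
    unfolding negpart_def using k(1) by (intro fc_cong[OF sp \<open>N > k\<close>] continuous_parts) auto
  then have nY: "negpart Y = 0" using fc_const[OF Y, of 0] by simp
  have nV: "negpart X * V \<doteq> 0"
    using cong_fc[OF X Y continuous_parts(2) XY] nY by (simp add: negpart_def)
  have "V = V * Y * Z" using YZ by (simp add: mult.assoc)
  also have "\<dots> \<doteq> X * V * Z" by (intro cong_mult_right cong_sym[OF XY])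
  finally have "neg X * V \<doteq> neg X * (X * V * Z)" by (rule cong_mult_left)
  also have "\<dots> = neg X * X * V * Z" by (simp add: mult.assoc)
  also have "\<dots> = - (negpart X * V) * Z" by (simp add: neg_props(6)[OF X])
  also have "\<dots> \<doteq> - 0 * Z" by (intro cong_mult_right cong_minus nV)
  finally show ?thesis by simp
qed

lemma sign_neg_scalar: "adj X = X \<Longrightarrow> r < 0 \<Longrightarrow> X * V \<doteq> r *\<^sub>R V \<Longrightarrow> neg X * V \<doteq> V"
  using sign_neg[of X "r *\<^sub>R 1" V "- r"] by simp

lemma sign_pos_scalar: "adj X = X \<Longrightarrow> r > 0 \<Longrightarrow> X * V \<doteq> r *\<^sub>R V \<Longrightarrow> neg X * V \<doteq> 0"
  using sign_pos[of X "r *\<^sub>R 1" V r] by simp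

subsection \<open>Lifting nested projections\<close>

text \<open>Compress 1/2 - Q to the complement of P. The result X kills P, so its spectral
  projection contains P exactly; modulo the ideal X is -1/2 on Q - P and 1/2 on 1 - Q, so that
  projection is congruent to Q.\<close>

lemma lift_nested_pair:
  assumes P: "isproj P" and Q: "isproj Q" and PQ: "P * Q \<doteq> P"
  obtains Q' where "isproj Q'" "Q' \<doteq> Q" "P * Q' = P"
proof -
  define X where "X = (1 - P) * ((1/2) *\<^sub>R 1 - Q) * (1 - P)"
  note P' = isproj_adj[OF P] isproj_idem[OF P] and Q' = isproj_adj[OF Q] isproj_idem[OF Q]
  have X: "adj X = X" by (simp add: X_def P' Q' mult.assoc)
  have QP: "Q * P \<doteq> P" using cong_adj[OF PQ] by (simp add: P' Q')
  have "X * P = 0" by (simp add: X_def algebra_simps P')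
  then have 1: "neg X * P = P" by (rule neg_of_zero[OF X])
  have "(1 - P) * (Q - P) = Q - P * Q" by (simp add: algebra_simps P')
  also have "\<dots> \<doteq> Q - P" by (intro cong_diff cong_refl PQ)
  finally have a: "(1 - P) * (Q - P) \<doteq> Q - P" .
  have "((1/2) *\<^sub>R 1 - Q) * (Q - P) = (1/2) *\<^sub>R (Q - P) - (Q - Q * P)" by (simp add: algebra_simps Q')
  also have "\<dots> \<doteq> (1/2) *\<^sub>R (Q - P) - (Q - P)" by (intro cong_diff cong_refl QP)
  also have "\<dots> = (-1/2) *\<^sub>R (Q - P)" by (simp flip: scaleR_left_diff_distrib add: scaleR_left_diff_distrib[of "1/2" 1, simplified, symmetric])
  finally have b: "((1/2) *\<^sub>R 1 - Q) * (Q - P) \<doteq> (-1/2) *\<^sub>R (Q - P)" .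
  have "X * (Q - P) = (1 - P) * (((1/2) *\<^sub>R 1 - Q) * ((1 - P) * (Q - P)))" by (simp add: X_def mult.assoc)
  also have "\<dots> \<doteq> (1 - P) * (((1/2) *\<^sub>R 1 - Q) * (Q - P))" by (intro cong_mult_left a)
  also have "\<dots> \<doteq> (1 - P) * ((-1/2) *\<^sub>R (Q - P))" by (intro cong_mult_left b)
  also have "\<dots> = (-1/2) *\<^sub>R ((1 - P) * (Q - P))" by simp
  also have "\<dots> \<doteq> (-1/2) *\<^sub>R (Q - P)" by (intro cong_scaleR a)
  finally have 2: "neg X * (Q - P) \<doteq> Q - P" by (intro sign_neg_scalar[OF X, of "-1/2"]) auto
  have "(1 - P) * (1 - Q) = (1 - Q) - (P - P * Q)" by (simp add: algebra_simps P')
  also have "\<dots> \<doteq> (1 - Q) - (P - P)" by (intro cong_diff cong_refl PQ)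
  finally have c: "(1 - P) * (1 - Q) \<doteq> 1 - Q" by simp
  have d: "((1/2) *\<^sub>R 1 - Q) * (1 - Q) = (1/2) *\<^sub>R (1 - Q)" by (simp add: algebra_simps Q')
  have "X * (1 - Q) = (1 - P) * (((1/2) *\<^sub>R 1 - Q) * ((1 - P) * (1 - Q)))" by (simp add: X_def mult.assoc)
  also have "\<dots> \<doteq> (1 - P) * (((1/2) *\<^sub>R 1 - Q) * (1 - Q))" by (intro cong_mult_left c)
  also have "\<dots> = (1/2) *\<^sub>R ((1 - P) * (1 - Q))" by (simp add: d)
  also have "\<dots> \<doteq> (1/2) *\<^sub>R (1 - Q)" by (intro cong_scaleR c)
  finally have 3: "neg X * (1 - Q) \<doteq> 0" by (intro sign_pos_scalar[OF X, of "1/2"]) auto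
  have "neg X = neg X * P + neg X * (Q - P) + neg X * (1 - Q)" by (simp add: algebra_simps)
  also have "\<dots> \<doteq> P + (Q - P) + 0" unfolding 1 by (intro cong_add cong_refl 2 3)
  finally have "neg X \<doteq> Q" by simp
  moreover have "P * neg X = P" using arg_cong[OF 1, of adj] by (simp add: P')
  ultimately show thesis using that isproj_neg by blast
qed

text \<open>Each new projection is lifted above the last corrected one; exact nesting is transitive,
  so consecutive pairs suffice.\<close>

lemma lift_nested:
  assumes H: "\<And>i. i < n \<Longrightarrow> isproj (H i)" and HH: "\<And>i. Suc i < n \<Longrightarrow> H i * H (Suc i) \<doteq> H i"
  obtains G where "\<And>i. i < n \<Longrightarrow> isproj (G i)" "\<And>i. i < n \<Longrightarrow> G i \<doteq> H i"
    "\<And>i j. i \<le> j \<Longrightarrow> j < n \<Longrightarrow> G i * G j = G i"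
proof -
  have "\<exists>G. (\<forall>i<n. isproj (G i) \<and> G i \<doteq> H i) \<and> (\<forall>i j. i \<le> j \<longrightarrow> j < n \<longrightarrow> G i * G j = G i)"
    using assms
  proof (induction n)
    case 0 then show ?case by auto
  next
    case (Suc n)
    then obtain G where G: "\<And>i. i < n \<Longrightarrow> isproj (G i)" "\<And>i. i < n \<Longrightarrow> G i \<doteq> H i"
      "\<And>i j. i \<le> j \<Longrightarrow> j < n \<Longrightarrow> G i * G j = G i" by (metis less_SucI)
    show ?case
    proof (cases n)
      case 0
      then show ?thesis using Suc.prems(1)[of 0] by (intro exI[of _ H]) (auto simp: isproj_idem)
    next
      case k: (Suc k)
      have 1: "G k * H n \<doteq> H k * H n" using G(2)[of k] k by (intro cong_mult_right) auto
      have 2: "H k * H (Suc k) \<doteq> H k" by (rule Suc.prems(2)) (simp add: k)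
      have 3: "H k \<doteq> G k" by (rule cong_sym, rule G(2)) (simp add: k)
      have GH: "G k * H n \<doteq> G k"
        by (rule cong_trans[OF 1 cong_trans[OF 2[folded k] 3]])
      have "isproj (G k)" "isproj (H n)" using G(1) Suc.prems(1) k by auto
      then obtain Q where Q: "isproj Q" "Q \<doteq> H n" "G k * Q = G k"
        using GH by (rule lift_nested_pair)
      have "G i * Q = G i" if "i < n" for i
      proof -
        have e: "G i * G k = G i" using G(3)[of i k] that k by simp
        have "G i * Q = G i * G k * Q" by (simp only: e)
        also have "\<dots> = G i * (G k * Q)" by (rule mult.assoc)
        also have "\<dots> = G i" by (simp only: Q(3) e)
        finally show ?thesis .
      qed
      then show ?thesis using G Q by (intro exI[of _ "G(n := Q)"]) (auto simp: less_Suc_eq isproj_idem)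
    qed
  qed
  then show thesis using that by blast
qed

end

subsection \<open>Pinching\<close>

definition partition :: "nat \<Rightarrow> (nat \<Rightarrow> 'a::complex_hilbert bop) \<Rightarrow> bool" where
  "partition n F \<longleftrightarrow> (\<forall>l\<le>n. isproj (F l)) \<and> (\<forall>l\<le>n. \<forall>k\<le>n. l \<noteq> k \<longrightarrow> F l * F k = 0) \<and> (\<Sum>l\<le>n. F l) = 1"

definition pinch :: "nat \<Rightarrow> (nat \<Rightarrow> 'a::complex_hilbert bop) \<Rightarrow> 'a bop \<Rightarrow> 'a bop" where
  "pinch n F Y = (\<Sum>l\<le>n. F l * Y * F l)"

text \<open>Differences of neighbours in the flag 0, G 0, ..., G (n - 1), 1: there are n + 1 steps,
  indexed by l at most n.\<close>

definition flag_step :: "nat \<Rightarrow> (nat \<Rightarrow> 'a::complex_hilbert bop) \<Rightarrow> nat \<Rightarrow> 'a bop" where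
  "flag_step n G l = (if l < n then G l else 1) - (if l = 0 then 0 else G (l - 1))"

lemma sum_flag_step: "i < n \<Longrightarrow> (\<Sum>l\<le>i. flag_step n G l) = G i"
  by (induction i) (auto simp: flag_step_def)

lemma partition_flag_step:
  assumes G: "\<And>i. i < n \<Longrightarrow> isproj (G i)" and nest: "\<And>i j. i \<le> j \<Longrightarrow> j < n \<Longrightarrow> G i * G j = G i"
  shows "partition n (flag_step n G)"
proof -
  \<comment> \<open>The flag with its end points 0 and 1 included, which moves all indices up by
    one.\<close>
  define E where "E l = (if l = 0 then 0 else if l \<le> n then G (l - 1) else 1)" for l
  have F: "flag_step n G l = E (Suc l) - E l" if "l \<le> n" for l
    using that by (auto simp: flag_step_def E_def)
  have E: "isproj (E l)" for l using G by (auto simp: E_def)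
  have EE: "E l * E k = E l" if "l \<le> k" for l k using that nest[of "l - 1" "k - 1"] by (auto simp: E_def)
  have EE': "E k * E l = E l" if "l \<le> k" for l k
    using arg_cong[OF EE[OF that], of adj] by (simp add: isproj_adj[OF E])
  have "isproj (E (Suc l) - E l)" for l
    using EE[of l "Suc l"] EE'[of l "Suc l"] isproj_idem[OF E] isproj_adj[OF E]
    by (simp add: isproj_def algebra_simps)
  moreover have "(E (Suc l) - E l) * (E (Suc k) - E k) = 0" if "l < k" for l k
    using that EE by (simp add: algebra_simps)
  moreover have "(E (Suc l) - E l) * (E (Suc k) - E k) = 0" if "k < l" for l k
    using that EE' by (simp add: algebra_simps)
  moreover have "(\<Sum>l\<le>n. E (Suc l) - E l) = 1"
    using sum_telescope[of "\<lambda>l. - E l" n] by (simp add: E_def)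
  ultimately show ?thesis unfolding partition_def using F by (auto simp: nat_neq_iff)
qed

lemma partition_sum_cases:
  assumes F: "partition n F" and l: "l \<le> n"
  shows "F l * pinch n F Y = F l * Y * F l" "pinch n F Y * F l = F l * Y * F l"
proof -
  have "F l * (F k * Y * F k) = (if k = l then F l * Y * F l else 0)" if "k \<le> n" for k
    using F l that by (auto simp: partition_def isproj_idem simp flip: mult.assoc)
  then show "F l * pinch n F Y = F l * Y * F l" using l by (simp add: pinch_def sum_distrib_left)
  have "(F k * Y * F k) * F l = (if k = l then F l * Y * F l else 0)" if "k \<le> n" for k
    using F l that by (auto simp: partition_def isproj_idem mult.assoc)
  then show "pinch n F Y * F l = F l * Y * F l" using l by (simp add: pinch_def sum_distrib_right)
qed

lemma pinch_commute: "partition n F \<Longrightarrow> l \<le> n \<Longrightarrow> F l * pinch n F Y = pinch n F Y * F l"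
  by (simp add: partition_sum_cases)

lemma adj_pinch: "partition n F \<Longrightarrow> adj Y = Y \<Longrightarrow> adj (pinch n F Y) = pinch n F Y"
  unfolding pinch_def adj_sum by (intro sum.cong) (auto simp: partition_def isproj_adj mult.assoc)

text \<open>Expresses the pinching error by commutators with the partition, the quantities that are
  estimated later.\<close>

lemma pinch_diff:
  assumes F: "partition n F"
  shows "Y - pinch n F Y = (\<Sum>l\<le>n. (Y * F l - F l * Y) * F l)"
proof -
  have "(Y * F l - F l * Y) * F l = Y * F l - F l * Y * F l" if "l \<le> n" for l
    using F that by (simp add: algebra_simps partition_def isproj_idem)
  then have "(\<Sum>l\<le>n. (Y * F l - F l * Y) * F l) = (\<Sum>l\<le>n. Y * F l - F l * Y * F l)"
    by (intro sum.cong) auto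
  also have "\<dots> = Y * (\<Sum>l\<le>n. F l) - pinch n F Y"
    by (simp add: sum_subtractf pinch_def sum_distrib_left)
  finally show ?thesis using F by (simp add: partition_def)
qed

section \<open>Orthonormal sets\<close>

lemma adj_cinner: "cinner (T \<cdot> x) y = cinner x (adj T \<cdot> y)"
  by (simp add: cinner_eq adj_inner flip: app_scaleC)

definition orthonormal :: "'a::complex_inner set \<Rightarrow> bool" where
  "orthonormal B \<longleftrightarrow> (\<forall>x\<in>B. \<forall>y\<in>B. cinner x y = (if x = y then 1 else 0))"

lemma is_onb_iff: "closed_csub S \<Longrightarrow> is_onb S B \<longleftrightarrow> orthonormal B \<and> closure (cspan B) = S"
  using closure_cspan_superset by (auto simp: is_onb_def orthonormal_def)

lemma cinner_sum_left: "cinner (sum f F) y = (\<Sum>x\<in>F. cinner (f x) y)"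
proof -
  have "cinner 0 y = 0" using cinner_scaleC_left[of 0 0 y] by simp
  then show ?thesis by (induction F rule: infinite_finite_induct) (auto simp: cinner_add_left)
qed

lemma norm_orthonormal_sum:
  assumes "orthonormal B" "finite F" "F \<subseteq> B"
  shows "(norm (\<Sum>b\<in>F. c b *\<^sub>C b))\<^sup>2 = (\<Sum>b\<in>F. (cmod (c b))\<^sup>2)"
proof -
  have "cinner (\<Sum>b\<in>F. c b *\<^sub>C b) (c b' *\<^sub>C b') = complex_of_real ((cmod (c b'))\<^sup>2)" if "b' \<in> F" for b'
  proof -
    have "cinner (\<Sum>b\<in>F. c b *\<^sub>C b) (c b' *\<^sub>C b') = (\<Sum>b\<in>F. c b * (cnj (c b') * cinner b b'))"
      by (simp add: cinner_sum_left cinner_scaleC_left cinner_scaleC_right sum_distrib_left mult.left_commute)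
    also have "\<dots> = (\<Sum>b\<in>F. if b = b' then c b' * cnj (c b') else 0)"
      using assms(1,3) that by (intro sum.cong) (auto simp: orthonormal_def subset_iff)
    finally show ?thesis using that assms(2) by (simp flip: complex_norm_square)
  qed
  then have "(\<Sum>b\<in>F. c b *\<^sub>C b) \<bullet> (c b' *\<^sub>C b') = (cmod (c b'))\<^sup>2" if "b' \<in> F" for b'
    using that by (simp add: inner_eq_Re_cinner)
  then show ?thesis by (simp add: power2_norm_eq_inner inner_sum_right)
qed

lemma bessel:
  assumes B: "orthonormal B" and F: "finite F" "F \<subseteq> B"
  shows "(\<Sum>b\<in>F. (cmod (cinner x b))\<^sup>2) \<le> (norm x)\<^sup>2"
proof -
  let ?p = "\<Sum>b\<in>F. cinner x b *\<^sub>C b" and ?s = "\<Sum>b\<in>F. (cmod (cinner x b))\<^sup>2"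
  have "x \<bullet> (cinner x b *\<^sub>C b) = (cmod (cinner x b))\<^sup>2" for b
    unfolding cmod_power2 by (simp add: inner_eq_Re_cinner cinner_scaleC_right power2_eq_square)
  then have "x \<bullet> ?p = ?s" by (simp add: inner_sum_right)
  moreover have "?p \<bullet> ?p = ?s" using norm_orthonormal_sum[OF B F] by (simp add: power2_norm_eq_inner)
  moreover have "0 \<le> (x - ?p) \<bullet> (x - ?p)" by simp
  ultimately show ?thesis by (simp add: inner_diff_left inner_diff_right inner_commute power2_norm_eq_inner)
qed

text \<open>By Bessel's inequality only finitely many squared coefficients exceed 1/(n + 1), for
  each n.\<close>

lemma countable_nonorthogonal:
  assumes B: "orthonormal B" shows "countable {b \<in> B. cinner x b \<noteq> 0}"
proof -
  let ?C = "\<lambda>n::nat. {b \<in> B. (cmod (cinner x b))\<^sup>2 > 1 / real (Suc n)}"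
  have fin: "finite (?C n)" for n
  proof (rule ccontr)
    assume "infinite (?C n)"
    obtain N :: nat where N: "real (Suc n) * (norm x)\<^sup>2 < real N" using reals_Archimedean2 by blast
    obtain F where F: "finite F" "card F = N" "F \<subseteq> ?C n"
      using infinite_arbitrarily_large[OF \<open>infinite (?C n)\<close>] by blast
    have "(\<Sum>b\<in>F. 1 / real (Suc n)) \<le> (\<Sum>b\<in>F. (cmod (cinner x b))\<^sup>2)"
      using F by (intro sum_mono) (auto intro: less_imp_le)
    also have "\<dots> \<le> (norm x)\<^sup>2" using F by (intro bessel[OF B]) auto
    finally have "real N / real (Suc n) \<le> (norm x)\<^sup>2" using F by simp
    then show False using N by (simp add: field_simps)
  qed
  have "countable (\<Union>n. ?C n)" by (rule countable_UN, simp, rule countable_finite, rule fin)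
  moreover have "{b \<in> B. cinner x b \<noteq> 0} \<subseteq> (\<Union>n. ?C n)"
  proof
    fix b assume b: "b \<in> {b \<in> B. cinner x b \<noteq> 0}"
    then have "0 < (cmod (cinner x b))\<^sup>2" by simp
    then obtain n where "inverse (real (Suc n)) < (cmod (cinner x b))\<^sup>2" using reals_Archimedean by blast
    then show "b \<in> (\<Union>n. ?C n)" using b by (auto simp: inverse_eq_divide)
  qed
  ultimately show ?thesis by (rule countable_subset[rotated])
qed

text \<open>Each b is non-orthogonal to some x in X, and each x is non-orthogonal to only countably
  many b.\<close>

lemma card_of_orthonormal:
  fixes X :: "'a::complex_hilbert set"
  assumes B: "orthonormal B" and BX: "B \<subseteq> closure (cspan X)"
  shows "|B| \<le>o |X \<times> (UNIV :: nat set)|"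
proof -
  have "\<exists>x\<in>X. cinner x b \<noteq> 0" if "b \<in> B" for b
  proof (rule ccontr)
    assume "\<not> ?thesis"
    then have "b \<in> corth (closure (cspan X))" unfolding corth_closure_cspan by (simp add: corth_def)
    then have "cinner b b = 0" using BX that by (auto simp: corth_def)
    then show False using B that by (auto simp: orthonormal_def)
  qed
  then obtain x where x: "\<And>b. b \<in> B \<Longrightarrow> x b \<in> X \<and> cinner (x b) b \<noteq> 0" by metis
  let ?g = "\<lambda>b. (x b, to_nat_on {b' \<in> B. cinner (x b) b' \<noteq> 0} b)"
  have "inj_on ?g B"
  proof (rule inj_onI)
    fix b b' assume b: "b \<in> B" "b' \<in> B" and eq: "?g b = ?g b'"
    have "cinner (x b) b \<noteq> 0" "cinner (x b) b' \<noteq> 0" using x[OF b(1)] x[OF b(2)] eq by simp_all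
    then show "b = b'"
      using eq b by (intro inj_onD[OF inj_on_to_nat_on[OF countable_nonorthogonal[OF B, of "x b"]]]) auto
  qed
  moreover have "?g ` B \<subseteq> X \<times> UNIV" using x by auto
  ultimately show ?thesis using card_of_ordLeq by blast
qed

lemma countable_ordLeq: "countable A \<Longrightarrow> |B| \<le>o |A| \<Longrightarrow> countable B"
  unfolding card_of_ordLeq[symmetric] by (meson countable_image_inj_on countable_subset)

lemma card_of_orthonormal_countable:
  fixes X :: "'a::complex_hilbert set"
  assumes "orthonormal B" "B \<subseteq> closure (cspan X)" "countable X"
  shows "countable B"
proof -
  have "countable (X \<times> (UNIV :: nat set))" using assms(3) by (intro countable_SIGMA) auto
  then show ?thesis using card_of_orthonormal[OF assms(1,2)] by (rule countable_ordLeq)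
qed

lemma card_of_times_nat: "infinite X \<Longrightarrow> |X \<times> (UNIV :: nat set)| \<le>o |X|"
  by (rule card_of_Sigma_ordLeq_infinite) (simp_all add: card_of_refl ordIso_imp_ordLeq infinite_iff_card_of_nat)

lemma card_of_orthonormal_infinite:
  fixes X :: "'a::complex_hilbert set"
  assumes "orthonormal B" "B \<subseteq> closure (cspan X)" "infinite X"
  shows "|B| \<le>o |X|"
  using card_of_orthonormal[OF assms(1,2)] card_of_times_nat[OF assms(3)] by (rule ordLeq_transitive)

text \<open>Zorn's lemma. R is not assumed symmetric, so maximality asks for both
  directions.\<close>

lemma maximal_clique:
  obtains B where "B \<subseteq> A" "\<And>x y. x \<in> B \<Longrightarrow> y \<in> B \<Longrightarrow> x \<noteq> y \<Longrightarrow> R x y"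
    "\<And>a. a \<in> A \<Longrightarrow> (\<And>b. b \<in> B \<Longrightarrow> R a b \<and> R b a) \<Longrightarrow> a \<in> B"
proof -
  define \<A> where "\<A> = {B. B \<subseteq> A \<and> (\<forall>x\<in>B. \<forall>y\<in>B. x \<noteq> y \<longrightarrow> R x y)}"
  have "\<exists>M\<in>\<A>. \<forall>X\<in>\<A>. M \<subseteq> X \<longrightarrow> X = M"
  proof (rule subset_Zorn')
    fix C assume C: "subset.chain \<A> C"
    have "R x y" if "x \<in> X" "X \<in> C" "y \<in> Y" "Y \<in> C" "x \<noteq> y" for x y X Y
    proof -
      have "X \<subseteq> Y \<or> Y \<subseteq> X" using C that by (auto simp: subset_chain_def)
      then show ?thesis using C that unfolding subset_chain_def \<A>_def by blast
    qed
    then show "\<Union>C \<in> \<A>" using C unfolding subset_chain_def \<A>_def by blast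
  qed
  then obtain M where M: "M \<in> \<A>" "\<And>X. X \<in> \<A> \<Longrightarrow> M \<subseteq> X \<Longrightarrow> X = M" by blast
  have "a \<in> M" if "a \<in> A" "\<And>b. b \<in> M \<Longrightarrow> R a b \<and> R b a" for a
  proof -
    have "insert a M \<in> \<A>" using M(1) that by (auto simp: \<A>_def)
    then show ?thesis using M(2) by blast
  qed
  note max = this
  have MA: "M \<subseteq> A" and MR: "\<And>x y. x \<in> M \<Longrightarrow> y \<in> M \<Longrightarrow> x \<noteq> y \<Longrightarrow> R x y"
    using M(1) unfolding \<A>_def by blast+
  show thesis by (rule that[OF MA MR max])
qed

lemma cinner_self: "cinner x x = complex_of_real ((norm x)\<^sup>2)"
proof -
  have "Im (cinner x x) = 0" using arg_cong[OF cinner_commute[of x x], of Im] by simp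
  then show ?thesis by (simp add: complex_eq_iff power2_norm_eq_inner inner_eq_Re_cinner)
qed

lemma onb_exists:
  assumes S: "closed_csub S" obtains B where "is_onb S B"
proof -
  obtain B where B: "B \<subseteq> {x \<in> S. norm x = 1}" "\<And>x y. x \<in> B \<Longrightarrow> y \<in> B \<Longrightarrow> x \<noteq> y \<Longrightarrow> cinner x y = 0"
    and max: "\<And>a. a \<in> {x \<in> S. norm x = 1} \<Longrightarrow> (\<And>b. b \<in> B \<Longrightarrow> cinner a b = 0 \<and> cinner b a = 0) \<Longrightarrow> a \<in> B"
    using maximal_clique[of "{x \<in> S. norm x = 1}" "\<lambda>x y. cinner x y = 0"] by blast
  have on: "orthonormal B" unfolding orthonormal_def using B by (auto simp: cinner_self)
  let ?T = "closure (cspan B)"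
  have TS: "?T \<subseteq> S" using B(1) by (intro closure_cspan_minimal S) auto
  have "S \<subseteq> ?T"
  proof
    fix x assume x: "x \<in> S"
    define v where "v = x - proj ?T \<cdot> x"
    have vS: "v \<in> S" unfolding v_def using x proj_in[of ?T x] TS closed_csubD(6)[OF S] by auto
    have "proj ?T \<cdot> v = 0" unfolding v_def app_diff using proj_id[OF _ proj_in, of ?T] by simp
    then have vB: "v \<in> corth B" using proj_0_iff[of ?T v] by simp
    have "v = 0"
    proof (rule ccontr)
      assume "v \<noteq> 0"
      let ?u = "(1 / norm v) *\<^sub>R v"
      have "?u \<in> S" using vS closed_csubD(1)[OF S] by (rule subspace_scale[rotated])
      moreover have "?u \<in> corth B" using vB closed_csubD(1)[OF closed_csub_corth] by (rule subspace_scale[rotated])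
      ultimately have "?u \<in> B" using \<open>v \<noteq> 0\<close>
        by (intro max) (auto simp: corth_def cinner_commute[of "(1 / norm v) *\<^sub>R v"])
      then have "cinner ?u ?u = 0" using \<open>?u \<in> corth B\<close> by (auto simp: corth_def)
      then show False using \<open>v \<noteq> 0\<close> by (simp add: cinner_self)
    qed
    then have "proj ?T \<cdot> x = x" by (simp add: v_def)
    then show "x \<in> ?T" using proj_fix_iff[of ?T x] by simp
  qed
  then have "is_onb S B" using on TS unfolding is_onb_iff[OF S] by blast
  then show thesis by (rule that)
qed

lemma onb_some: "closed_csub S \<Longrightarrow> is_onb S (SOME B. is_onb S B)"
  by (metis onb_exists someI)

subsection \<open>Partial isometries\<close>

text \<open>By Pythagoras the partial sums inherit the Cauchy property from those of the squared
  coefficients.\<close>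

lemma orthonormal_summable:
  fixes B :: "'a::complex_hilbert set"
  assumes B: "orthonormal B" and c: "(\<lambda>b. (cmod (c b))\<^sup>2) summable_on B"
  shows "(\<lambda>b. c b *\<^sub>C b) summable_on B"
proof -
  let ?g = "\<lambda>b. (cmod (c b))\<^sup>2" and ?f = "\<lambda>b. c b *\<^sub>C b"
  obtain L where lim: "(sum ?g \<longlongrightarrow> L) (finite_subsets_at_top B)"
    using c unfolding has_sum_def summable_on_def by blast
  have "\<exists>P. eventually P (finite_subsets_at_top B) \<and> (\<forall>F F'. P F \<and> P F' \<longrightarrow> dist (sum ?f F) (sum ?f F') < e)"
    if "e > 0" for e
  proof -
    define d where "d = e\<^sup>2 / 16"
    have d: "d > 0" using that by (simp add: d_def)
    have "\<forall>\<^sub>F F in finite_subsets_at_top B. dist (sum ?g F) L < d" using lim d by (rule tendstoD)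
    then obtain F0 where F0: "finite F0" "F0 \<subseteq> B"
      "\<And>F. finite F \<Longrightarrow> F0 \<subseteq> F \<Longrightarrow> F \<subseteq> B \<Longrightarrow> dist (sum ?g F) L < d"
      unfolding eventually_finite_subsets_at_top by metis
    define P where "P F \<longleftrightarrow> finite F \<and> F0 \<subseteq> F \<and> F \<subseteq> B" for F
    have "eventually P (finite_subsets_at_top B)"
      unfolding eventually_finite_subsets_at_top P_def using F0(1,2) by blast
    moreover have half: "dist (sum ?f F) (sum ?f F0) < e / 2" if F: "P F" for F
    proof -
      have "sum ?f F - sum ?f F0 = sum ?f (F - F0)" using F by (simp add: P_def sum_diff)
      then have "(norm (sum ?f F - sum ?f F0))\<^sup>2 = sum ?g (F - F0)"
        using norm_orthonormal_sum[OF B, of "F - F0" c] F by (auto simp: P_def)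
      also have "\<dots> = sum ?g F - sum ?g F0" using F by (simp add: P_def sum_diff)
      also have "\<dots> < 2 * d" using F0(3)[of F] F0(3)[of F0] F F0(1,2)
        by (auto simp: P_def dist_real_def abs_less_iff)
      also have "\<dots> < (e / 2)\<^sup>2"
      proof -
        have "0 < e\<^sup>2" using \<open>e > 0\<close> by simp
        then show ?thesis by (simp add: d_def power_divide)
      qed
      finally have "norm (sum ?f F - sum ?f F0) < e / 2" by (rule power2_less_imp_less) (use \<open>e > 0\<close> in simp)
      then show ?thesis by (simp add: dist_norm)
    qed
    moreover have "dist (sum ?f F) (sum ?f F') < e" if "P F" "P F'" for F F'
      using dist_triangle_half_l[OF half[OF that(1)] half[OF that(2)]] .
    ultimately show ?thesis by blast
  qed
  then have "cauchy_filter (filtermap (sum ?f) (finite_subsets_at_top B))"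
    by (simp add: cauchy_filter_metric_filtermap)
  moreover have "complete (UNIV :: 'a set)"
    by (meson Cauchy_convergent UNIV_I complete_def convergent_def)
  ultimately obtain L' where "(sum ?f \<longlongrightarrow> L') (finite_subsets_at_top B)"
    using complete_uniform[where S=UNIV] by (force simp add: filterlim_def)
  then show ?thesis using summable_on_def has_sum_def by blast
qed

text \<open>W maps every b to its partner in C and kills the complement of B; Bessel's inequality
  yields both convergence and the norm bound.\<close>

lemma partial_isometry:
  fixes B C :: "'a::complex_hilbert set"
  assumes B: "orthonormal B" and C: "orthonormal C" and bij: "bij_betw \<beta> B C"
  obtains W where "adj W * W = proj (closure (cspan B))" "W * adj W = proj (closure (cspan C))"
proof -
  have \<beta>: "\<And>b. b \<in> B \<Longrightarrow> \<beta> b \<in> C" "inj_on \<beta> B" "\<beta> ` B = C" using bij by (auto simp: bij_betw_def)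
  define \<gamma> where "\<gamma> = inv_into B \<beta>"
  have \<gamma>: "\<gamma> (\<beta> b) = b" if "b \<in> B" for b using that \<beta>(2) by (simp add: \<gamma>_def)
  have sq: "(\<lambda>b. (cmod (cinner v b))\<^sup>2) summable_on B" for v
    by (rule nonneg_bdd_above_summable_on) (auto intro!: bdd_aboveI[of _ "(norm v)\<^sup>2"] bessel[OF B])
  have sm: "(\<lambda>b. cinner v b *\<^sub>C \<beta> b) summable_on B" for v
  proof -
    have "(\<lambda>c. (cmod (cinner v (\<gamma> c)))\<^sup>2) summable_on C"
      using sq[of v] summable_on_reindex[OF \<beta>(2), of "\<lambda>c. (cmod (cinner v (\<gamma> c)))\<^sup>2"]
      unfolding \<beta>(3) by (simp add: o_def \<gamma> cong: summable_on_cong)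
    then have "(\<lambda>c. cinner v (\<gamma> c) *\<^sub>C c) summable_on C" by (rule orthonormal_summable[OF C])
    then show ?thesis
      using summable_on_reindex[OF \<beta>(2), of "\<lambda>c. cinner v (\<gamma> c) *\<^sub>C c"]
      unfolding \<beta>(3) by (simp add: o_def \<gamma> cong: summable_on_cong)
  qed
  define f where "f v = infsum (\<lambda>b. cinner v b *\<^sub>C \<beta> b) B" for v
  have hs: "((\<lambda>b. cinner v b *\<^sub>C \<beta> b) has_sum f v) B" for v
    unfolding f_def by (rule has_sum_infsum[OF sm])
  have lin: "bounded_linear f"
  proof (rule bounded_linear_intro[where K=1])
    fix x y :: 'a and r :: real
    show "f (x + y) = f x + f y"
      using has_sum_add[OF hs[of x] hs[of y]] hs[of "x + y"]
      by (simp add: cinner_add_left scaleC_add_left has_sum_unique)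
    show "f (r *\<^sub>R x) = r *\<^sub>R f x"
      using has_sum_bounded_linear[OF bounded_linear_scaleR_right hs[of x], of r] hs[of "r *\<^sub>R x"]
      by (simp add: scaleR_scaleC cinner_scaleC_left scaleC_scaleC has_sum_unique)
    show "norm (f x) \<le> norm x * 1"
    proof -
      have "((\<lambda>F. norm (\<Sum>b\<in>F. cinner x b *\<^sub>C \<beta> b)) \<longlongrightarrow> norm (f x)) (finite_subsets_at_top B)"
        using hs[of x] unfolding has_sum_def by (rule tendsto_norm)
      moreover have "norm (\<Sum>b\<in>F. cinner x b *\<^sub>C \<beta> b) \<le> norm x" if F: "finite F" "F \<subseteq> B" for F
      proof -
        have inj: "inj_on \<beta> F" using \<beta>(2) F(2) by (rule inj_on_subset)
        have "(\<Sum>b\<in>F. cinner x b *\<^sub>C \<beta> b) = (\<Sum>c\<in>\<beta> ` F. cinner x (\<gamma> c) *\<^sub>C c)"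
          using F \<gamma> by (subst sum.reindex[OF inj]) (auto intro!: sum.cong)
        also have "(norm \<dots>)\<^sup>2 = (\<Sum>c\<in>\<beta> ` F. (cmod (cinner x (\<gamma> c)))\<^sup>2)"
          using F \<beta> by (intro norm_orthonormal_sum[OF C]) auto
        also have "\<dots> = (\<Sum>b\<in>F. (cmod (cinner x b))\<^sup>2)"
          using F \<gamma> by (subst sum.reindex[OF inj]) (auto intro!: sum.cong)
        also have "\<dots> \<le> (norm x)\<^sup>2" by (rule bessel[OF B F])
        finally show ?thesis by (rule power2_le_imp_le) simp
      qed
      then have "\<forall>\<^sub>F F in finite_subsets_at_top B. norm (\<Sum>b\<in>F. cinner x b *\<^sub>C \<beta> b) \<le> norm x"
        by (intro eventually_finite_subsets_at_top_weakI) auto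
      ultimately have "norm (f x) \<le> norm x"
        by (intro tendsto_upperbound[of _ _ "finite_subsets_at_top B"]) auto
      then show ?thesis by simp
    qed
  qed
  have fi: "f (\<i> *\<^sub>C x) = \<i> *\<^sub>C f x" for x
    using has_sum_bounded_linear[OF bounded_linear_i hs[of x]] hs[of "\<i> *\<^sub>C x"]
    by (simp add: cinner_scaleC_left scaleC_scaleC has_sum_unique)
  define W where "W = bop_of f"
  have W: "W \<cdot> v = f v" for v unfolding W_def by (rule bop_of_app[OF lin fi])
  have inner_W: "((\<lambda>b. (cinner v b *\<^sub>C \<beta> b) \<bullet> w) has_sum ((W \<cdot> v) \<bullet> w)) B" for v w
    unfolding W by (rule has_sum_bounded_linear[OF bounded_linear_inner_left hs])
  have Wb: "W \<cdot> b = \<beta> b" if "b \<in> B" for b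
  proof -
    have "cinner b b' *\<^sub>C \<beta> b' = (if b' = b then \<beta> b else 0)" if "b' \<in> B" for b'
      using that \<open>b \<in> B\<close> B by (auto simp: orthonormal_def)
    then have "((\<lambda>b'. cinner b b' *\<^sub>C \<beta> b') has_sum \<beta> b) {b}"
      using \<open>b \<in> B\<close> by (intro has_sum_finiteI) auto
    also have "?this \<longleftrightarrow> ((\<lambda>b'. cinner b b' *\<^sub>C \<beta> b') has_sum \<beta> b) B"
      using \<open>b \<in> B\<close> B by (intro has_sum_cong_neutral) (auto simp: orthonormal_def)
    finally show ?thesis using hs[of b] by (simp add: W has_sum_unique)
  qed
  have Wadj: "adj W \<cdot> \<beta> b = b" if "b \<in> B" for b
  proof (rule inner_eqI)
    fix v
    have 1: "(cinner v b' *\<^sub>C \<beta> b') \<bullet> \<beta> b = (if b' = b then v \<bullet> b else 0)" if "b' \<in> B" for b'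
      using that \<open>b \<in> B\<close> C \<beta>(1) inj_onD[OF \<beta>(2), of b' b]
      by (auto simp: orthonormal_def inner_eq_Re_cinner cinner_scaleC_left)
    then have "((\<lambda>b'. (cinner v b' *\<^sub>C \<beta> b') \<bullet> \<beta> b) has_sum (v \<bullet> b)) {b}"
      using \<open>b \<in> B\<close> by (intro has_sum_finiteI) auto
    also have "?this \<longleftrightarrow> ((\<lambda>b'. (cinner v b' *\<^sub>C \<beta> b') \<bullet> \<beta> b) has_sum (v \<bullet> b)) B"
      using \<open>b \<in> B\<close> 1 by (intro has_sum_cong_neutral) auto
    finally have "(W \<cdot> v) \<bullet> \<beta> b = v \<bullet> b" using inner_W[of v "\<beta> b"] by (rule has_sum_unique[rotated])
    then show "v \<bullet> (adj W \<cdot> \<beta> b) = v \<bullet> b" by (simp add: adj_inner)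
  qed
  have proj_eq: "T = proj (closure (cspan X))" if "\<And>x. x \<in> X \<Longrightarrow> T \<cdot> x = x" "\<And>v. v \<in> corth X \<Longrightarrow> T \<cdot> v = 0"
    for T :: "'a bop" and X
  proof (rule bop_eqI)
    fix x
    let ?P = "proj (closure (cspan X))"
    have "closure (cspan X) \<subseteq> {x. T \<cdot> x = x}" using that(1) by (intro closure_cspan_minimal closed_csub_fix) auto
    then have 1: "T \<cdot> ?P \<cdot> x = ?P \<cdot> x" using proj_in[OF closed_csub_closure_cspan] by blast
    have "?P \<cdot> (x - ?P \<cdot> x) = 0" by (simp add: app_diff proj_id[OF closed_csub_closure_cspan proj_in[OF closed_csub_closure_cspan]])
    then have "x - ?P \<cdot> x \<in> corth X"
      by (simp only: proj_0_iff[OF closed_csub_closure_cspan] corth_closure_cspan)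
    then have "T \<cdot> (x - ?P \<cdot> x) = 0" by (rule that(2))
    then show "T \<cdot> x = ?P \<cdot> x" using 1 by (simp add: app_diff)
  qed
  have zero: "W \<cdot> v = 0" if "v \<in> corth B" for v
  proof -
    have "cinner v b = 0" if "b \<in> B" for b
      using \<open>v \<in> corth B\<close> that by (subst cinner_commute) (auto simp: corth_def)
    then have "((\<lambda>b. cinner v b *\<^sub>C \<beta> b) has_sum 0) B" by (intro has_sum_0) auto
    then show ?thesis using hs[of v] by (simp add: W has_sum_unique)
  qed
  have zero': "adj W \<cdot> w = 0" if "w \<in> corth C" for w
  proof (rule inner_eqI)
    fix v
    have "cinner (\<beta> b) w = 0" if "b \<in> B" for b using \<open>w \<in> corth C\<close> \<beta>(1)[OF that] by (auto simp: corth_def)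
    then have "((\<lambda>b. (cinner v b *\<^sub>C \<beta> b) \<bullet> w) has_sum 0) B"
      by (intro has_sum_0) (auto simp: inner_eq_Re_cinner cinner_scaleC_left)
    then have "(W \<cdot> v) \<bullet> w = 0" using inner_W[of v w] by (rule has_sum_unique[rotated])
    then show "v \<bullet> (adj W \<cdot> w) = v \<bullet> 0" by (simp add: adj_inner)
  qed
  show thesis
  proof
    show "adj W * W = proj (closure (cspan B))"
      by (rule proj_eq) (auto simp: Wb Wadj zero)
    show "W * adj W = proj (closure (cspan C))"
      by (rule proj_eq) (auto simp: Wb Wadj zero' simp flip: \<beta>(3))
  qed
qed

section \<open>Small sets and essentially bounded operators\<close>

definition words :: "'a::complex_hilbert bop set \<Rightarrow> 'a bop set" where
  "words Ts = prod_list ` lists Ts"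

lemma countable_words: "countable Ts \<Longrightarrow> countable (words Ts)"
  by (simp add: words_def countable_lists)

lemma words_1: "1 \<in> words Ts"
  by (auto simp: words_def intro!: image_eqI[of _ _ "[]"])

lemma words_mult: "T \<in> Ts \<Longrightarrow> w \<in> words Ts \<Longrightarrow> T * w \<in> words Ts"
  unfolding words_def by (auto intro!: image_eqI[of _ _ "T # _"])

lemma words_mult_words: "v \<in> words Ts \<Longrightarrow> w \<in> words Ts \<Longrightarrow> v * w \<in> words Ts"
  unfolding words_def by (auto intro!: image_eqI[of _ _ "_ @ _"])

lemma words_adj:
  assumes Ts: "\<And>T. T \<in> Ts \<Longrightarrow> adj T \<in> Ts" and "w \<in> words Ts"
  shows "adj w \<in> words Ts"
proof -
  obtain l where l: "l \<in> lists Ts" "w = prod_list l" using assms(2) by (auto simp: words_def)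
  have "adj (prod_list l) \<in> words Ts" using l(1)
  proof (induction l)
    case (Cons T l)
    then have "adj T \<in> words Ts" using words_mult[OF Ts words_1] by simp
    then show ?case using Cons by (simp add: words_mult_words)
  qed (simp add: words_1)
  then show ?thesis using l by simp
qed

definition orbit :: "'a::complex_hilbert bop set \<Rightarrow> 'a set \<Rightarrow> 'a set" where
  "orbit Ts X = (\<lambda>(w, x). w \<cdot> x) ` (words Ts \<times> X)"

text \<open>Projection onto the closed invariant subspace generated by X. It reduces Ts if Ts is
  closed under adjoints, and words keep the generating set small when Ts is countable.\<close>

definition reduce :: "'a::complex_hilbert bop set \<Rightarrow> 'a set \<Rightarrow> 'a bop" where
  "reduce Ts X = proj (closure (cspan (orbit Ts X)))"

lemma orbit_superset: "X \<subseteq> orbit Ts X"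
  unfolding orbit_def using words_1 by (force intro!: image_eqI[of _ _ "(1, _)"])

lemma orbit_mono: "X \<subseteq> Y \<Longrightarrow> orbit Ts X \<subseteq> orbit Ts Y"
  unfolding orbit_def by auto

lemma orbit_app: "w \<in> words Ts \<Longrightarrow> x \<in> orbit Ts X \<Longrightarrow> w \<cdot> x \<in> orbit Ts X"
  unfolding orbit_def by (auto intro!: image_eqI[of _ _ "(w * _, _)"] words_mult_words)

lemma closed_csub_vimage: "closed_csub S \<Longrightarrow> closed_csub {x. T \<cdot> x \<in> S}"
proof -
  assume S: "closed_csub S"
  have "T \<cdot> x \<in> S \<longleftrightarrow> ((1 - proj S) * T) \<cdot> x = 0" for x
    unfolding proj_fix_iff[OF S, symmetric] by auto
  then show ?thesis by (simp only: closed_csub_ker)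
qed

lemma isproj_reduce [simp]: "isproj (reduce Ts X)"
  by (simp add: reduce_def isproj_proj)

lemma reduce_app: "x \<in> orbit Ts X \<Longrightarrow> reduce Ts X \<cdot> x = x"
  unfolding reduce_def using closure_cspan_superset by (intro proj_id) auto

lemma reduce_0_iff: "reduce Ts X \<cdot> v = 0 \<longleftrightarrow> v \<in> corth (orbit Ts X)"
  by (simp add: reduce_def proj_0_iff)

lemma reduce_commute:
  assumes Ts: "\<And>T. T \<in> Ts \<Longrightarrow> adj T \<in> Ts" and T: "T \<in> Ts"
  shows "reduce Ts X * T = T * reduce Ts X"
proof -
  let ?S = "closure (cspan (orbit Ts X))"
  have inv: "U \<cdot> x \<in> ?S" if "U \<in> Ts" "x \<in> ?S" for U x
  proof -
    have "U \<in> words Ts" using words_mult[OF that(1) words_1] by simp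
    then have "orbit Ts X \<subseteq> {x. U \<cdot> x \<in> ?S}" using orbit_app closure_cspan_superset by blast
    then have "?S \<subseteq> {x. U \<cdot> x \<in> ?S}" by (rule closure_cspan_minimal) (simp add: closed_csub_vimage)
    then show ?thesis using that by blast
  qed
  show ?thesis unfolding reduce_def
    by (rule proj_commute) (use inv T Ts in auto)
qed

lemma reduce_mono:
  assumes "X \<subseteq> Y" shows "reduce Ts Y * reduce Ts X = reduce Ts X" "reduce Ts X * reduce Ts Y = reduce Ts X"
proof -
  have "closure (cspan (orbit Ts X)) \<subseteq> closure (cspan (orbit Ts Y))"
    by (rule closure_cspan_minimal[OF subset_trans[OF orbit_mono[OF assms] closure_cspan_superset] closed_csub_closure_cspan])
  then show 1: "reduce Ts Y * reduce Ts X = reduce Ts X"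
    unfolding reduce_def proj_cong_app[OF closed_csub_closure_cspan]
    using proj_in[OF closed_csub_closure_cspan] by blast
  show "reduce Ts X * reduce Ts Y = reduce Ts X"
    using arg_cong[OF 1, of adj] by (simp add: isproj_adj)
qed

lemma reduce_orbit_zero: "(\<And>x. x \<in> orbit Ts X \<Longrightarrow> T \<cdot> x = 0) \<Longrightarrow> T * reduce Ts X = 0"
proof -
  assume "\<And>x. x \<in> orbit Ts X \<Longrightarrow> T \<cdot> x = 0"
  then have "orbit Ts X \<subseteq> {x. T \<cdot> x = 0}" by blast
  then have "closure (cspan (orbit Ts X)) \<subseteq> {x. T \<cdot> x = 0}"
    by (rule closure_cspan_minimal[OF _ closed_csub_ker])
  then show ?thesis unfolding reduce_def
    using proj_in[OF closed_csub_closure_cspan, of "orbit Ts X"] by (intro bop_eqI) auto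
qed

section \<open>Small sets and the norm modulo the ideal\<close>

locale uncountable_cardinal =
  fixes m :: "'m rel" and ty :: "'a::complex_hilbert itself"
  assumes card: "Card_order m" and unc: "natLeq <o m"
begin

definition small :: "'b set \<Rightarrow> bool" where "small X \<longleftrightarrow> |X| <o m"

lemma infinite_Field: "infinite (Field m)"
proof
  assume "finite (Field m)"
  then have "|Field m| <o natLeq" by (simp add: finite_iff_ordLess_natLeq)
  then have "|Field m| <o m" using unc by (rule ordLess_transitive)
  then have "m <o m" using card_of_Field_ordIso[OF card] by (metis ordIso_ordLess_trans ordIso_symmetric)
  then show False using ordLess_irreflexive by blast
qed

lemma small_ordLeq: "small Y \<Longrightarrow> |X| \<le>o |Y| \<Longrightarrow> small X"
  unfolding small_def by (rule ordLeq_ordLess_trans)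

lemma small_countable: "countable X \<Longrightarrow> small X"
proof -
  assume "countable X"
  then obtain f :: "'b \<Rightarrow> nat" where "inj_on f X" by (auto simp: countable_def)
  then have "|X| \<le>o |UNIV :: nat set|" using card_of_ordLeq by (metis subset_UNIV)
  also have "|UNIV :: nat set| \<le>o natLeq" using card_of_nat by (rule ordIso_imp_ordLeq)
  finally show ?thesis unfolding small_def using unc by (rule ordLeq_ordLess_trans)
qed

lemma small_empty [simp]: "small {}"
  by (rule small_countable) simp

lemma small_image: "small X \<Longrightarrow> small (f ` X)"
  by (rule small_ordLeq[OF _ card_of_image])

text \<open>Finite unions only: for countably cofinal m a countable union of small sets can have
  cardinality m.\<close>

lemma small_Un: "small X \<Longrightarrow> small Y \<Longrightarrow> small (X \<union> Y)"
  unfolding small_def by (rule card_of_Un_ordLess_infinite_Field[OF infinite_Field card])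

lemma small_times: assumes "countable D" "small X" shows "small (D \<times> X)"
proof (cases "countable X")
  case True
  then show ?thesis using assms by (intro small_countable countable_SIGMA) auto
next
  case False
  then have inf: "infinite X" using countable_finite by blast
  obtain f :: "'b \<Rightarrow> nat" where "inj_on f D" using assms(1) by (auto simp: countable_def)
  then have "|D| \<le>o |UNIV :: nat set|" using card_of_ordLeq by (metis subset_UNIV)
  also have "|UNIV :: nat set| \<le>o |X|" using inf by (simp add: infinite_iff_card_of_nat)
  finally have "|D \<times> X| \<le>o |X|"
    using inf by (intro card_of_Sigma_ordLeq_infinite) (auto simp: card_of_refl ordIso_imp_ordLeq)
  then show ?thesis by (rule small_ordLeq[OF assms(2)])
qed

lemma small_orbit: "countable Ts \<Longrightarrow> small X \<Longrightarrow> small (orbit Ts X)"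
  unfolding orbit_def by (intro small_image small_times countable_words)

text \<open>\<open>T\<close> has norm at most \<open>c\<close> modulo the ideal of \<open>m\<close>-compact operators.\<close>

definition ebound :: "real \<Rightarrow> 'a bop \<Rightarrow> bool" where
  "ebound c T \<longleftrightarrow> (\<forall>e>0. \<exists>X. small X \<and> (\<forall>v\<in>corth X. norm (T \<cdot> v) \<le> (c + e) * norm v))"

text \<open>Describes the ideal by its effect on vectors instead of by ranks;
  \<open>m_compact_ops_eq\<close> identifies the two.\<close>

definition negl :: "'a bop set" where "negl = {T. ebound 0 T}"

lemma eboundI: "(\<And>e. e > 0 \<Longrightarrow> \<exists>X. small X \<and> (\<forall>v\<in>corth X. norm (T \<cdot> v) \<le> (c + e) * norm v)) \<Longrightarrow> ebound c T"
  by (simp add: ebound_def)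

lemma eboundE:
  assumes "ebound c T" "e > 0"
  obtains X where "small X" "\<And>v. v \<in> corth X \<Longrightarrow> norm (T \<cdot> v) \<le> (c + e) * norm v"
  using assms by (auto simp: ebound_def)

lemma ebound_norm: "norm T \<le> c \<Longrightarrow> ebound c T"
proof (rule eboundI)
  fix e :: real assume "norm T \<le> c" "e > 0"
  then have "norm (T \<cdot> v) \<le> (c + e) * norm v" for v
    using norm_app[of T v] mult_right_mono[of "norm T" "c + e" "norm v"] by auto
  then show "\<exists>X. small X \<and> (\<forall>v\<in>corth X. norm (T \<cdot> v) \<le> (c + e) * norm v)"
    by (intro exI[of _ "{}"]) auto
qed

lemma ebound_mono: "ebound c T \<Longrightarrow> c \<le> d \<Longrightarrow> ebound d T"
proof (rule eboundI)
  fix e :: real assume T: "ebound c T" "c \<le> d" "e > 0"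
  obtain X where X: "small X" "\<And>v. v \<in> corth X \<Longrightarrow> norm (T \<cdot> v) \<le> (c + e) * norm v"
    using eboundE[OF T(1,3)] by blast
  have "(c + e) * norm v \<le> (d + e) * norm v" for v :: 'a using T(2) by (intro mult_right_mono) auto
  then show "\<exists>X. small X \<and> (\<forall>v\<in>corth X. norm (T \<cdot> v) \<le> (d + e) * norm v)"
    using X order_trans by blast
qed

lemma ebound_add: assumes "ebound c S" "ebound d T" shows "ebound (c + d) (S + T)"
proof (rule eboundI)
  fix e :: real assume "e > 0"
  then have e2: "e / 2 > 0" by simp
  obtain X where X: "small X" "\<And>v. v \<in> corth X \<Longrightarrow> norm (S \<cdot> v) \<le> (c + e / 2) * norm v"
    using eboundE[OF assms(1) e2] by blast
  obtain Y where Y: "small Y" "\<And>v. v \<in> corth Y \<Longrightarrow> norm (T \<cdot> v) \<le> (d + e / 2) * norm v"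
    using eboundE[OF assms(2) e2] by blast
  have "norm ((S + T) \<cdot> v) \<le> (c + d + e) * norm v" if "v \<in> corth (X \<union> Y)" for v
  proof -
    have "norm ((S + T) \<cdot> v) \<le> norm (S \<cdot> v) + norm (T \<cdot> v)" by (simp add: norm_triangle_ineq)
    also have "\<dots> \<le> (c + e / 2) * norm v + (d + e / 2) * norm v"
      using that X(2) Y(2) by (intro add_mono) (auto simp: corth_Un)
    also have "\<dots> = (c + d + e) * norm v" by (simp add: algebra_simps)
    finally show ?thesis .
  qed
  then show "\<exists>X. small X \<and> (\<forall>v\<in>corth X. norm ((S + T) \<cdot> v) \<le> (c + d + e) * norm v)"
    using small_Un[OF X(1) Y(1)] by blast
qed

lemma ebound_mult_left: assumes "ebound c T" shows "ebound (norm S * c) (S * T)"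
proof (rule eboundI)
  fix e :: real assume e: "e > 0"
  define d where "d = e / (norm S + 1)"
  have S1: "norm S + 1 > 0" by (simp add: add_nonneg_pos)
  then have d: "d > 0" "norm S * d \<le> e" using e by (simp_all add: d_def field_simps)
  obtain X where X: "small X" "\<And>v. v \<in> corth X \<Longrightarrow> norm (T \<cdot> v) \<le> (c + d) * norm v"
    using eboundE[OF assms d(1)] by blast
  have "norm ((S * T) \<cdot> v) \<le> (norm S * c + e) * norm v" if "v \<in> corth X" for v
  proof -
    have "norm ((S * T) \<cdot> v) \<le> norm S * norm (T \<cdot> v)" using norm_app by simp
    also have "\<dots> \<le> norm S * ((c + d) * norm v)" using X(2)[OF that] by (intro mult_left_mono) auto
    also have "\<dots> = (norm S * c + norm S * d) * norm v" by (simp add: algebra_simps)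
    also have "\<dots> \<le> (norm S * c + e) * norm v" using d(2) by (intro mult_right_mono) auto
    finally show ?thesis .
  qed
  then show "\<exists>X. small X \<and> (\<forall>v\<in>corth X. norm ((S * T) \<cdot> v) \<le> (norm S * c + e) * norm v)"
    using X(1) by blast
qed

lemma corth_adj_image: "v \<in> corth (app (adj S) ` X) \<longleftrightarrow> S \<cdot> v \<in> corth X"
  using adj_cinner[of "adj S"] by (auto simp: corth_def)

text \<open>S v is orthogonal to X as soon as v is orthogonal to the image of X under
  \<open>adj S\<close>.\<close>

lemma ebound_mult_right: assumes "ebound c T" "0 \<le> c" shows "ebound (c * norm S) (T * S)"
proof (rule eboundI)
  fix e :: real assume e: "e > 0"
  define d where "d = e / (norm S + 1)"
  have S1: "norm S + 1 > 0" by (simp add: add_nonneg_pos)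
  then have d: "d > 0" "d * norm S \<le> e" using e by (simp_all add: d_def field_simps)
  obtain X where X: "small X" "\<And>v. v \<in> corth X \<Longrightarrow> norm (T \<cdot> v) \<le> (c + d) * norm v"
    using eboundE[OF assms(1) d(1)] by blast
  have "norm ((T * S) \<cdot> v) \<le> (c * norm S + e) * norm v" if "v \<in> corth (app (adj S) ` X)" for v
  proof -
    have "norm ((T * S) \<cdot> v) \<le> (c + d) * norm (S \<cdot> v)" using X(2)[OF corth_adj_image[THEN iffD1, OF that]] by simp
    also have "\<dots> \<le> (c + d) * (norm S * norm v)" using d assms(2) by (intro mult_left_mono norm_app) auto
    also have "\<dots> = (c * norm S + d * norm S) * norm v" by (simp add: algebra_simps)
    also have "\<dots> \<le> (c * norm S + e) * norm v" using d(2) by (intro mult_right_mono) auto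
    finally show ?thesis .
  qed
  then show "\<exists>X. small X \<and> (\<forall>v\<in>corth X. norm ((T * S) \<cdot> v) \<le> (c * norm S + e) * norm v)"
    using small_image[OF X(1)] by blast
qed

lemma ebound_sum: "(\<And>i. i \<in> A \<Longrightarrow> ebound (c i) (f i)) \<Longrightarrow> ebound (sum c A) (sum f A)"
  by (induction A rule: infinite_finite_induct) (auto intro: ebound_add ebound_norm)

lemma closed_negl: "closed negl"
  unfolding closed_sequential_limits
proof (intro allI impI)
  fix X L assume XL: "(\<forall>n. X n \<in> negl) \<and> X \<longlonglongrightarrow> L"
  have "\<exists>Y. small Y \<and> (\<forall>v\<in>corth Y. norm (L \<cdot> v) \<le> (0 + e) * norm v)" if "e > 0" for e
  proof -
    have e2: "e / 2 > 0" using that by simp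
    obtain n where n: "norm (X n - L) < e / 2" using XL e2 LIMSEQ_iff[of X L] by (metis order_refl)
    have "ebound 0 (X n)" using XL by (simp add: negl_def)
    then obtain Y where Y: "small Y" "\<And>v. v \<in> corth Y \<Longrightarrow> norm (X n \<cdot> v) \<le> (0 + e / 2) * norm v"
      using eboundE[OF _ e2] by blast
    have "norm (L \<cdot> v) \<le> (0 + e) * norm v" if "v \<in> corth Y" for v
    proof -
      have "L \<cdot> v = X n \<cdot> v - (X n - L) \<cdot> v" by simp
      then have "norm (L \<cdot> v) \<le> norm (X n \<cdot> v) + norm ((X n - L) \<cdot> v)" by (metis norm_triangle_ineq4)
      also have "\<dots> \<le> (0 + e / 2) * norm v + (e / 2) * norm v"
        using n norm_app[of "X n - L" v] mult_right_mono[of "norm (X n - L)" "e / 2" "norm v"]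
        by (intro add_mono Y(2) that) auto
      also have "\<dots> = (0 + e) * norm v" by (simp add: field_simps)
      finally show ?thesis .
    qed
    then show ?thesis using Y(1) by blast
  qed
  then show "L \<in> negl" by (simp add: negl_def ebound_def)
qed

lemma op_ideal_negl: "op_ideal negl"
  unfolding op_ideal_def
  using closed_negl ebound_norm[of 0 0] ebound_add[of 0 _ 0] ebound_mult_left[of 0] ebound_mult_right[of 0]
  by (auto simp: negl_def)

lemma proj_negl: "small X \<Longrightarrow> proj (closure (cspan X)) \<in> negl"
  unfolding negl_def ebound_def
  by (auto intro!: exI[of _ X] simp: proj_0_iff[THEN iffD2])

lemma reduce_negl: "countable Ts \<Longrightarrow> small X \<Longrightarrow> reduce Ts X \<in> negl"
  unfolding reduce_def by (intro proj_negl small_orbit)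

text \<open>Holds for every projection that fixes X, so that P may afterwards be taken to reduce a
  given countable family.\<close>

lemma negl_cut:
  assumes "ebound c T" "0 \<le> c" "e > 0"
  obtains X where "small X" "\<And>P. isproj P \<Longrightarrow> (\<And>x. x \<in> X \<Longrightarrow> P \<cdot> x = x) \<Longrightarrow> norm (T * (1 - P)) \<le> c + e"
proof -
  obtain X where X: "small X" "\<And>v. v \<in> corth X \<Longrightarrow> norm (T \<cdot> v) \<le> (c + e) * norm v"
    using eboundE[OF assms(1,3)] by blast
  have "norm (T * (1 - P)) \<le> c + e" if P: "isproj P" "\<And>x. x \<in> X \<Longrightarrow> P \<cdot> x = x" for P
  proof (rule norm_bop_bound)
    fix v
    let ?w = "(1 - P) \<cdot> v"
    have "cinner x ?w = 0" if "x \<in> X" for x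
      using adj_cinner[of "1 - P" x v] P(2)[OF that] isproj_adj[OF P(1)] cinner_scaleC_left[of 0 0 v] by simp
    then have "?w \<in> corth X" by (simp add: corth_def)
    then have "norm (T \<cdot> ?w) \<le> (c + e) * norm ?w" by (rule X(2))
    also have "\<dots> \<le> (c + e) * norm v"
    proof (rule mult_left_mono)
      have "norm ?w \<le> norm (1 - P) * norm v" by (rule norm_app)
      also have "\<dots> \<le> 1 * norm v" by (intro mult_right_mono isproj_norm isproj_compl P) auto
      finally show "norm ?w \<le> norm v" by simp
    qed (use assms in auto)
    finally show "norm ((T * (1 - P)) \<cdot> v) \<le> (c + e) * norm v" by simp
  qed (use assms in auto)
  then show thesis using that X(1) by blast
qed

text \<open>Let P project onto the closed span of X. For v orthogonal to the image of X under T,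
  \<open>adj T\<close> sends v into the complement of P, and (1 - P) adj T has the norm of its
  adjoint T (1 - P).\<close>

lemma star_negl: assumes "T \<in> negl" shows "adj T \<in> negl"
  unfolding negl_def mem_Collect_eq
proof (rule eboundI)
  fix e :: real assume e: "e > 0"
  have "ebound 0 T" using assms by (simp add: negl_def)
  then obtain X where X: "small X" "\<And>P. isproj P \<Longrightarrow> (\<And>x. x \<in> X \<Longrightarrow> P \<cdot> x = x) \<Longrightarrow> norm (T * (1 - P)) \<le> 0 + e"
    using negl_cut[OF _ order_refl e] by blast
  define P where "P = proj (closure (cspan X))"
  have P: "isproj P" by (simp add: P_def isproj_proj)
  have "norm (T * (1 - P)) \<le> 0 + e"
    using closure_cspan_superset by (intro X(2) P) (auto simp: P_def intro!: proj_id)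
  then have "norm (adj (T * (1 - P))) \<le> e" unfolding norm_adj by simp
  then have n: "norm ((1 - P) * adj T) \<le> e" using isproj_adj[OF P] by simp
  have "norm (adj T \<cdot> v) \<le> (0 + e) * norm v" if "v \<in> corth (app T ` X)" for v
  proof -
    have "adj T \<cdot> v \<in> corth X" using corth_adj_image[of v "adj T" X] that by simp
    then have "P \<cdot> adj T \<cdot> v = 0" by (simp add: P_def proj_0_iff)
    then have "norm (adj T \<cdot> v) = norm (((1 - P) * adj T) \<cdot> v)" by simp
    also have "\<dots> \<le> norm ((1 - P) * adj T) * norm v" by (rule norm_app)
    also have "\<dots> \<le> e * norm v" using n by (intro mult_right_mono) auto
    finally show ?thesis by simp
  qed
  then show "\<exists>X. small X \<and> (\<forall>v\<in>corth X. norm (adj T \<cdot> v) \<le> (0 + e) * norm v)"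
    using small_image[OF X(1)] by blast
qed

end

sublocale uncountable_cardinal \<subseteq> closed_ideal negl
  by standard (auto simp: op_ideal_negl star_negl)

context uncountable_cardinal
begin

notation cong (infix "\<doteq>" 50)

lemma small_range_negl:
  assumes "small X" "\<And>v. T \<cdot> v \<in> closure (cspan X)"
  shows "T \<in> negl"
proof -
  have "proj (closure (cspan X)) * T = T" using assms(2) by (simp add: proj_cong_app)
  then show ?thesis using I_rules(5)[OF proj_negl[OF assms(1)], of T] by simp
qed

lemma congD_ebound: "S \<doteq> T \<Longrightarrow> ebound 0 (S - T)"
  unfolding cong_def by (simp add: negl_def)

lemma ebound_cong: "S \<doteq> T \<Longrightarrow> ebound c S \<Longrightarrow> ebound c T"
  using ebound_add[of c S 0 "T - S"] congD_ebound[OF cong_sym, of S T] by simp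

text \<open>Off X and Y the quadratic form of Z stays between the two order bounds up to e, so the
  compression R Z R has norm at most c + e. If Z v is orthogonal to X and Y as well, then Z v = R Z
  R v.\<close>

lemma ebound_order:
  assumes Z: "adj Z = Z" and Z1: "Z \<doteq> Z1" "pos (c *\<^sub>R 1 - Z1)" and Z2: "Z \<doteq> Z2" "pos (c *\<^sub>R 1 + Z2)" and c: "0 \<le> c"
  shows "ebound c Z"
proof (rule eboundI)
  fix e :: real assume e: "e > 0"
  have "ebound 0 (Z - Z1)" "ebound 0 (Z - Z2)" using Z1 Z2 by (auto intro: congD_ebound)
  then obtain X Y where X: "small X" "\<And>v. v \<in> corth X \<Longrightarrow> norm ((Z - Z1) \<cdot> v) \<le> (0 + e) * norm v"
    and Y: "small Y" "\<And>v. v \<in> corth Y \<Longrightarrow> norm ((Z - Z2) \<cdot> v) \<le> (0 + e) * norm v"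
    using eboundE[OF _ e] by metis
  define S where "S = closure (cspan (X \<union> Y))"
  have S: "closed_csub S" by (simp add: S_def)
  define R where "R = 1 - proj S"
  have R: "isproj R" by (simp add: R_def isproj_compl isproj_proj S)
  have RS: "R \<cdot> v \<in> corth (X \<union> Y)" for v
  proof -
    have "proj S \<cdot> (R \<cdot> v) = 0" by (simp add: R_def app_diff proj_id[OF S proj_in[OF S]])
    then show ?thesis by (simp only: proj_0_iff[OF S]) (simp add: S_def)
  qed
  have form: "\<bar>(Z \<cdot> v) \<bullet> v\<bar> \<le> (c + e) * (v \<bullet> v)" if "v \<in> corth (X \<union> Y)" for v
  proof -
    have v: "v \<in> corth X" "v \<in> corth Y" using that by (auto simp: corth_Un)
    have "\<bar>((Z - Z1) \<cdot> v) \<bullet> v\<bar> \<le> norm ((Z - Z1) \<cdot> v) * norm v" by (rule Cauchy_Schwarz_ineq2)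
    also have "\<dots> \<le> ((0 + e) * norm v) * norm v" using X(2)[OF v(1)] by (intro mult_right_mono) auto
    finally have 1: "\<bar>(Z \<cdot> v) \<bullet> v - (Z1 \<cdot> v) \<bullet> v\<bar> \<le> e * (v \<bullet> v)"
      by (simp add: inner_diff_left power2_norm_eq_inner[symmetric] power2_eq_square mult.assoc)
    have "\<bar>((Z - Z2) \<cdot> v) \<bullet> v\<bar> \<le> norm ((Z - Z2) \<cdot> v) * norm v" by (rule Cauchy_Schwarz_ineq2)
    also have "\<dots> \<le> ((0 + e) * norm v) * norm v" using Y(2)[OF v(2)] by (intro mult_right_mono) auto
    finally have 2: "\<bar>(Z \<cdot> v) \<bullet> v - (Z2 \<cdot> v) \<bullet> v\<bar> \<le> e * (v \<bullet> v)"
      by (simp add: inner_diff_left power2_norm_eq_inner[symmetric] power2_eq_square mult.assoc)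
    have "(Z1 \<cdot> v) \<bullet> v \<le> c * (v \<bullet> v)" using Z1(2) by (simp add: pos_def inner_diff_left)
    moreover have "- (c * (v \<bullet> v)) \<le> (Z2 \<cdot> v) \<bullet> v"
    proof -
      have "0 \<le> ((c *\<^sub>R 1 + Z2) \<cdot> v) \<bullet> v" using Z2(2) by (simp add: pos_def)
      then show ?thesis by (simp add: inner_add_left)
    qed
    ultimately show ?thesis using 1 2 by (simp add: distrib_right abs_le_iff)
  qed
  have Rv: "(R \<cdot> v) \<bullet> (R \<cdot> v) \<le> v \<bullet> v" for v
  proof -
    have "norm (R \<cdot> v) \<le> norm R * norm v" by (rule norm_app)
    also have "\<dots> \<le> 1 * norm v" by (intro mult_right_mono isproj_norm R) auto
    finally show ?thesis by (simp add: power2_norm_eq_inner[symmetric])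
  qed
  have RZR: "((R * Z * R) \<cdot> v) \<bullet> v = (Z \<cdot> (R \<cdot> v)) \<bullet> (R \<cdot> v)" for v
    by (simp add: adj_inner[of R] isproj_adj[OF R])
  have bd: "\<bar>((R * Z * R) \<cdot> v) \<bullet> v\<bar> \<le> (c + e) * (v \<bullet> v)" for v
  proof -
    have "\<bar>((R * Z * R) \<cdot> v) \<bullet> v\<bar> \<le> (c + e) * ((R \<cdot> v) \<bullet> (R \<cdot> v))" unfolding RZR by (rule form[OF RS])
    also have "\<dots> \<le> (c + e) * (v \<bullet> v)" using Rv c e by (intro mult_left_mono) auto
    finally show ?thesis .
  qed
  have nb: "norm (R * Z * R) \<le> c + e"
  proof (rule norm_le_of_pos)
    have sa: "adj (R * Z * R) = R * Z * R" by (simp add: Z isproj_adj[OF R] mult.assoc)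
    show "pos ((c + e) *\<^sub>R 1 - R * Z * R)" "pos ((c + e) *\<^sub>R 1 + R * Z * R)"
      unfolding pos_def using bd sa by (auto simp: inner_diff_left inner_add_left abs_le_iff simp del: app_simps(3)) (metis add.commute neg_le_iff_le minus_le_iff diff_ge_0_iff_ge diff_minus_eq_add)
  qed (use c e in auto)
  have "norm (Z \<cdot> v) \<le> (c + e) * norm v" if v: "v \<in> corth ((X \<union> Y) \<union> app Z ` (X \<union> Y))" for v
  proof -
    have vX: "v \<in> corth (X \<union> Y)" and "v \<in> corth (app (adj Z) ` (X \<union> Y))" using v by (auto simp: corth_Un Z image_Un)
    then have ZvX: "Z \<cdot> v \<in> corth (X \<union> Y)" by (simp only: corth_adj_image)
    have fix_R: "R \<cdot> w = w" if "w \<in> corth (X \<union> Y)" for w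
    proof -
      have "w \<in> corth S" using that by (simp add: S_def)
      then have "proj S \<cdot> w = 0" by (simp only: proj_0_iff[OF S])
      then show ?thesis by (simp add: R_def)
    qed
    have "Z \<cdot> v = (R * Z * R) \<cdot> v" using fix_R[OF vX] fix_R[OF ZvX] by simp
    also have "norm \<dots> \<le> norm (R * Z * R) * norm v" by (rule norm_app)
    also have "\<dots> \<le> (c + e) * norm v" using nb by (intro mult_right_mono) auto
    finally show ?thesis .
  qed
  then show "\<exists>X. small X \<and> (\<forall>v\<in>corth X. norm (Z \<cdot> v) \<le> (c + e) * norm v)"
    using small_Un[OF small_Un[OF X(1) Y(1)] small_image[OF small_Un[OF X(1) Y(1)]]] by blast
qed

end

section \<open>Unitary polar decomposition modulo the ideal\<close>

text \<open>The inverse square root, frozen below 1/16 to be continuous. The threshold is below 1/8,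
  the lower bound for N and M where the polar decomposition is formed.\<close>

definition polar_fun :: "real \<Rightarrow> real" where "polar_fun t = 1 / sqrt (max t (1/16))"

lemma continuous_polar_fun: "continuous_on UNIV polar_fun"
  unfolding polar_fun_def by (intro continuous_intros) (auto simp: max_def)

lemma continuous_polar_cut: "continuous_on UNIV (\<lambda>t. polar_fun t * t * polar_fun t)"
  by (intro continuous_on_mult continuous_polar_fun continuous_on_id)

lemma polar_fun_sq: "polar_fun t * t * polar_fun t = t / max t (1/16)"
proof -
  have "sqrt (max t (1/16)) * sqrt (max t (1/16)) = max t (1/16)" by simp
  then show ?thesis by (simp add: polar_fun_def field_simps)
qed

lemma fc_polar_cut:
  assumes N: "adj N = N" and P: "isproj P" "P * N = N * P"
    and low: "\<And>x. P \<cdot> x = x \<Longrightarrow> 1/8 * (x \<bullet> x) \<le> (N \<cdot> x) \<bullet> x"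
  shows "fc N polar_fun * N * fc N polar_fun * P = P"
proof -
  let ?h = "\<lambda>t. polar_fun t * t * polar_fun t"
  let ?g = "\<lambda>t. 1 - ?h t"
  have ch: "continuous_on UNIV ?h" by (rule continuous_polar_cut)
  have cg: "continuous_on UNIV ?g" by (intro continuous_on_diff continuous_on_const ch)
  have h: "fc N ?h = fc N polar_fun * N * fc N polar_fun"
    by (simp add: fc_mult[OF N] continuous_polar_fun continuous_on_mult continuous_on_id fc_id[OF N])
  have g: "fc N ?g = 1 - fc N ?h" by (simp add: fc_diff[OF N continuous_on_const ch] fc_const[OF N])
  let ?G = "fc N ?g"
  have G: "adj ?G = ?G" by (rule fc_adj[OF N cg])
  have PG: "?G * P = P * ?G" by (rule fc_intertwine_exact[OF N N cg]) (simp add: P(2))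
  have "pos (fc N (\<lambda>t. ?g t * (1/16 - t) * ?g t))"
  proof (rule fc_pos'[OF N])
    show "continuous_on UNIV (\<lambda>t. ?g t * (1/16 - t) * ?g t)"
      by (intro continuous_on_mult cg continuous_on_diff continuous_on_const continuous_on_id)
    show "0 \<le> ?g t * (1/16 - t) * ?g t" for t
    proof (cases "t \<ge> 1/16")
      case True
      then have "?g t = 0" unfolding polar_fun_sq by simp
      then show ?thesis by simp
    next
      case False
      then have "0 \<le> (1/16 - t) * (?g t * ?g t)" by (intro mult_nonneg_nonneg[OF _ zero_le_square]) simp
      then show ?thesis by (simp only: mult_ac)
    qed
  qed
  also have "fc N (\<lambda>t. ?g t * (1/16 - t) * ?g t) = ?G * ((1/16) *\<^sub>R 1 - N) * ?G"
  proof -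
    have "fc N (\<lambda>t. 1/16 - t) = (1/16) *\<^sub>R 1 - N"
      using fc_diff[OF N continuous_on_const continuous_on_id, of "1/16"] by (simp add: fc_const[OF N] fc_id[OF N])
    moreover have "continuous_on UNIV (\<lambda>t::real. 1/16 - t)" by (intro continuous_intros)
    ultimately show ?thesis
      using fc_mult[OF N continuous_on_mult[OF cg \<open>continuous_on UNIV (\<lambda>t::real. 1/16 - t)\<close>] cg]
        fc_mult[OF N cg \<open>continuous_on UNIV (\<lambda>t::real. 1/16 - t)\<close>] by simp
  qed
  finally have pos: "pos (?G * ((1/16) *\<^sub>R 1 - N) * ?G)" .
  have "?G * P = 0"
  proof (rule bop_eqI)
    fix v
    let ?u = "(?G * P) \<cdot> v"
    have "P \<cdot> ?u = (P * ?G * P) \<cdot> v" by simp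
    also have "P * ?G * P = ?G * P" unfolding PG[symmetric] using isproj_idem[OF P(1)] by (simp add: mult.assoc)
    finally have "1/8 * (?u \<bullet> ?u) \<le> (N \<cdot> ?u) \<bullet> ?u" by (rule low)
    moreover have "0 \<le> ((?G * ((1/16) *\<^sub>R 1 - N) * ?G) \<cdot> (P \<cdot> v)) \<bullet> (P \<cdot> v)" using pos by (simp add: pos_def)
    then have "0 \<le> (((1/16) *\<^sub>R 1 - N) \<cdot> ?u) \<bullet> ?u" by (simp add: adj_inner[of ?G] G)
    then have "(N \<cdot> ?u) \<bullet> ?u \<le> 1/16 * (?u \<bullet> ?u)" by (simp add: inner_diff_left)
    ultimately have "?u \<bullet> ?u \<le> 0" by linarith
    then have "?u \<bullet> ?u = 0" using inner_ge_zero[of ?u] by (rule antisym)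
    then show "?u = 0 \<cdot> v" unfolding inner_eq_zero_iff app_simps(1) .
  qed
  then have "P - fc N ?h * P = 0" by (simp only: g left_diff_distrib mult_1_left)
  then have "fc N ?h * P = P" by (simp only: right_minus_eq)
  then show ?thesis by (simp only: h)
qed

lemma adj_mult_eq_0: "adj T * T = 0 \<Longrightarrow> T = 0"
proof (rule bop_eqI)
  fix x assume "adj T * T = 0"
  then have "x \<bullet> ((adj T * T) \<cdot> x) = 0" by simp
  then have "x \<bullet> (adj T \<cdot> T \<cdot> x) = 0" by simp
  then have "(T \<cdot> x) \<bullet> (T \<cdot> x) = 0" by (simp add: adj_inner)
  then show "T \<cdot> x = 0 \<cdot> x" by simp
qed

lemma partial_isometry_support:
  assumes "adj W * W = E" "isproj E" shows "W * E = W"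
proof -
  have "adj (W - W * E) * (W - W * E) = E - E * E - (E * E - E * E * E)"
    using isproj_adj[OF assms(2)] by (simp add: algebra_simps flip: assms(1))
  also have "\<dots> = 0" using isproj_idem[OF assms(2)] by simp
  finally show ?thesis using adj_mult_eq_0 by fastforce
qed

lemma proj_range: assumes "isproj P" shows "proj {x. P \<cdot> x = x} = P"
proof (rule bop_eqI)
  fix x
  show "proj {x. P \<cdot> x = x} \<cdot> x = P \<cdot> x"
  proof (rule proj_eqI[OF closed_csub_fix])
    show "P \<cdot> x \<in> {x. P \<cdot> x = x}"
      using arg_cong[OF isproj_idem[OF assms], of "\<lambda>T. T \<cdot> x"] by simp
    show "(x - P \<cdot> x) \<bullet> z = 0" if "z \<in> {x. P \<cdot> x = x}" for z
      using that adj_inner[of P x z] isproj_adj[OF assms] by (simp add: inner_diff_left)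
  qed
qed

text \<open>V = S R (1 - E) is a partial isometry from 1 - E onto 1 - E', the polar part of S where
  it is bounded below; adding W, from E onto E', makes it unitary.\<close>

lemma polar_unitary:
  fixes S :: "'a::complex_hilbert bop"
  defines "N \<equiv> adj S * S" and "M \<equiv> S * adj S"
  defines "R \<equiv> fc N polar_fun"
  assumes E: "isproj E" "isproj E'" "E' * S = S * E"
    and low: "\<And>x. E \<cdot> x = 0 \<Longrightarrow> 1/8 * (x \<bullet> x) \<le> (N \<cdot> x) \<bullet> x" "\<And>x. E' \<cdot> x = 0 \<Longrightarrow> 1/8 * (x \<bullet> x) \<le> (M \<cdot> x) \<bullet> x"
    and W: "adj W * W = E" "W * adj W = E'"
  obtains U where "adj U * U = 1" "U * adj U = 1" "U * (1 - E) = S * R * (1 - E)"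
    "adj U * (1 - E') = R * adj S * (1 - E')"
proof -
  have N: "adj N = N" and M: "adj M = M" by (simp_all add: N_def M_def)
  note Ea = isproj_adj[OF E(1)] isproj_adj[OF E(2)] and Ei = isproj_idem[OF E(1)] isproj_idem[OF E(2)]
  have ES: "E * adj S = adj S * E'" using arg_cong[OF E(3), of adj] by (simp add: Ea)
  have EN: "E * N = N * E" unfolding N_def by (metis E(3) ES mult.assoc)
  have EM: "E' * M = M * E'" unfolding M_def by (metis E(3) ES mult.assoc)
  have R: "adj R = R" unfolding R_def by (rule fc_adj[OF N continuous_polar_fun])
  have ER: "R * E = E * R" unfolding R_def by (rule fc_intertwine_exact[OF N N continuous_polar_fun]) (simp add: EN)
  let ?R' = "fc M polar_fun"
  \<comment> \<open>M S = S N carries functions of N across S to functions of M.\<close>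
  have SR: "?R' * S = S * R" unfolding R_def
    by (rule fc_intertwine_exact[OF M N continuous_polar_fun]) (simp add: M_def N_def mult.assoc)
  have R': "adj ?R' = ?R'" by (rule fc_adj[OF M continuous_polar_fun])
  have RS: "R * adj S = adj S * ?R'" using arg_cong[OF SR, of adj] by (simp add: R R')
  have NE: "R * N * R * (1 - E) = 1 - E"
    unfolding R_def
  proof (rule fc_polar_cut[OF N isproj_compl[OF E(1)]])
    fix x assume "(1 - E) \<cdot> x = x" then show "1/8 * (x \<bullet> x) \<le> (N \<cdot> x) \<bullet> x" by (intro low) simp
  qed (simp add: algebra_simps EN)
  have ME: "?R' * M * ?R' * (1 - E') = 1 - E'"
  proof (rule fc_polar_cut[OF M isproj_compl[OF E(2)]])
    fix x assume "(1 - E') \<cdot> x = x" then show "1/8 * (x \<bullet> x) \<le> (M \<cdot> x) \<bullet> x" by (intro low) simp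
  qed (simp add: algebra_simps EM)
  define V where "V = S * R * (1 - E)"
  have SE: "S * (1 - E) = (1 - E') * S" by (simp add: algebra_simps E(3))
  have RE: "R * (1 - E) = (1 - E) * R" by (simp add: algebra_simps ER)
  have SE': "adj S * (1 - E') = (1 - E) * adj S" by (simp add: algebra_simps ES)
  have ee: "(1 - E) * (1 - E) = 1 - E" "(1 - E') * (1 - E') = 1 - E'" by (simp_all add: algebra_simps Ei)
  have V2: "V = V * (1 - E)" by (simp only: V_def mult.assoc ee)
  have "(1 - E') * V = (1 - E') * S * (R * (1 - E))" by (simp only: V_def mult.assoc)
  also have "\<dots> = S * ((1 - E) * R) * (1 - E)" by (simp only: SE[symmetric] mult.assoc)
  also have "\<dots> = V" by (simp only: RE[symmetric] V_def mult.assoc ee)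
  finally have V1: "V = (1 - E') * V" by simp
  have aV: "adj V = R * adj S * (1 - E')"
  proof -
    have "adj V = ((1 - E) * R) * adj S" by (simp add: V_def R Ea mult.assoc)
    also have "\<dots> = R * (adj S * (1 - E'))" by (simp only: RE[symmetric] SE' mult.assoc)
    finally show ?thesis by (simp only: mult.assoc)
  qed
  have VV: "adj V * V = 1 - E"
  proof -
    have "adj V * V = (1 - E) * (R * N * R * (1 - E))" by (simp add: V_def R Ea N_def mult.assoc)
    then show ?thesis by (simp only: NE ee)
  qed
  have VV': "V * adj V = 1 - E'"
  proof -
    have "V * adj V = V * (1 - E) * adj V" by (simp flip: V2)
    also have "\<dots> = S * R * ((1 - E) * (1 - E)) * adj V" by (simp add: V_def mult.assoc)
    also have "\<dots> = S * R * (1 - E) * adj V" by (simp only: ee)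
    also have "\<dots> = S * R * adj (V * (1 - E))" by (simp add: Ea mult.assoc)
    also have "\<dots> = S * R * (R * adj S * (1 - E'))" by (simp only: V2[symmetric] aV)
    also have "\<dots> = (S * R) * (R * adj S) * (1 - E')" by (simp add: mult.assoc)
    also have "\<dots> = ?R' * M * ?R' * (1 - E')" by (simp only: SR[symmetric] RS) (simp add: M_def mult.assoc)
    finally show ?thesis by (simp only: ME)
  qed
  have WE: "W * E = W" by (rule partial_isometry_support[OF W(1) E(1)])
  have aWE: "adj W * E' = adj W" using partial_isometry_support[of "adj W" E'] W(2) E(2) by simp
  have EW: "E' * W = W" using arg_cong[OF aWE, of adj] by (simp add: Ea)
  have aVW: "adj V * W = 0"
  proof -
    have "adj V * W = adj ((1 - E') * V) * (E' * W)" by (simp only: V1[symmetric] EW)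
    also have "\<dots> = adj V * ((1 - E') * E') * W" by (simp add: Ea mult.assoc)
    also have "(1 - E') * E' = 0" by (simp add: algebra_simps Ei)
    finally show ?thesis by simp
  qed
  have VaW: "V * adj W = 0"
  proof -
    have "V * adj W = V * (1 - E) * adj (W * E)" by (simp only: V2[symmetric] WE)
    also have "\<dots> = V * ((1 - E) * E) * adj W" by (simp add: Ea mult.assoc)
    also have "(1 - E) * E = 0" by (simp add: algebra_simps Ei)
    finally show ?thesis by simp
  qed
  have WaV: "adj W * V = 0" "W * adj V = 0" using arg_cong[OF aVW, of adj] arg_cong[OF VaW, of adj] by simp_all
  show thesis
  proof
    show "adj (V + W) * (V + W) = 1" by (simp add: distrib_left distrib_right VV aVW WaV W)
    show "(V + W) * adj (V + W) = 1" by (simp add: distrib_left distrib_right VV' VaW WaV W)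
    have "W * (1 - E) = 0" by (simp add: right_diff_distrib WE)
    then show "(V + W) * (1 - E) = S * R * (1 - E)" by (simp add: distrib_right V2[symmetric]) (simp add: V_def)
    have "adj W * (1 - E') = 0" using arg_cong[OF EW, of adj] by (simp add: right_diff_distrib Ea)
    then show "adj (V + W) * (1 - E') = R * adj S * (1 - E')"
      by (simp add: distrib_right aV mult.assoc ee)
  qed
qed

context uncountable_cardinal
begin

text \<open>Approximate kernel vectors of \<open>S\<close> are grouped into orthogonal cyclic reducing subspaces,
  each of which meets the low spectral subspaces of both \<open>adj S * S\<close> and \<open>S * adj S\<close>. If there are
  uncountably many of them, these two spectral subspaces have the same dimension, so the polar
  decomposition of \<open>S\<close> extends to a unitary; otherwise they are negligible.\<close>

lemma unitary_polar_decomposition: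
  fixes S :: "'a bop"
  defines "N \<equiv> adj S * S" and "M \<equiv> S * adj S"
  defines "R \<equiv> fc N polar_fun"
  assumes NM: "norm (N - M) \<le> 1/8"
  obtains U E E' where "adj U * U = 1" "U * adj U = 1" "U * (1 - E) = S * R * (1 - E)"
    "adj U * (1 - E') = R * adj S * (1 - E')"
    "E \<in> negl \<or> (\<exists>Z. E = Z * neg (N - (1/2) *\<^sub>R 1))" "E' \<in> negl \<or> (\<exists>Z. E' = Z * neg (M - (1/2) *\<^sub>R 1))"
proof -
  define Ts where "Ts = {S, adj S}"
  have Ts: "adj T \<in> Ts" if "T \<in> Ts" for T using that by (auto simp: Ts_def)
  have cTs: "countable Ts" by (simp add: Ts_def)
  have N: "adj N = N" and M: "adj M = M" by (simp_all add: N_def M_def)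
  have Nx: "(N \<cdot> x) \<bullet> x = (S \<cdot> x) \<bullet> (S \<cdot> x)" for x by (simp add: N_def adj_inner')
  have NMx: "\<bar>(N \<cdot> x) \<bullet> x - (M \<cdot> x) \<bullet> x\<bar> \<le> 1/8 * (x \<bullet> x)" for x
  proof -
    have "\<bar>((N - M) \<cdot> x) \<bullet> x\<bar> \<le> norm ((N - M) \<cdot> x) * norm x" by (rule Cauchy_Schwarz_ineq2)
    also have "\<dots> \<le> (norm (N - M) * norm x) * norm x" by (intro mult_right_mono norm_app) auto
    also have "\<dots> \<le> (1/8 * norm x) * norm x" using NM by (intro mult_right_mono) auto
    finally show ?thesis by (simp add: inner_diff_left power2_norm_eq_inner[symmetric] power2_eq_square)
  qed
  \<comment> \<open>The value 1/4 leaves room for the deviation 1/8 between N and M on both sides: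
    off the family M is at least 1/4 - 1/8, and on it both forms are at most 1/4 + 1/8, below
    1/2.\<close>
  obtain X where X: "X \<subseteq> {e. norm e = 1 \<and> (S \<cdot> e) \<bullet> (S \<cdot> e) \<le> 1/4}"
    and orth: "\<And>x y. x \<in> X \<Longrightarrow> y \<in> X \<Longrightarrow> x \<noteq> y \<Longrightarrow> \<forall>w\<in>words Ts. cinner (w \<cdot> x) y = 0"
    and max: "\<And>a. a \<in> {e. norm e = 1 \<and> (S \<cdot> e) \<bullet> (S \<cdot> e) \<le> 1/4} \<Longrightarrow>
      (\<And>b. b \<in> X \<Longrightarrow> (\<forall>w\<in>words Ts. cinner (w \<cdot> a) b = 0) \<and> (\<forall>w\<in>words Ts. cinner (w \<cdot> b) a = 0)) \<Longrightarrow> a \<in> X"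
    using maximal_clique[of "{e. norm e = 1 \<and> (S \<cdot> e) \<bullet> (S \<cdot> e) \<le> 1/4}" "\<lambda>a b. \<forall>w\<in>words Ts. cinner (w \<cdot> a) b = 0"]
    by blast
  define Zp where "Zp = reduce Ts X"
  have Zp: "isproj Zp" by (simp add: Zp_def)
  note Za = isproj_adj[OF Zp] and Zi = isproj_idem[OF Zp]
  have ZS: "Zp * S = S * Zp" "Zp * adj S = adj S * Zp"
    unfolding Zp_def by (rule reduce_commute[OF Ts], assumption, simp add: Ts_def)+
  have ZN: "Zp * N = N * Zp" unfolding N_def by (metis ZS mult.assoc)
  have ZM: "Zp * M = M * Zp" unfolding M_def by (metis ZS mult.assoc)
  \<comment> \<open>By maximality: a normalised counterexample is orthogonal to all orbits of the
    family and could be added to it.\<close>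
  have low: "1/4 * (v \<bullet> v) \<le> (S \<cdot> v) \<bullet> (S \<cdot> v)" if v: "Zp \<cdot> v = 0" for v
  proof (rule ccontr)
    assume neg: "\<not> ?thesis"
    then have v0: "v \<noteq> 0" by auto
    define u where "u = (1 / norm v) *\<^sub>R v"
    have u1: "norm u = 1" using v0 by (simp add: u_def)
    have "(S \<cdot> u) \<bullet> (S \<cdot> u) = ((S \<cdot> v) \<bullet> (S \<cdot> v)) / (norm v)\<^sup>2"
      by (simp add: u_def app_scaleR power2_eq_square)
    also have "\<dots> \<le> 1/4" using neg v0 by (simp add: field_simps power2_norm_eq_inner)
    finally have uA: "u \<in> {e. norm e = 1 \<and> (S \<cdot> e) \<bullet> (S \<cdot> e) \<le> 1/4}" using u1 by simp
    have "Zp \<cdot> u = 0" using v by (simp add: u_def app_scaleR)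
    then have uc: "u \<in> corth (orbit Ts X)" by (simp add: Zp_def reduce_0_iff)
    have 1: "cinner (w \<cdot> b) u = 0" if "b \<in> X" "w \<in> words Ts" for b w
    proof -
      have "w \<cdot> b \<in> orbit Ts X" using that orbit_superset by (intro orbit_app) auto
      then show ?thesis using uc by (auto simp: corth_def)
    qed
    have 2: "cinner (w \<cdot> u) b = 0" if "b \<in> X" "w \<in> words Ts" for b w
    proof -
      have "cinner (w \<cdot> u) b = cinner u (adj w \<cdot> b)" by (rule adj_cinner)
      also have "\<dots> = cnj (cinner (adj w \<cdot> b) u)" by (rule cinner_commute)
      finally show ?thesis using 1[OF that(1) words_adj[OF Ts that(2)]] by simp
    qed
    have "u \<in> X" by (rule max[OF uA]) (use 1 2 in blast)
    then have "Zp \<cdot> u = u" unfolding Zp_def using orbit_superset by (intro reduce_app) auto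
    then show False using \<open>Zp \<cdot> u = 0\<close> u1 by simp
  qed
  show thesis
  proof (cases "countable X")
    case True
    have Zn: "Zp \<in> negl" unfolding Zp_def by (intro reduce_negl cTs small_countable True)
    have "1/8 * (x \<bullet> x) \<le> (N \<cdot> x) \<bullet> x \<and> 1/8 * (x \<bullet> x) \<le> (M \<cdot> x) \<bullet> x" if "Zp \<cdot> x = 0" for x
      using low[OF that] NMx[of x] inner_ge_zero[of x] unfolding Nx[symmetric] by linarith
    \<comment> \<open>\<open>Zp\<close> itself serves as the partial isometry on the exceptional
      part.\<close>
    then obtain U where "adj U * U = 1" "U * adj U = 1" "U * (1 - Zp) = S * R * (1 - Zp)"
      "adj U * (1 - Zp) = R * adj S * (1 - Zp)"
      using polar_unitary[OF Zp Zp ZS(1), of Zp] unfolding N_def M_def R_def by (auto simp: Za Zi)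
    then show thesis using Zn that by blast
  next
    case False
    then have infX: "infinite X" using countable_finite by blast
    let ?n = "neg (N - (1/2) *\<^sub>R 1)" and ?m = "neg (M - (1/2) *\<^sub>R 1)"
    have sa: "adj (N - (1/2) *\<^sub>R 1) = N - (1/2) *\<^sub>R 1" "adj (M - (1/2) *\<^sub>R 1) = M - (1/2) *\<^sub>R 1"
      by (simp_all add: N M)
    \<comment> \<open>Low spectral parts inside the range of \<open>Zp\<close> only; off that range
      S and \<open>adj S\<close> are already bounded below.\<close>
    define E where "E = Zp * ?n"
    define E' where "E' = Zp * ?m"
    have Zn: "?n * Zp = Zp * ?n" by (rule neg_commute[OF sa(1)]) (simp add: algebra_simps ZN)
    have Zm: "?m * Zp = Zp * ?m" by (rule neg_commute[OF sa(2)]) (simp add: algebra_simps ZM)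
    have projmult: "isproj (P * Q)" if "isproj P" "isproj Q" "Q * P = P * Q" for P Q :: "'a bop"
      unfolding isproj_def using that isproj_adj isproj_idem by (metis adj_simps(7) mult.assoc)
    have E: "isproj E" unfolding E_def by (rule projmult[OF Zp isproj_neg Zn])
    have E': "isproj E'" unfolding E'_def by (rule projmult[OF Zp isproj_neg Zm])
    have "?m * S = S * ?n" by (rule neg_intertwine[OF sa(2,1)]) (simp add: algebra_simps M_def N_def)
    then have ES: "E' * S = S * E" unfolding E_def E'_def by (metis ZS(1) mult.assoc)
    have high: "1/2 * (y \<bullet> y) \<le> (A \<cdot> y) \<bullet> y" if "adj A = A" "neg (A - (1/2) *\<^sub>R 1) \<cdot> y = 0" for A y
    proof -
      have "pos ((A - (1/2) *\<^sub>R 1) * (1 - neg (A - (1/2) *\<^sub>R 1)))" by (rule neg_pos) (simp add: that(1))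
      then have "0 \<le> (((A - (1/2) *\<^sub>R 1) * (1 - neg (A - (1/2) *\<^sub>R 1))) \<cdot> y) \<bullet> y" by (simp add: pos_def)
      then show ?thesis using that(2) by (simp add: inner_diff_left app_diff)
    qed
    \<comment> \<open>\<open>Zp\<close> splits x into orthogonal parts that A does not mix: inside,
      the spectral bound 1/2 applies, outside, the assumption \<open>lo\<close>.\<close>
    have lowE: "1/8 * (x \<bullet> x) \<le> (A \<cdot> x) \<bullet> x"
      if A: "adj A = A" and ZA: "Zp * A = A * Zp" and x: "(Zp * neg (A - (1/2) *\<^sub>R 1)) \<cdot> x = 0"
        and lo: "\<And>v. Zp \<cdot> v = 0 \<Longrightarrow> 1/8 * (v \<bullet> v) \<le> (A \<cdot> v) \<bullet> v" for A x
    proof -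
      let ?y = "Zp \<cdot> x" and ?z = "x - Zp \<cdot> x"
      have nZ: "neg (A - (1/2) *\<^sub>R 1) * Zp = Zp * neg (A - (1/2) *\<^sub>R 1)"
        by (rule neg_commute) (simp_all add: A algebra_simps ZA)
      have "neg (A - (1/2) *\<^sub>R 1) \<cdot> ?y = 0" using x arg_cong[OF nZ, of "\<lambda>T. T \<cdot> x"] by simp
      then have 1: "1/2 * (?y \<bullet> ?y) \<le> (A \<cdot> ?y) \<bullet> ?y" by (rule high[OF A])
      have ZZ: "Zp \<cdot> Zp \<cdot> w = Zp \<cdot> w" for w using arg_cong[OF Zi, of "\<lambda>T. T \<cdot> w"] by simp
      have ZAx: "Zp \<cdot> A \<cdot> w = A \<cdot> Zp \<cdot> w" for w using arg_cong[OF ZA, of "\<lambda>T. T \<cdot> w"] by simp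
      have 2: "1/8 * (?z \<bullet> ?z) \<le> (A \<cdot> ?z) \<bullet> ?z" by (rule lo) (simp add: app_diff ZZ)
      have o1: "?y \<bullet> ?z = 0" using adj_inner[of Zp x ?z] by (simp add: Za app_diff ZZ)
      have o2: "(A \<cdot> ?y) \<bullet> ?z = 0"
        using adj_inner[of Zp "A \<cdot> x" ?z] by (simp add: Za app_diff ZZ ZAx)
      have o3: "(A \<cdot> ?z) \<bullet> ?y = 0" using adj_inner[of A ?z ?y] o2 by (simp add: A inner_commute)
      have "x \<bullet> x = (?y + ?z) \<bullet> (?y + ?z)" by simp
      also have "\<dots> = ?y \<bullet> ?y + ?z \<bullet> ?z" using o1 unfolding inner_add_left inner_add_right by (simp add: inner_commute)
      finally have xx: "x \<bullet> x = ?y \<bullet> ?y + ?z \<bullet> ?z" .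
      have "(A \<cdot> x) \<bullet> x = (A \<cdot> (?y + ?z)) \<bullet> (?y + ?z)" by simp
      also have "\<dots> = (A \<cdot> ?y) \<bullet> ?y + (A \<cdot> ?z) \<bullet> ?z"
        unfolding app_add inner_add_left inner_add_right using o2 o3 by simp
      finally show ?thesis using 1 2 xx inner_ge_zero[of ?y] by argo
    qed
    have lo: "1/8 * (x \<bullet> x) \<le> (N \<cdot> x) \<bullet> x" "1/8 * (x \<bullet> x) \<le> (M \<cdot> x) \<bullet> x" if "Zp \<cdot> x = 0" for x
      using low[OF that] NMx[of x] inner_ge_zero[of x] unfolding Nx[symmetric] by linarith+
    have lowEN: "E \<cdot> x = 0 \<Longrightarrow> 1/8 * (x \<bullet> x) \<le> (N \<cdot> x) \<bullet> x" for x
      unfolding E_def by (rule lowE[OF N ZN]) (use lo in auto)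
    have lowEM: "E' \<cdot> x = 0 \<Longrightarrow> 1/8 * (x \<bullet> x) \<le> (M \<cdot> x) \<bullet> x" for x
      unfolding E'_def by (rule lowE[OF M ZM]) (use lo in auto)
    \<comment> \<open>Generic in A to cover both N and M. Each member of the family has a nonzero
      component in the range of F, and these are orthogonal, so there are at least |X| dimensions;
      each cyclic subspace is separable, so there are at most |X|.\<close>
    have cardB: "|B| =o |X|"
      if A: "adj A = A" and AT: "\<And>P. P * S = S * P \<Longrightarrow> P * adj S = adj S * P \<Longrightarrow> P * A = A * P"
        and Ax: "\<And>e. e \<in> X \<Longrightarrow> (A \<cdot> e) \<bullet> e < 1/2"
        and F: "F = Zp * neg (A - (1/2) *\<^sub>R 1)" "isproj F" and B: "is_onb {x. F \<cdot> x = x} B" for A F B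
    proof -
      let ?k = "neg (A - (1/2) *\<^sub>R 1)"
      have sA: "adj (A - (1/2) *\<^sub>R 1) = A - (1/2) *\<^sub>R 1" by (simp add: A)
      have kP: "?k * reduce Ts Y = reduce Ts Y * ?k" for Y
      proof (rule neg_commute[OF sA])
        have "reduce Ts Y * A = A * reduce Ts Y"
          by (rule AT; rule reduce_commute[OF Ts]) (simp_all add: Ts_def)
        then show "(A - (1/2) *\<^sub>R 1) * reduce Ts Y = reduce Ts Y * (A - (1/2) *\<^sub>R 1)" by (simp add: algebra_simps)
      qed
      have B': "orthonormal B" "closure (cspan B) = {x. F \<cdot> x = x}" using B is_onb_iff[OF closed_csub_fix] by blast+
      have Bsub: "B \<subseteq> {x. F \<cdot> x = x}" using B by (auto simp: is_onb_def)
      have upper: "|B| \<le>o |X|"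
      proof -
        let ?Y = "app F ` orbit Ts X"
        have "B \<subseteq> closure (cspan ?Y)"
        proof
          fix b assume "b \<in> B"
          have "orbit Ts X \<subseteq> {x. F \<cdot> x \<in> closure (cspan ?Y)}" using closure_cspan_superset[of ?Y] by blast
          then have "closure (cspan (orbit Ts X)) \<subseteq> {x. F \<cdot> x \<in> closure (cspan ?Y)}"
            by (rule closure_cspan_minimal) (simp add: closed_csub_vimage)
          moreover have "Zp \<cdot> b \<in> closure (cspan (orbit Ts X))"
            unfolding Zp_def reduce_def by (rule proj_in) simp
          ultimately have "F \<cdot> Zp \<cdot> b \<in> closure (cspan ?Y)" by blast
          moreover have "F * Zp = F" using kP[of X] Zi by (simp add: F(1) Zp_def mult.assoc) (simp flip: mult.assoc)
          then have "F \<cdot> Zp \<cdot> b = F \<cdot> b" by (metis app_simps(3))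
          ultimately show "b \<in> closure (cspan ?Y)" using \<open>b \<in> B\<close> Bsub by auto
        qed
        then have "|B| \<le>o |?Y \<times> (UNIV :: nat set)|" by (rule card_of_orthonormal[OF B'(1)])
        also have "|?Y \<times> (UNIV :: nat set)| \<le>o |X|"
        proof (rule card_of_Sigma_ordLeq_infinite[OF infX])
          have "|words Ts \<times> X| \<le>o |X|"
          proof (rule card_of_Sigma_ordLeq_infinite[OF infX])
            obtain f :: "'a bop \<Rightarrow> nat" where "inj_on f (words Ts)"
              using countable_words[OF cTs] by (auto simp: countable_def)
            then have "|words Ts| \<le>o |UNIV :: nat set|" using card_of_ordLeq by (metis subset_UNIV)
            also have "|UNIV :: nat set| \<le>o |X|" using infX by (simp add: infinite_iff_card_of_nat)
            finally show "|words Ts| \<le>o |X|" .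
          qed (simp add: card_of_refl ordIso_imp_ordLeq)
          then have "|orbit Ts X| \<le>o |X|" unfolding orbit_def using card_of_image ordLeq_transitive by blast
          then show "|?Y| \<le>o |X|" using card_of_image ordLeq_transitive by blast
        qed (use infX in \<open>simp add: infinite_iff_card_of_nat\<close>)
        finally show ?thesis .
      qed
      have Fe: "F \<cdot> e = ?k \<cdot> e" if "e \<in> X" for e
      proof -
        have "Zp \<cdot> e = e" unfolding Zp_def using that orbit_superset by (intro reduce_app) auto
        moreover have "F = ?k * Zp" using kP[of X] by (simp add: F(1) Zp_def)
        ultimately show ?thesis by simp
      qed
      have Fe0: "F \<cdot> e \<noteq> 0" if e: "e \<in> X" for e
      proof
        assume "F \<cdot> e = 0"
        then have "1/2 * (e \<bullet> e) \<le> (A \<cdot> e) \<bullet> e" using Fe[OF e] by (intro high[OF A]) simp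
        moreover have "e \<bullet> e = 1" using X e by (auto simp: power2_norm_eq_inner[symmetric])
        ultimately show False using Ax[OF e] by simp
      qed
      have Forth: "cinner (F \<cdot> e) (F \<cdot> e') = 0" if e: "e \<in> X" "e' \<in> X" "e \<noteq> e'" for e e'
      proof -
        have "x \<in> corth (orbit Ts {e})" if x: "x \<in> orbit Ts {e'}" for x
        proof -
          obtain w' where w': "w' \<in> words Ts" "x = w' \<cdot> e'" using x by (auto simp: orbit_def)
          have "cinner (w \<cdot> e) x = 0" if "w \<in> words Ts" for w
          proof -
            have "cinner ((adj w' * w) \<cdot> e) e' = 0"
              using orth[OF e] words_mult_words[OF words_adj[OF Ts w'(1)] that] by blast
            then show ?thesis by (simp add: adj_cinner w')
          qed
          then show ?thesis by (auto simp: corth_def orbit_def)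
        qed
        then have z: "reduce Ts {e} * reduce Ts {e'} = 0"
          by (intro reduce_orbit_zero) (simp add: reduce_0_iff)
        have r: "reduce Ts {a} \<cdot> ?k \<cdot> a = ?k \<cdot> a" for a
        proof -
          have "reduce Ts {a} \<cdot> a = a" using orbit_superset by (intro reduce_app) auto
          then show ?thesis using arg_cong[OF kP[of "{a}"], of "\<lambda>T. T \<cdot> a"] by simp
        qed
        have "cinner (?k \<cdot> e) (?k \<cdot> e') = cinner (reduce Ts {e} \<cdot> ?k \<cdot> e) (reduce Ts {e'} \<cdot> ?k \<cdot> e')" by (simp add: r)
        also have "\<dots> = cinner (?k \<cdot> e) ((reduce Ts {e} * reduce Ts {e'}) \<cdot> ?k \<cdot> e')"
          by (simp add: adj_cinner isproj_adj)
        also have "\<dots> = 0" using z cinner_scaleC_right[of "?k \<cdot> e" 0 0] by simp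
        finally show ?thesis by (simp add: Fe e)
      qed
      define u where "u e = (1 / norm (F \<cdot> e)) *\<^sub>R F \<cdot> e" for e
      have uu: "cinner (u e) (u e') = (if e = e' then 1 else 0)" if "e \<in> X" "e' \<in> X" for e e'
        using Forth[OF that] Fe0[OF that(1)]
        by (auto simp: u_def scaleR_scaleC cinner_scaleC_left cinner_scaleC_right cinner_self power2_eq_square)
      have inj: "inj_on u X"
        by (rule inj_onI) (metis uu zero_neq_one)
      have on: "orthonormal (u ` X)" unfolding orthonormal_def using uu by (auto simp: inj_on_eq_iff[OF inj])
      have sub: "u ` X \<subseteq> closure (cspan B)"
        unfolding B'(2) using arg_cong[OF isproj_idem[OF F(2)], of "\<lambda>T. T \<cdot> _"] by (auto simp: u_def app_scaleR)
      have XB: "|X| \<le>o |u ` X|" using inj by (meson card_of_ordLeq order_refl)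
      have "infinite B"
      proof
        assume "finite B"
        then have "countable (u ` X)" by (intro card_of_orthonormal_countable[OF on sub] countable_finite)
        then show False using False countable_image_inj_on inj by blast
      qed
      then have "|u ` X| \<le>o |B|" by (rule card_of_orthonormal_infinite[OF on sub])
      with XB have "|X| \<le>o |B|" by (rule ordLeq_transitive)
      with upper show ?thesis by (simp add: ordIso_iff_ordLeq)
    qed
    obtain B where B: "is_onb {x. E \<cdot> x = x} B" using onb_exists closed_csub_fix by blast
    obtain C where C: "is_onb {x. E' \<cdot> x = x} C" using onb_exists closed_csub_fix by blast
    have Xe: "(N \<cdot> e) \<bullet> e < 1/2" "(M \<cdot> e) \<bullet> e < 1/2" if "e \<in> X" for e
    proof -
      have "e \<bullet> e = 1" "(S \<cdot> e) \<bullet> (S \<cdot> e) \<le> 1/4" using X that by (auto simp: power2_norm_eq_inner[symmetric])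
      then show "(N \<cdot> e) \<bullet> e < 1/2" "(M \<cdot> e) \<bullet> e < 1/2" using NMx[of e] unfolding Nx[symmetric] by linarith+
    qed
    have "|B| =o |X|"
      by (rule cardB[OF N _ _ E_def E B]) (use Xe in \<open>auto simp: N_def\<close>, metis mult.assoc)
    moreover have "|C| =o |X|"
      by (rule cardB[OF M _ _ E'_def E' C]) (use Xe in \<open>auto simp: M_def\<close>, metis mult.assoc)
    ultimately have "|B| =o |C|" using ordIso_symmetric ordIso_transitive by blast
    then obtain \<beta> where "bij_betw \<beta> B C" using card_of_ordIso by blast
    moreover have B': "orthonormal B" "closure (cspan B) = {x. E \<cdot> x = x}" using B is_onb_iff[OF closed_csub_fix] by blast+
    moreover have C': "orthonormal C" "closure (cspan C) = {x. E' \<cdot> x = x}" using C is_onb_iff[OF closed_csub_fix] by blast+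
    ultimately obtain W where "adj W * W = E" "W * adj W = E'"
      using partial_isometry[of B C \<beta>] by (metis proj_range[OF E] proj_range[OF E'])
    then obtain U where "adj U * U = 1" "U * adj U = 1" "U * (1 - E) = S * R * (1 - E)"
      "adj U * (1 - E') = R * adj S * (1 - E')"
      using polar_unitary[OF E E' ES] lowEN lowEM unfolding N_def M_def R_def by blast
    then show thesis using that[of U E E'] E_def E'_def by blast
  qed
qed

end

section \<open>Quadrant projections\<close>

lemma norm_ii: "norm (ii :: 'a::complex_hilbert bop) \<le> 1"
  by (rule norm_bop_bound) auto

text \<open>1 + T^2 has its spectrum in [1, 2], where the inverse square root is at least
  1/2.\<close>

lemma polar_fun_spec:
  assumes T: "adj T = T" "norm T \<le> 1"
  defines "\<rho> \<equiv> fc (1 + T * T) polar_fun"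
  shows "adj \<rho> = \<rho>" "pos (\<rho> - (1/2) *\<^sub>R 1)" "\<rho> * T = T * \<rho>"
proof -
  let ?D = "1 + T * T"
  have D: "adj ?D = ?D" using T by simp
  have "norm (T * T) \<le> norm T * norm T" by (rule norm_mult_ineq)
  also have "\<dots> \<le> 1 * 1" using T by (intro mult_mono) auto
  finally have "pos (1 *\<^sub>R 1 - T * T)" using T by (intro pos_norm_diff) auto
  also have "1 *\<^sub>R 1 - T * T = 2 *\<^sub>R 1 - ?D" by (simp add: scaleR_2)
  finally have "pos (2 *\<^sub>R 1 - ?D)" .
  moreover have "pos (?D - 1 *\<^sub>R 1)" using pos_adj_mult[of T] T by simp
  ultimately have sp: "spec_in 1 2 ?D" by (simp only: spec_in_def simp_thms)
  show "adj \<rho> = \<rho>" unfolding \<rho>_def by (rule fc_adj[OF D continuous_polar_fun])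
  show "\<rho> * T = T * \<rho>" unfolding \<rho>_def
    by (rule fc_intertwine_exact[OF D D continuous_polar_fun]) (simp add: algebra_simps)
  have "pos (fc ?D (\<lambda>t. polar_fun t - 1/2))"
  proof (rule fc_pos[OF sp])
    show "continuous_on UNIV (\<lambda>t. polar_fun t - 1/2)" by (intro continuous_on_diff continuous_polar_fun continuous_on_const)
    show "0 \<le> polar_fun t - 1/2" if "t \<in> {1..2}" for t
    proof -
      have "sqrt t \<le> sqrt 4" using that by (intro real_sqrt_le_mono) auto
      moreover have "max t (1/16) = t" "0 < sqrt t" using that by auto
      ultimately show ?thesis by (simp add: polar_fun_def field_simps)
    qed
  qed simp
  then show "pos (\<rho> - (1/2) *\<^sub>R 1)"
    by (simp add: \<rho>_def fc_diff[OF D continuous_polar_fun continuous_on_const] fc_const[OF D])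
qed

context uncountable_cardinal
begin

text \<open>Along V the operator S looks like A, while N and M look like 1 + T^2, far above the low
  spectral parts. So V avoids E and E', and U acts along V as the phase of A.\<close>

lemma unitary_on_module:
  fixes S :: "'a bop"
  defines "N \<equiv> adj S * S" and "M \<equiv> S * adj S"
  defines "R \<equiv> fc N polar_fun"
  assumes U: "U * (1 - E) = S * R * (1 - E)" "adj U * (1 - E') = R * adj S * (1 - E')"
    and E: "E \<in> negl \<or> (\<exists>Z. E = Z * neg (N - (1/2) *\<^sub>R 1))" and E': "E' \<in> negl \<or> (\<exists>Z. E' = Z * neg (M - (1/2) *\<^sub>R 1))"
    and V: "S * V \<doteq> V * A" "adj S * V \<doteq> V * B"
    and AB: "A * B = 1 + T * T" "B * A = 1 + T * T" and T: "adj T = T"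
  shows "U * V \<doteq> V * (A * fc (1 + T * T) polar_fun)" "adj U * V \<doteq> V * (fc (1 + T * T) polar_fun * B)"
proof -
  let ?D = "1 + T * T"
  let ?r = "fc ?D polar_fun"
  have D: "adj ?D = ?D" using T by simp
  have N: "adj N = N" and M: "adj M = M" by (simp_all add: N_def M_def)
  have "N * V = adj S * (S * V)" by (simp add: N_def mult.assoc)
  also have "\<dots> \<doteq> adj S * (V * A)" by (intro cong_mult_left V)
  also have "\<dots> = adj S * V * A" by (simp add: mult.assoc)
  also have "\<dots> \<doteq> V * B * A" by (intro cong_mult_right V)
  finally have NV: "N * V \<doteq> V * ?D" by (simp add: mult.assoc AB)
  have "M * V = S * (adj S * V)" by (simp add: M_def mult.assoc)
  also have "\<dots> \<doteq> S * (V * B)" by (intro cong_mult_left V)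
  also have "\<dots> = S * V * B" by (simp add: mult.assoc)
  also have "\<dots> \<doteq> V * A * B" by (intro cong_mult_right V)
  finally have MV: "M * V \<doteq> V * ?D" by (simp add: mult.assoc AB)
  have "pos ((1/2) *\<^sub>R 1 + adj T * T)" by (intro pos_add pos_scaleR pos_1 pos_adj_mult) simp
  also have "(1/2) *\<^sub>R 1 + adj T * T = (?D - (1/2) *\<^sub>R 1) - 0 *\<^sub>R 1"
  proof -
    have "(1::'a bop) = (1/2) *\<^sub>R 1 + (1/2) *\<^sub>R 1" by (simp flip: scaleR_left_distrib)
    then show ?thesis using T by (simp add: algebra_simps)
  qed
  finally have "pos (?D - (1/2) *\<^sub>R 1)" by simp
  \<comment> \<open>Subtracting 1/2 from 1 + T^2 leaves at least 1/2, so V belongs to the positive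
    side of G - 1/2.\<close>
  have kill: "neg (G - (1/2) *\<^sub>R 1) * V \<doteq> 0" if G: "adj G = G" "G * V \<doteq> V * ?D" for G
  proof (rule sign_pos[of _ "?D - (1/2) *\<^sub>R 1" _ "1/2"])
    show "(G - (1/2) *\<^sub>R 1) * V \<doteq> V * (?D - (1/2) *\<^sub>R 1)"
      using cong_diff[OF G(2) cong_refl, of "(1/2) *\<^sub>R V"] by (simp add: left_diff_distrib right_diff_distrib)
    show "pos (?D - (1/2) *\<^sub>R 1 - (1/2) *\<^sub>R 1)"
    proof -
      have "(1/2) *\<^sub>R 1 + (1/2) *\<^sub>R 1 = (1::'a bop)" by (simp flip: scaleR_left_distrib)
      then have "?D - (1/2) *\<^sub>R 1 - (1/2) *\<^sub>R 1 = adj T * T"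
        unfolding diff_diff_eq by (simp add: T)
      then show ?thesis by (simp only: pos_adj_mult)
    qed
  qed (use G D in auto)
  have EV: "E * V \<doteq> 0"
    using E
  proof
    assume "E \<in> negl" then show ?thesis using I_rules(5) by (simp add: cong_0_iff)
  next
    assume "\<exists>Z. E = Z * neg (N - (1/2) *\<^sub>R 1)"
    then show ?thesis using cong_mult_left[OF kill[OF N NV]] by (auto simp: mult.assoc)
  qed
  have EV': "E' * V \<doteq> 0"
    using E'
  proof
    assume "E' \<in> negl" then show ?thesis using I_rules(5) by (simp add: cong_0_iff)
  next
    assume "\<exists>Z. E' = Z * neg (M - (1/2) *\<^sub>R 1)"
    then show ?thesis using cong_mult_left[OF kill[OF M MV]] by (auto simp: mult.assoc)
  qed
  have V1: "(1 - E) * V \<doteq> V" and V2: "(1 - E') * V \<doteq> V"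
    using cong_diff[OF cong_refl EV, of V] cong_diff[OF cong_refl EV', of V] by (simp_all add: left_diff_distrib)
  have RV: "R * V \<doteq> V * ?r" unfolding R_def by (rule cong_fc[OF N D continuous_polar_fun NV])
  have "U * V \<doteq> U * ((1 - E) * V)" by (intro cong_mult_left cong_sym[OF V1])
  also have "\<dots> = S * R * ((1 - E) * V)" using U(1) by (simp flip: mult.assoc)
  also have "\<dots> \<doteq> S * R * V" by (intro cong_mult_left V1)
  also have "\<dots> = S * (R * V)" by (rule mult.assoc)
  also have "\<dots> \<doteq> S * (V * ?r)" by (intro cong_mult_left RV)
  also have "\<dots> = S * V * ?r" by (simp add: mult.assoc)
  also have "\<dots> \<doteq> V * A * ?r" by (intro cong_mult_right V)
  finally show "U * V \<doteq> V * (A * ?r)" by (simp only: mult.assoc)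
  have "adj U * V \<doteq> adj U * ((1 - E') * V)" by (intro cong_mult_left cong_sym[OF V2])
  also have "\<dots> = R * adj S * ((1 - E') * V)" using U(2) by (simp flip: mult.assoc)
  also have "\<dots> \<doteq> R * adj S * V" by (intro cong_mult_left V2)
  also have "\<dots> = R * (adj S * V)" by (rule mult.assoc)
  also have "\<dots> \<doteq> R * (V * B)" by (intro cong_mult_left V)
  also have "\<dots> = R * V * B" by (simp add: mult.assoc)
  also have "\<dots> \<doteq> V * ?r * B" by (intro cong_mult_right RV)
  finally show "adj U * V \<doteq> V * (?r * B)" by (simp only: mult.assoc)
qed

text \<open>The joint spectrum of \<open>X\<close> and \<open>Y\<close> is cut along both coordinate axes simultaneously: the
  normal element \<open>X + iY\<close> is replaced by a unitary near the boundary of the square, and the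
  coordinate half planes become half circles.\<close>

lemma quadrant_projections:
  fixes X Y :: "'a bop"
  assumes X: "adj X = X" "norm X \<le> 1" and Y: "adj Y = Y" "norm Y \<le> 1" and XY: "X * Y \<doteq> Y * X"
  obtains Q H where "isproj Q" "isproj H" "Q * H = H * Q"
    "\<And>V. Y * V \<doteq> V * Y \<Longrightarrow> X * V \<doteq> - V \<Longrightarrow> Q * V \<doteq> V" "\<And>V. Y * V \<doteq> V * Y \<Longrightarrow> X * V \<doteq> V \<Longrightarrow> Q * V \<doteq> 0"
    "\<And>V. X * V \<doteq> V * X \<Longrightarrow> Y * V \<doteq> - V \<Longrightarrow> H * V \<doteq> V" "\<And>V. X * V \<doteq> V * X \<Longrightarrow> Y * V \<doteq> V \<Longrightarrow> H * V \<doteq> 0"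
proof -
  have "ebound 0 (X * Y - Y * X)" by (rule congD_ebound[OF XY])
  then obtain Z where Z: "small Z"
    "\<And>P. isproj P \<Longrightarrow> (\<And>x. x \<in> Z \<Longrightarrow> P \<cdot> x = x) \<Longrightarrow> norm ((X * Y - Y * X) * (1 - P)) \<le> 0 + 1/16"
    by (rule negl_cut[of 0 _ "1/16"]) auto
  \<comment> \<open>Removing a negligible reducing part makes the commutator small in norm and not
    just modulo the ideal. The self-commutator of S is 2i times it, which turns 1/16 into the 1/8
    that the polar decomposition demands.\<close>
  define P where "P = reduce {X, Y} Z"
  have P: "isproj P" by (simp add: P_def)
  have PX: "P * X = X * P" "P * Y = Y * P" unfolding P_def by (rule reduce_commute; use X Y in auto)+
  have Pn: "P \<in> negl" unfolding P_def by (rule reduce_negl[OF _ Z(1)]) simp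
  have nC: "norm ((X * Y - Y * X) * (1 - P)) \<le> 1/16"
    using Z(2)[OF P] orbit_superset[of Z "{X, Y}"] by (auto simp: P_def intro!: reduce_app)
  define X' Y' where "X' = (1 - P) * X" and "Y' = (1 - P) * Y"
  note Pa = isproj_adj[OF P] and Pi = isproj_idem[OF P]
  have X': "adj X' = X'" and Y': "adj Y' = Y'" by (simp_all add: X'_def Y'_def X Y Pa algebra_simps PX)
  have cX: "X' \<doteq> X" and cY: "Y' \<doteq> Y"
    using I_rules(5)[OF I_rules(6)[OF Pn]] by (simp_all add: X'_def Y'_def cong_def algebra_simps)
  have "X' * Y' - Y' * X' = (X * Y - Y * X) * (1 - P)"
  proof -
    have c: "(1 - P) * X = X * (1 - P)" "(1 - P) * Y = Y * (1 - P)" by (simp_all add: algebra_simps PX)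
    have i: "(1 - P) * ((1 - P) * T) = (1 - P) * T" for T
      using isproj_idem[OF isproj_compl[OF P]] by (simp only: mult.assoc[symmetric])
    have "X' * Y' = X * ((1 - P) * ((1 - P) * Y))" by (simp only: X'_def Y'_def c(1) mult.assoc)
    then have "X' * Y' = X * Y * (1 - P)" by (simp only: i) (simp only: c(2) mult.assoc)
    moreover have "Y' * X' = Y * ((1 - P) * ((1 - P) * X))" by (simp only: X'_def Y'_def c(2) mult.assoc)
    then have "Y' * X' = Y * X * (1 - P)" by (simp only: i) (simp only: c(1) mult.assoc)
    ultimately show ?thesis by (simp only: left_diff_distrib)
  qed
  with nC have nC': "norm (X' * Y' - Y' * X') \<le> 1/16" by simp
  define S where "S = X' + ii * Y'"
  have aS: "adj S = X' - ii * Y'" by (simp add: S_def X' Y' ii_commute[of Y'])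
  have iY: "Z * (ii * W) = ii * (Z * W)" for Z W :: "'a bop"
    by (metis ii_commute mult.assoc)
  have ii2: "ii * (ii * W) = - W" for W :: "'a bop" by (simp add: ii_ii flip: mult.assoc)
  have "adj S * S - S * adj S = 2 *\<^sub>R (ii * (X' * Y' - Y' * X'))"
    unfolding aS unfolding S_def by (simp add: algebra_simps iY[of X'] iY[of Y'] ii2 mult.assoc scaleR_2)
  also have "norm \<dots> \<le> 1/8"
  proof -
    have "norm (ii * (X' * Y' - Y' * X')) \<le> norm (ii :: 'a bop) * norm (X' * Y' - Y' * X')" by (rule norm_mult_ineq)
    also have "\<dots> \<le> 1 * (1/16)" by (intro mult_mono norm_ii nC') auto
    finally show ?thesis by simp
  qed
  finally obtain U E E' where U: "adj U * U = 1" "U * adj U = 1" "U * (1 - E) = S * fc (adj S * S) polar_fun * (1 - E)"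
    "adj U * (1 - E') = fc (adj S * S) polar_fun * adj S * (1 - E')"
    "E \<in> negl \<or> (\<exists>Z. E = Z * neg (adj S * S - (1/2) *\<^sub>R 1))" "E' \<in> negl \<or> (\<exists>Z. E' = Z * neg (S * adj S - (1/2) *\<^sub>R 1))"
    by (rule unitary_polar_decomposition)
  \<comment> \<open>Real and imaginary part of U. They commute exactly as U is unitary, and
    therefore so do their spectral projections.\<close>
  define C J where "C = (1/2) *\<^sub>R (U + adj U)" and "J = (1/2) *\<^sub>R (ii * (adj U - U))"
  have C: "adj C = C" by (simp add: C_def add.commute)
  have J: "adj J = J" by (simp add: J_def algebra_simps ii_commute[of U] ii_commute[of "adj U"])
  have CJ: "C * J = J * C"
    by (simp add: C_def J_def algebra_simps iY[of U] iY[of "adj U"] U(1,2) mult.assoc)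
  have module: "U * V \<doteq> V * (A * fc (1 + T * T) polar_fun)" "adj U * V \<doteq> V * (fc (1 + T * T) polar_fun * B)"
    if "S * V \<doteq> V * A" "adj S * V \<doteq> V * B" "A * B = 1 + T * T" "B * A = 1 + T * T" "adj T = T" for V A B T
    using unitary_on_module[OF U(3-6) that] by blast+
  \<comment> \<open>On the edge X = s of the square, U acts as (s + iY)(1 + Y^2)^(-1/2), whose real
    part has the sign of s.\<close>
  have caseX: "C * V \<doteq> V * (s *\<^sub>R fc (1 + Y * Y) polar_fun)"
    if "Y * V \<doteq> V * Y" "X * V \<doteq> s *\<^sub>R V" "s * s = 1" for V s
  proof -
    let ?r = "fc (1 + Y * Y) polar_fun"
    have XV: "X' * V \<doteq> s *\<^sub>R V" by (rule cong_trans[OF cong_mult_right[OF cX] that(2)])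
    have YV: "Y' * V \<doteq> V * Y" by (rule cong_trans[OF cong_mult_right[OF cY] that(1)])
    have 1: "S * V \<doteq> V * (s *\<^sub>R 1 + ii * Y)"
      using cong_add[OF XV cong_mult_left[OF YV, of ii]] by (simp add: S_def algebra_simps iY[of V] mult.assoc)
    have 2: "adj S * V \<doteq> V * (s *\<^sub>R 1 - ii * Y)"
      using cong_diff[OF XV cong_mult_left[OF YV, of ii]] by (simp add: aS algebra_simps iY[of V] mult.assoc)
    have AB: "(s *\<^sub>R 1 + ii * Y) * (s *\<^sub>R 1 - ii * Y) = 1 + Y * Y" "(s *\<^sub>R 1 - ii * Y) * (s *\<^sub>R 1 + ii * Y) = 1 + Y * Y"
      using that(3) by (simp_all add: algebra_simps iY[of Y] ii2 mult.assoc)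
    note UV = module[OF 1 2 AB Y(1)]
    have "C * V = (1/2) *\<^sub>R (U * V + adj U * V)" by (simp add: C_def algebra_simps)
    also have "\<dots> \<doteq> (1/2) *\<^sub>R (V * ((s *\<^sub>R 1 + ii * Y) * ?r) + V * (?r * (s *\<^sub>R 1 - ii * Y)))"
      by (intro cong_scaleR cong_add UV)
    also have "\<dots> = V * (s *\<^sub>R ?r)"
    proof -
      have "(s *\<^sub>R 1 + ii * Y) * ?r + ?r * (s *\<^sub>R 1 - ii * Y) = (2 * s) *\<^sub>R ?r"
        using polar_fun_spec(3)[OF Y] by (simp add: algebra_simps iY[of ?r] mult.assoc) (simp flip: scaleR_left_distrib)
      then show ?thesis by (simp flip: distrib_left)
    qed
    finally show ?thesis .
  qed
  have caseY: "J * V \<doteq> V * (s *\<^sub>R fc (1 + X * X) polar_fun)"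
    if "X * V \<doteq> V * X" "Y * V \<doteq> s *\<^sub>R V" "s * s = 1" for V s
  proof -
    let ?r = "fc (1 + X * X) polar_fun"
    have XV: "X' * V \<doteq> V * X" by (rule cong_trans[OF cong_mult_right[OF cX] that(1)])
    have YV: "Y' * V \<doteq> s *\<^sub>R V" by (rule cong_trans[OF cong_mult_right[OF cY] that(2)])
    have 1: "S * V \<doteq> V * (X + s *\<^sub>R ii)"
      using cong_add[OF XV cong_mult_left[OF YV, of ii]] by (simp add: S_def algebra_simps ii_commute[of V] mult.assoc)
    have 2: "adj S * V \<doteq> V * (X - s *\<^sub>R ii)"
      using cong_diff[OF XV cong_mult_left[OF YV, of ii]] by (simp add: aS algebra_simps ii_commute[of V] mult.assoc)
    have AB: "(X + s *\<^sub>R ii) * (X - s *\<^sub>R ii) = 1 + X * X" "(X - s *\<^sub>R ii) * (X + s *\<^sub>R ii) = 1 + X * X"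
      using that(3) by (simp_all add: algebra_simps ii_commute[of X] ii_ii)
    note UV = module[OF 1 2 AB X(1)]
    have "J * V = (1/2) *\<^sub>R (ii * (adj U * V - U * V))" by (simp add: J_def algebra_simps)
    also have "\<dots> \<doteq> (1/2) *\<^sub>R (ii * (V * (?r * (X - s *\<^sub>R ii)) - V * ((X + s *\<^sub>R ii) * ?r)))"
      by (intro cong_scaleR cong_mult_left cong_diff UV)
    also have "\<dots> = V * (s *\<^sub>R ?r)"
    proof -
      have "ii * (?r * (X - s *\<^sub>R ii) - (X + s *\<^sub>R ii) * ?r) = (2 * s) *\<^sub>R ?r"
        using polar_fun_spec(3)[OF X]
        by (simp add: algebra_simps ii_commute[of ?r, symmetric] ii2 mult.assoc) (simp flip: scaleR_left_distrib)
      then have "V * (ii * (?r * (X - s *\<^sub>R ii) - (X + s *\<^sub>R ii) * ?r)) = V * ((2 * s) *\<^sub>R ?r)" by simp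
      then show ?thesis by (simp add: right_diff_distrib iY[of V])
    qed
    finally show ?thesis .
  qed
  have minus: "neg G * V \<doteq> V"
    if "adj G = G" "G * V \<doteq> V * ((-1) *\<^sub>R fc (1 + T * T) polar_fun)" "adj T = T" "norm T \<le> 1" for G V T
    by (rule sign_neg[OF that(1) _ that(2), of "1/2"]) (use polar_fun_spec[OF that(3,4)] in \<open>simp_all add: algebra_simps\<close>)
  have plus: "neg G * V \<doteq> 0"
    if "adj G = G" "G * V \<doteq> V * (1 *\<^sub>R fc (1 + T * T) polar_fun)" "adj T = T" "norm T \<le> 1" for G V T
    by (rule sign_pos[OF that(1) _ that(2), of "1/2"]) (use polar_fun_spec[OF that(3,4)] in simp_all)
  show thesis
  proof (rule that[of "neg C" "neg J"])
    show "neg C * neg J = neg J * neg C" by (rule neg_commute_neg[OF C J CJ])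
    show "neg C * V \<doteq> V" if "Y * V \<doteq> V * Y" "X * V \<doteq> - V" for V
      by (rule minus[OF C _ Y], rule caseX) (use that in simp_all)
    show "neg C * V \<doteq> 0" if "Y * V \<doteq> V * Y" "X * V \<doteq> V" for V
      by (rule plus[OF C _ Y], rule caseX) (use that in simp_all)
    show "neg J * V \<doteq> V" if "X * V \<doteq> V * X" "Y * V \<doteq> - V" for V
      by (rule minus[OF J _ X], rule caseY) (use that in simp_all)
    show "neg J * V \<doteq> 0" if "X * V \<doteq> V * X" "Y * V \<doteq> V" for V
      by (rule plus[OF J _ X], rule caseY) (use that in simp_all)
  qed simp_all
qed

end

section \<open>Ladders of spectral cut-offs\<close>

definition clamp :: "real \<Rightarrow> real" where "clamp t = max 0 (min 1 t)"

lemma clamp_simps: "t \<le> 0 \<Longrightarrow> clamp t = 0" "1 \<le> t \<Longrightarrow> clamp t = 1" "0 \<le> clamp t" "clamp t \<le> 1"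
  by (auto simp: clamp_def)

lemma clamp_mono: "s \<le> t \<Longrightarrow> clamp s \<le> clamp t"
  by (auto simp: clamp_def)

lemma continuous_clamp: "continuous_on UNIV f \<Longrightarrow> continuous_on UNIV (\<lambda>x. clamp (f x))"
  unfolding clamp_def by (intro continuous_intros)

text \<open>A continuous ramp in A that rises from 0 at k to 1 at k + 1.\<close>

definition rung :: "'a::complex_hilbert bop \<Rightarrow> nat \<Rightarrow> 'a bop" where
  "rung A k = fc A (\<lambda>x. clamp (x - real k))"

lemma continuous_rung: "continuous_on UNIV (\<lambda>x. clamp (x - real k))"
  by (intro continuous_clamp continuous_intros)

lemma rung_below: "j < k \<Longrightarrow> clamp (x - real k) * clamp (x - real j) = clamp (x - real k)"
  by (cases "x \<le> real k") (auto simp: clamp_simps)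

lemma adj_rung: "adj A = A \<Longrightarrow> adj (rung A k) = rung A k"
  unfolding rung_def by (rule fc_adj[OF _ continuous_rung])

lemma rung_mult_fc: "adj A = A \<Longrightarrow> continuous_on UNIV f \<Longrightarrow> rung A k * fc A f = fc A (\<lambda>x. clamp (x - real k) * f x)"
  unfolding rung_def by (simp add: fc_mult continuous_rung)

lemma fc_zero: "adj A = A \<Longrightarrow> fc A (\<lambda>x. 0) = 0"
  using fc_const[of A 0] by simp

lemma fc_one: "adj A = A \<Longrightarrow> fc A (\<lambda>x. 1) = 1"
  using fc_const[of A 1] by simp

lemma fc_sum:
  assumes A: "adj A = A" and f: "\<And>i. i \<in> S \<Longrightarrow> continuous_on UNIV (f i)"
  shows "fc A (\<lambda>x. \<Sum>i\<in>S. f i x) = (\<Sum>i\<in>S. fc A (f i))"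
  using f
proof (induction S rule: infinite_finite_induct)
  case (insert i S)
  then have "continuous_on UNIV (\<lambda>x. \<Sum>i\<in>S. f i x)" by (intro continuous_on_sum) auto
  then show ?case using insert by (simp add: fc_add[OF A])
qed (simp_all add: fc_zero[OF A])

text \<open>With \<open>staircase_lower\<close>: scalar estimates for the two extreme staircases
  between which, modulo the ideal, the sum in \<open>staircase_ebound\<close> lies.\<close>

lemma staircase_upper: "x \<le> 2 * real n + 2 \<Longrightarrow> x - 2 * (\<Sum>i<n. clamp (x - real (2 * i + 2))) \<le> 2"
proof -
  \<comment> \<open>Truncation at the height reached by n steps makes the induction work for all
    x.\<close>
  have "min x (2 * real n + 2) - 2 \<le> 2 * (\<Sum>i<n. clamp (x - real (2 * i + 2)))"
  proof (induction n)
    case 0 then show ?case by simp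
  next
    case (Suc n)
    have "min x (2 * real (Suc n) + 2) - 2 \<le> min x (2 * real n + 2) - 2 + 2 * clamp (x - real (2 * n + 2))"
      by (auto simp: clamp_def min_def max_def)
    also have "\<dots> \<le> 2 * (\<Sum>i<Suc n. clamp (x - real (2 * i + 2)))" using Suc by simp
    finally show ?case .
  qed
  moreover assume "x \<le> 2 * real n + 2"
  ultimately show ?thesis by simp
qed

lemma staircase_lower: "0 \<le> x \<Longrightarrow> 2 * (\<Sum>i<n. clamp (x - real (2 * i))) \<le> x + 2"
proof -
  assume x: "0 \<le> x"
  have "2 * (\<Sum>i<n. clamp (x - real (2 * i))) \<le> min (x + 2) (2 * real n)"
  proof (induction n)
    case 0 then show ?case using x by simp
  next
    case (Suc n)
    have "2 * (\<Sum>i<Suc n. clamp (x - real (2 * i))) \<le> min (x + 2) (2 * real n) + 2 * clamp (x - real (2 * n))"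
      using Suc by simp
    also have "\<dots> \<le> min (x + 2) (2 * real (Suc n))"
      by (auto simp: clamp_def min_def max_def)
    finally show ?case .
  qed
  then show ?thesis by simp
qed

context uncountable_cardinal
begin

lemma pinch_cong:
  assumes F: "partition n F" and Y: "\<And>l. l \<le> n \<Longrightarrow> F l * Y \<doteq> Y * F l"
  shows "pinch n F Y \<doteq> Y"
proof -
  have "(Y * F l - F l * Y) * F l \<doteq> 0" if "l \<le> n" for l
    using cong_mult_right[OF cong_diff[OF cong_sym[OF Y[OF that]] cong_refl, of "F l * Y"], of "F l"] by simp
  then have "Y - pinch n F Y \<doteq> (\<Sum>l\<le>n. 0)" unfolding pinch_diff[OF F] by (intro cong_sum) auto
  then have "Y \<doteq> pinch n F Y" using cong_iff_diff by simp
  then show ?thesis by (rule cong_sym)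
qed

lemma flag_step_cong: "(\<And>i. i < n \<Longrightarrow> G i * Y \<doteq> Y * G i) \<Longrightarrow> l \<le> n \<Longrightarrow> flag_step n G l * Y \<doteq> Y * flag_step n G l"
  unfolding flag_step_def left_diff_distrib right_diff_distrib by (intro cong_diff) auto

lemma flag_commute:
  assumes "\<And>l. l \<le> n \<Longrightarrow> flag_step n G l * Y = Y * flag_step n G l" "i < n"
  shows "G i * Y = Y * G i"
  unfolding sum_flag_step[OF assms(2), symmetric] sum_distrib_left sum_distrib_right
  using assms by (intro sum.cong) auto

lemma cong_commute_fc:
  assumes A: "adj A = A" and f: "continuous_on UNIV f" and "A * Y \<doteq> Y * A"
  shows "fc A f * Y \<doteq> Y * fc A f"
  by (rule cong_fc[OF A A f assms(3)])

lemma cong_commute_fc2: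
  assumes A: "adj A = A" and B: "adj B = B" and f: "continuous_on UNIV f" and g: "continuous_on UNIV g" and AB: "A * B \<doteq> B * A"
  shows "fc A f * fc B g \<doteq> fc B g * fc A f"
  by (rule cong_sym, rule cong_commute_fc[OF B g], rule cong_sym, rule cong_commute_fc[OF A f AB])

lemma ebound_commutator:
  assumes Z: "ebound c Z" "0 \<le> c" and P: "norm P \<le> 1"
  shows "ebound (2 * c) (P * Z - Z * P)"
proof -
  have "ebound (norm P * c + c * norm (- P)) (P * Z + Z * (- P))"
    by (intro ebound_add ebound_mult_left ebound_mult_right Z)
  moreover have "norm P * c \<le> 1 * c" using Z P by (intro mult_right_mono) auto
  ultimately have "ebound (2 * c) (P * Z + Z * (- P))" by (elim ebound_mono) (simp add: mult.commute)
  then show ?thesis by simp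
qed

text \<open>Order estimates replace norm estimates here because the number of steps is not bounded.\<close>

lemma staircase_ebound:
  assumes A: "spec_in 1 (2 * real n) A" and n: "n > 0"
    and H: "\<And>i. i < n \<Longrightarrow> isproj (H i)"
    and up: "\<And>i. i < n \<Longrightarrow> H i * rung A (2 * i + 2) \<doteq> 0"
    and lo: "\<And>i. i < n \<Longrightarrow> (1 - H i) * (1 - rung A (2 * i)) \<doteq> 0"
  shows "ebound 2 (A - (\<Sum>i<n. 2 *\<^sub>R (1 - H i)))"
proof -
  have sa: "adj A = A" by (rule spec_in_adj[OF A])
  have lt: "1 < 2 * real n" using n by simp
  note ra = adj_rung[OF sa]
  let ?Z = "A - (\<Sum>i<n. 2 *\<^sub>R (1 - H i))"
  have Z: "adj ?Z = ?Z" by (simp add: sa adj_sum isproj_adj[OF H])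
  have pos1: "pos (1 - rung A k)" and pos0: "pos (rung A k)" for k
  proof -
    have "pos (fc A (\<lambda>x. 1 - clamp (x - real k)))"
      by (rule fc_pos'[OF sa]) (auto intro!: continuous_on_diff continuous_rung simp: clamp_simps)
    then show "pos (1 - rung A k)"
      by (simp add: rung_def fc_diff[OF sa continuous_on_const continuous_rung] fc_one[OF sa])
    show "pos (rung A k)" unfolding rung_def
      by (rule fc_pos'[OF sa continuous_rung]) (simp add: clamp_simps)
  qed
  \<comment> \<open>Positive corrections: modulo the ideal, 1 - H i equals
    \<open>rung A (2 * i + 2) + P1 i\<close> and also \<open>rung A (2 * i) - P2 i\<close>.\<close>
  define P1 where "P1 i = (1 - H i) * (1 - rung A (2 * i + 2)) * (1 - H i)" for i
  have P1: "pos (P1 i)" if "i < n" for i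
    unfolding P1_def by (intro pos_conj_sa pos1) (simp add: isproj_adj[OF H[OF that]])
  have c1: "1 - H i \<doteq> rung A (2 * i + 2) + P1 i" if i: "i < n" for i
  proof -
    let ?t = "rung A (2 * i + 2)"
    have e: "(1 - H i) * (1 - H i) = 1 - H i" by (rule isproj_idem[OF isproj_compl[OF H[OF i]]])
    have "?t * H i \<doteq> 0" using cong_adj[OF up[OF i]] by (simp add: ra isproj_adj[OF H[OF i]])
    then have 1: "?t * (1 - H i) \<doteq> ?t" using cong_diff[OF cong_refl, of "?t * H i" 0 ?t] by (simp add: right_diff_distrib)
    have 2: "(1 - H i) * ?t \<doteq> ?t" using cong_diff[OF cong_refl up[OF i], of ?t] by (simp add: left_diff_distrib)
    have "(1 - H i) * ?t * (1 - H i) \<doteq> ?t * (1 - H i)" by (intro cong_mult_right 2)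
    also have "\<dots> \<doteq> ?t" by (rule 1)
    finally have 3: "(1 - H i) * ?t * (1 - H i) \<doteq> ?t" .
    have "a * (1 - t) * a = a * a - a * t * a" for a t :: "'a bop" by (simp add: algebra_simps)
    then have "P1 i = (1 - H i) - (1 - H i) * ?t * (1 - H i)" by (simp only: P1_def e)
    then have "P1 i + (1 - H i) * ?t * (1 - H i) = 1 - H i" by (simp only: diff_add_cancel)
    then have "1 - H i = (1 - H i) * ?t * (1 - H i) + P1 i" by (metis add.commute)
    also have "\<dots> \<doteq> ?t + P1 i" by (intro cong_add 3 cong_refl)
    finally show ?thesis .
  qed
  define P2 where "P2 i = H i * rung A (2 * i) * H i" for i
  have P2: "pos (P2 i)" if "i < n" for i
    unfolding P2_def by (intro pos_conj_sa pos0) (simp add: isproj_adj[OF H[OF that]])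
  have c2: "1 - H i \<doteq> rung A (2 * i) - P2 i" if i: "i < n" for i
  proof -
    let ?t = "rung A (2 * i)"
    have l: "(1 - H i) * ?t \<doteq> 1 - H i"
      using cong_diff[OF cong_refl lo[OF i], of "1 - H i"] by (simp add: right_diff_distrib)
    have r: "?t * (1 - H i) \<doteq> 1 - H i" using cong_adj[OF l] by (simp add: ra isproj_adj[OF H[OF i]])
    have HH: "(1 - H i) * H i = 0" by (simp add: left_diff_distrib isproj_idem[OF H[OF i]])
    have "(1 - H i) * ?t * H i \<doteq> (1 - H i) * H i" by (intro cong_mult_right l)
    then have z: "(1 - H i) * ?t * H i \<doteq> 0" by (simp only: HH)
    have "?t = ?t * (1 - H i) + ((1 - H i) * ?t * H i + P2 i)" by (simp add: P2_def algebra_simps)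
    also have "\<dots> \<doteq> (1 - H i) + (0 + P2 i)" by (intro cong_add r z cong_refl)
    finally have "?t - P2 i \<doteq> (1 - H i) + (0 + P2 i) - P2 i" by (intro cong_diff cong_refl)
    then show ?thesis using cong_sym by simp
  qed
  have rung_sum: "fc A (\<lambda>x. 2 * (\<Sum>i<n. clamp (x - real (g i)))) = (\<Sum>i<n. 2 *\<^sub>R rung A (g i))" for g
    by (subst fc_scaleR[OF sa]) (auto intro!: continuous_on_sum continuous_rung simp: fc_sum[OF sa continuous_rung] rung_def scaleR_sum_right)
  have cs: "continuous_on UNIV (\<lambda>x. 2 * (\<Sum>i<n. clamp (x - real (g i))))" for g
    by (intro continuous_on_mult continuous_on_const continuous_on_sum continuous_rung)
  define Z1 where "Z1 = A - (\<Sum>i<n. 2 *\<^sub>R (rung A (2 * i + 2) + P1 i))"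
  define Z2 where "Z2 = A - (\<Sum>i<n. 2 *\<^sub>R (rung A (2 * i) - P2 i))"
  show ?thesis
  proof (rule ebound_order[OF Z])
    show "?Z \<doteq> Z1" unfolding Z1_def by (intro cong_diff cong_refl cong_sum cong_scaleR c1) auto
    show "?Z \<doteq> Z2" unfolding Z2_def by (intro cong_diff cong_refl cong_sum cong_scaleR c2) auto
    have "pos (fc A (\<lambda>x. 2 - (x - 2 * (\<Sum>i<n. clamp (x - real (2 * i + 2))))))"
      by (rule fc_pos[OF A lt], intro continuous_on_diff continuous_on_const continuous_on_id cs)
         (use staircase_upper[of _ n] in auto)
    also have "fc A (\<lambda>x. 2 - (x - 2 * (\<Sum>i<n. clamp (x - real (2 * i + 2))))) = 2 *\<^sub>R 1 - (A - (\<Sum>i<n. 2 *\<^sub>R rung A (2 * i + 2)))"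
      by (simp only: fc_diff[OF sa] continuous_on_diff continuous_on_const continuous_on_id cs fc_const[OF sa] fc_id[OF sa] rung_sum)
    finally have "pos (2 *\<^sub>R 1 - (A - (\<Sum>i<n. 2 *\<^sub>R rung A (2 * i + 2))) + (\<Sum>i<n. 2 *\<^sub>R P1 i))"
      by (rule pos_add) (intro pos_sum pos_scaleR P1; simp)
    then show "pos (2 *\<^sub>R 1 - Z1)" by (simp add: Z1_def sum.distrib scaleR_right_distrib algebra_simps)
    have "pos (fc A (\<lambda>x. 2 + (x - 2 * (\<Sum>i<n. clamp (x - real (2 * i))))))"
      by (rule fc_pos[OF A lt], intro continuous_on_add continuous_on_diff continuous_on_const continuous_on_id cs)
         (use staircase_lower[of _ n] in \<open>force simp: algebra_simps\<close>)
    also have "fc A (\<lambda>x. 2 + (x - 2 * (\<Sum>i<n. clamp (x - real (2 * i))))) = 2 *\<^sub>R 1 + (A - (\<Sum>i<n. 2 *\<^sub>R rung A (2 * i)))"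
      by (simp only: fc_diff[OF sa] fc_add[OF sa] continuous_on_diff continuous_on_const continuous_on_id cs fc_const[OF sa] fc_id[OF sa] rung_sum)
    finally have "pos (2 *\<^sub>R 1 + (A - (\<Sum>i<n. 2 *\<^sub>R rung A (2 * i))) + (\<Sum>i<n. 2 *\<^sub>R P2 i))"
      by (rule pos_add) (intro pos_sum pos_scaleR P2; simp)
    then show "pos (2 *\<^sub>R 1 + Z2)" by (simp add: Z2_def sum_subtractf scaleR_right_diff_distrib algebra_simps)
  qed simp
qed

text \<open>Split H (1 - H') along 1 = t + (1 - t): H kills the first part and 1 - H' the
  second.\<close>

lemma nested_of_rungs:
  assumes "isproj H'" "adj t = t" "H * t \<doteq> 0" "(1 - H') * (1 - t) \<doteq> 0"
  shows "H * H' \<doteq> H"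
proof -
  have "(1 - t) * (1 - H') \<doteq> 0" using cong_adj[OF assms(4)] assms(2) by (simp add: isproj_adj[OF assms(1)])
  then have 1: "H * ((1 - t) * (1 - H')) \<doteq> 0" using cong_mult_left[of _ 0 H] by simp
  have 2: "H * t * (1 - H') \<doteq> 0" using cong_mult_right[OF assms(3), of "1 - H'"] by simp
  have "H - H * H' = H * ((1 - t) * (1 - H')) + H * t * (1 - H')" by (simp add: algebra_simps)
  also have "\<dots> \<doteq> 0 + 0" by (intro cong_add 1 2)
  finally have "H \<doteq> H * H'" using cong_iff_diff by simp
  then show ?thesis by (rule cong_sym)
qed

subsection \<open>Cutting one operator along a level, almost commuting with the other\<close>

text \<open>The bound 4 is independent of n: P commutes exactly with a flag K whose staircase is
  within 2 of A modulo the ideal, so only the difference contributes to the commutator.\<close>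

lemma level_cut:
  assumes A: "spec_in 1 (2 * real n) A" and n: "n > 0" and B: "adj B = B" and AB: "A * B \<doteq> B * A"
  obtains P where "isproj P" "(1 - P) * (1 - rung B j) \<doteq> 0" "P * rung B (j + 2) \<doteq> 0" "ebound 4 (P * A - A * P)"
proof -
  have sa: "adj A = A" by (rule spec_in_adj[OF A])
  have lt: "1 < 2 * real n" using n by simp
  let ?F = "fc A" and ?G = "fc B"
  have comm: "?F f * ?G g \<doteq> ?G g * ?F f" if "continuous_on UNIV f" "continuous_on UNIV g" for f g
    by (rule cong_commute_fc2[OF sa B that AB])
  have norm_sym: "norm (2 *\<^sub>R rung T k - 1) \<le> 1" if "adj T = T" for T :: "'a bop" and k
  proof -
    have "norm (fc T (\<lambda>x. 2 * clamp (x - real k) - 1)) \<le> 1"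
      by (rule fc_norm[OF adj_spec[OF that] norm_interval])
         (auto intro!: continuous_on_diff continuous_on_mult continuous_rung simp: abs_le_iff clamp_simps)
    moreover have "fc T (\<lambda>x. 2 * clamp (x - real k) - 1) = 2 *\<^sub>R rung T k - 1"
      using fc_diff[OF that continuous_on_mult[OF continuous_on_const continuous_rung] continuous_on_const, of 2 k 1]
      by (simp add: fc_scaleR[OF that continuous_rung] fc_one[OF that] rung_def)
    ultimately show ?thesis by simp
  qed
  \<comment> \<open>Q cuts B inside [j + 1, j + 2] and H cuts A inside [2i + 1, 2i + 2]. The clauses
    with g and f test this on functions that live below or above these gaps.\<close>
  define quad where "quad i Q H \<longleftrightarrow> isproj Q \<and> isproj H \<and> Q * H = H * Q \<and>
      (\<forall>g. continuous_on UNIV g \<longrightarrow> (\<forall>x. clamp (x - real (j + 1)) * g x = 0) \<longrightarrow> Q * ?G g \<doteq> ?G g) \<and>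
      (\<forall>g. continuous_on UNIV g \<longrightarrow> (\<forall>x. clamp (x - real (j + 1)) * g x = g x) \<longrightarrow> Q * ?G g \<doteq> 0) \<and>
      (\<forall>f. continuous_on UNIV f \<longrightarrow> (\<forall>x. clamp (x - real (2 * i + 1)) * f x = 0) \<longrightarrow> H * ?F f \<doteq> ?F f) \<and>
      (\<forall>f. continuous_on UNIV f \<longrightarrow> (\<forall>x. clamp (x - real (2 * i + 1)) * f x = f x) \<longrightarrow> H * ?F f \<doteq> 0)"
    for i Q H
  have "\<exists>Q H. quad i Q H" for i
  proof -
    let ?t = "rung A (2 * i + 1)" and ?z = "rung B (j + 1)"
    \<comment> \<open>Ramps rescaled to take the value -1 below the gap and 1 above it, which are
      two opposite edges of the square.\<close>
    let ?X = "2 *\<^sub>R ?z - 1" and ?Y = "2 *\<^sub>R ?t - 1"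
    have tz: "?t * ?z \<doteq> ?z * ?t" unfolding rung_def by (intro comm continuous_rung)
    have "?X * ?Y - ?Y * ?X = 4 *\<^sub>R (?z * ?t - ?t * ?z)"
      by (simp add: algebra_simps)
    also have "\<dots> \<doteq> 4 *\<^sub>R (?z * ?t - ?z * ?t)" by (intro cong_scaleR cong_diff cong_refl tz)
    finally have XY: "?X * ?Y \<doteq> ?Y * ?X" using cong_iff_diff by simp
    have X: "adj ?X = ?X" and Y: "adj ?Y = ?Y" by (simp_all add: adj_rung[OF B] adj_rung[OF sa])
    obtain Q H where QH: "isproj Q" "isproj H" "Q * H = H * Q"
      and q: "\<And>V. ?Y * V \<doteq> V * ?Y \<Longrightarrow> ?X * V \<doteq> - V \<Longrightarrow> Q * V \<doteq> V" "\<And>V. ?Y * V \<doteq> V * ?Y \<Longrightarrow> ?X * V \<doteq> V \<Longrightarrow> Q * V \<doteq> 0"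
      and h: "\<And>V. ?X * V \<doteq> V * ?X \<Longrightarrow> ?Y * V \<doteq> - V \<Longrightarrow> H * V \<doteq> V" "\<And>V. ?X * V \<doteq> V * ?X \<Longrightarrow> ?Y * V \<doteq> V \<Longrightarrow> H * V \<doteq> 0"
      using quadrant_projections[OF X norm_sym[OF B] Y norm_sym[OF sa] XY] by blast
    have YG: "?Y * ?G g \<doteq> ?G g * ?Y" if "continuous_on UNIV g" for g
    proof -
      have "2 *\<^sub>R (?t * ?G g) - ?G g \<doteq> 2 *\<^sub>R (?G g * ?t) - ?G g"
        unfolding rung_def by (intro cong_diff cong_scaleR cong_refl comm continuous_rung that)
      then show ?thesis by (simp add: algebra_simps)
    qed
    have XF: "?X * ?F f \<doteq> ?F f * ?X" if "continuous_on UNIV f" for f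
    proof -
      have "2 *\<^sub>R (?z * ?F f) - ?F f \<doteq> 2 *\<^sub>R (?F f * ?z) - ?F f"
        unfolding rung_def by (intro cong_diff cong_scaleR cong_refl cong_sym[OF comm] continuous_rung that)
      then show ?thesis by (simp add: algebra_simps)
    qed
    have XG: "?X * ?G g = 2 *\<^sub>R ?G (\<lambda>x. clamp (x - real (j + 1)) * g x) - ?G g" if "continuous_on UNIV g" for g
      using rung_mult_fc[OF B that, of "j + 1"] by (simp add: left_diff_distrib)
    have YF: "?Y * ?F f = 2 *\<^sub>R ?F (\<lambda>x. clamp (x - real (2 * i + 1)) * f x) - ?F f" if "continuous_on UNIV f" for f
      using rung_mult_fc[OF sa that, of "2 * i + 1"] by (simp add: left_diff_distrib)
    have d: "2 *\<^sub>R V - V = V" for V :: "'a bop" by (simp add: scaleR_2)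
    have q1: "Q * ?G g \<doteq> ?G g" if g: "continuous_on UNIV g" and z: "\<forall>x. clamp (x - real (j + 1)) * g x = 0" for g
    proof (rule q(1)[OF YG[OF g]])
      show "?X * ?G g \<doteq> - ?G g" unfolding XG[OF g] z[rule_format] by (simp add: fc_zero[OF B])
    qed
    have q0: "Q * ?G g \<doteq> 0" if g: "continuous_on UNIV g" and z: "\<forall>x. clamp (x - real (j + 1)) * g x = g x" for g
    proof (rule q(2)[OF YG[OF g]])
      show "?X * ?G g \<doteq> ?G g" unfolding XG[OF g] z[rule_format] by (simp add: d)
    qed
    have h1: "H * ?F f \<doteq> ?F f" if f: "continuous_on UNIV f" and z: "\<forall>x. clamp (x - real (2 * i + 1)) * f x = 0" for f
    proof (rule h(1)[OF XF[OF f]])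
      show "?Y * ?F f \<doteq> - ?F f" unfolding YF[OF f] z[rule_format] by (simp add: fc_zero[OF sa])
    qed
    have h0: "H * ?F f \<doteq> 0" if f: "continuous_on UNIV f" and z: "\<forall>x. clamp (x - real (2 * i + 1)) * f x = f x" for f
    proof (rule h(2)[OF XF[OF f]])
      show "?Y * ?F f \<doteq> ?F f" unfolding YF[OF f] z[rule_format] by (simp add: d)
    qed
    have "quad i Q H" unfolding quad_def using QH q1 q0 h1 h0 by (intro conjI allI impI) blast+
    then show ?thesis by blast
  qed
  then obtain Q H where "\<And>i. quad i (Q i) (H i)" by metis
  note quad = this[unfolded quad_def]
  have Q: "isproj (Q i)" and H: "isproj (H i)" and QH: "Q i * H i = H i * Q i" for i
    using quad[of i] by blast+
  have Q1: "continuous_on UNIV g \<Longrightarrow> (\<And>x. clamp (x - real (j + 1)) * g x = 0) \<Longrightarrow> Q i * ?G g \<doteq> ?G g"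
    and Q0: "continuous_on UNIV g \<Longrightarrow> (\<And>x. clamp (x - real (j + 1)) * g x = g x) \<Longrightarrow> Q i * ?G g \<doteq> 0"
    and H1: "continuous_on UNIV f \<Longrightarrow> (\<And>x. clamp (x - real (2 * i + 1)) * f x = 0) \<Longrightarrow> H i * ?F f \<doteq> ?F f"
    and H0: "continuous_on UNIV f \<Longrightarrow> (\<And>x. clamp (x - real (2 * i + 1)) * f x = f x) \<Longrightarrow> H i * ?F f \<doteq> 0" for i f g
    using quad[of i] by blast+
  have compl: "fc T (\<lambda>x. 1 - clamp (x - real k)) = 1 - rung T k" if "adj T = T" for T :: "'a bop" and k
    using fc_diff[OF that continuous_on_const continuous_rung, of 1 k] by (simp add: rung_def fc_one[OF that])
  have ccompl: "continuous_on UNIV (\<lambda>x. 1 - clamp (x - real k))" for k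
    by (intro continuous_on_diff continuous_on_const continuous_rung)
  have Hlo: "(1 - H i) * (1 - rung A k) \<doteq> 0" if "k \<le> 2 * i" for i k
  proof -
    have "H i * ?F (\<lambda>x. 1 - clamp (x - real k)) \<doteq> ?F (\<lambda>x. 1 - clamp (x - real k))"
      using that rung_below[of k "2 * i + 1"] by (intro H1 ccompl) (simp add: right_diff_distrib)
    then show ?thesis unfolding compl[OF sa] left_diff_distrib[of 1 "H i"] using cong_iff_diff cong_sym by simp
  qed
  have Hup: "H i * rung A k \<doteq> 0" if "k \<ge> 2 * i + 2" for i k
    unfolding rung_def using that rung_below[of "2 * i + 1" k]
    by (intro H0 continuous_rung) (simp add: mult.commute)
  have HH: "H i * H (Suc i) \<doteq> H i" for i
    by (rule nested_of_rungs[OF H adj_rung[OF sa] Hup[of i "2 * i + 2"] Hlo]) auto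
  obtain K where K: "\<And>i. i < n \<Longrightarrow> isproj (K i)" "\<And>i. i < n \<Longrightarrow> K i \<doteq> H i" "\<And>i k. i \<le> k \<Longrightarrow> k < n \<Longrightarrow> K i * K k = K i"
    using lift_nested[of n H] H HH by blast
  \<comment> \<open>Square root of a bump supported on [2i, 2i + 3]; the squares add up to 1 on
    [1, 2n]. Among the gaps of the cuts H k only that of H i meets the interior of this
    support.\<close>
  define ph where "ph i x = sqrt (clamp (x - real (2 * i)) - clamp (x - real (2 * i + 2)))" for i :: nat and x
  have cph: "continuous_on UNIV (ph i)" for i
    unfolding ph_def by (intro continuous_on_real_sqrt continuous_on_diff continuous_rung)
  have ph_sq: "ph i x * ph i x = clamp (x - real (2 * i)) - clamp (x - real (2 * i + 2))" for i x
  proof -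
    have "clamp (x - real (2 * i + 2)) \<le> clamp (x - real (2 * i))" by (rule clamp_mono) simp
    then show ?thesis unfolding ph_def by (intro real_sqrt_mult_self[THEN trans]) simp
  qed
  let ?p = "\<lambda>i. ?F (ph i)"
  have pa: "adj (?p i) = ?p i" for i by (rule fc_adj[OF sa cph])
  have p_below: "H k * ?p i \<doteq> ?p i" if "i < k" for i k
  proof (rule H1[OF cph])
    fix x
    show "clamp (x - real (2 * k + 1)) * ph i x = 0"
    proof (cases "x \<le> real (2 * k + 1)")
      case False
      then have "clamp (x - real (2 * i)) = 1" "clamp (x - real (2 * i + 2)) = 1" using that by (auto intro!: clamp_simps)
      then show ?thesis by (simp add: ph_def)
    qed (simp add: clamp_simps)
  qed
  have p_above: "H k * ?p i \<doteq> 0" if "k < i" for i k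
  proof (rule H0[OF cph])
    fix x
    show "clamp (x - real (2 * k + 1)) * ph i x = ph i x"
    proof (cases "x \<le> real (2 * i)")
      case True
      then have "clamp (x - real (2 * i)) = 0" "clamp (x - real (2 * i + 2)) = 0" by (auto intro!: clamp_simps)
      then show ?thesis by (simp add: ph_def)
    next
      case False
      then have "clamp (x - real (2 * k + 1)) = 1" using that by (intro clamp_simps) simp
      then show ?thesis by simp
    qed
  qed
  have p_mid: "H i * ?p i \<doteq> ?p i * H i" for i
  proof -
    \<comment> \<open>\<open>ph i\<close> differs from 1 by u, which lives below the gap of H i, and
      v, which lives above it; H i acts trivially on both.\<close>
    define u where "u x = 1 - sqrt (clamp (x - real (2 * i)))" for x
    define v where "v x = 1 - sqrt (1 - clamp (x - real (2 * i + 2)))" for x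
    have cu: "continuous_on UNIV u" and cv: "continuous_on UNIV v"
      unfolding u_def v_def by (intro continuous_on_diff continuous_on_const continuous_on_real_sqrt continuous_rung)+
    have "ph i = (\<lambda>x. 1 - u x - v x)"
    proof
      fix x
      show "ph i x = 1 - u x - v x"
      proof (cases "x \<le> real (2 * i + 2)")
        case True
        then have "clamp (x - real (2 * i + 2)) = 0" by (intro clamp_simps) simp
        then show ?thesis by (simp add: ph_def u_def v_def)
      next
        case False
        then have "clamp (x - real (2 * i)) = 1" by (intro clamp_simps) simp
        then show ?thesis by (simp add: ph_def u_def v_def)
      qed
    qed
    then have p: "?p i = 1 - ?F u - ?F v"
      using fc_diff[OF sa continuous_on_diff[OF continuous_on_const cu] cv, of 1] fc_diff[OF sa continuous_on_const cu, of 1]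
      by (simp add: fc_one[OF sa])
    have u1: "H i * ?F u \<doteq> ?F u"
    proof (rule H1[OF cu])
      fix x
      show "clamp (x - real (2 * i + 1)) * u x = 0"
      proof (cases "x \<le> real (2 * i + 1)")
        case False
        then have "clamp (x - real (2 * i)) = 1" by (intro clamp_simps) simp
        then show ?thesis by (simp add: u_def)
      qed (simp add: clamp_simps)
    qed
    have v0: "H i * ?F v \<doteq> 0"
    proof (rule H0[OF cv])
      fix x
      show "clamp (x - real (2 * i + 1)) * v x = v x"
      proof (cases "x \<le> real (2 * i + 2)")
        case True
        then have "clamp (x - real (2 * i + 2)) = 0" by (intro clamp_simps) simp
        then show ?thesis by (simp add: v_def)
      next
        case False
        then have "clamp (x - real (2 * i + 1)) = 1" by (intro clamp_simps) simp
        then show ?thesis by simp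
      qed
    qed
    have "H i * ?p i = H i - H i * ?F u - H i * ?F v" by (simp add: p right_diff_distrib)
    also have "\<dots> \<doteq> H i - ?F u - 0" by (intro cong_diff cong_refl u1 v0)
    finally have 1: "H i * ?p i \<doteq> H i - ?F u" by simp
    have "?p i * H i \<doteq> H i - ?F u"
      using cong_adj[OF 1] by (simp add: pa isproj_adj[OF H] fc_adj[OF sa cu])
    with 1 show ?thesis using cong_sym cong_trans by blast
  qed
  \<comment> \<open>Glues the cuts Q i of B along the ladder of A. On bump i every H k with k
    different from i is 0 or 1, and H i commutes exactly with Q i, so y commutes with all H k modulo
    the ideal.\<close>
  define y where "y = (\<Sum>i<n. ?p i * Q i * ?p i)"
  have ya: "adj y = y" by (simp add: y_def adj_sum pa isproj_adj[OF Q] mult.assoc)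
  have yH: "H k * y \<doteq> y * H k" for k
    unfolding y_def sum_distrib_left sum_distrib_right
  proof (rule cong_sum)
    fix i
    have r: "?p i * H k \<doteq> Y" if "H k * ?p i \<doteq> Y" "adj Y = Y" for Y
      using cong_adj[OF that(1)] that(2) by (simp add: pa isproj_adj[OF H])
    consider "i < k" | "i = k" | "k < i" by linarith
    then show "H k * (?p i * Q i * ?p i) \<doteq> ?p i * Q i * ?p i * H k"
    proof cases
      case 1
      have "H k * (?p i * Q i * ?p i) = H k * ?p i * (Q i * ?p i)" by (simp add: mult.assoc)
      also have "\<dots> \<doteq> ?p i * (Q i * ?p i)" by (intro cong_mult_right p_below 1)
      also have "\<dots> = ?p i * Q i * ?p i" by (simp add: mult.assoc)
      also have "\<dots> \<doteq> ?p i * Q i * (?p i * H k)" by (intro cong_mult_left cong_sym[OF r] p_below 1 pa)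
      finally show ?thesis by (simp add: mult.assoc)
    next
      case 2
      have "H k * (?p i * Q i * ?p i) = H i * ?p i * (Q i * ?p i)" by (simp add: mult.assoc 2)
      also have "\<dots> \<doteq> ?p i * H i * (Q i * ?p i)" by (intro cong_mult_right p_mid)
      also have "\<dots> = ?p i * (H i * Q i) * ?p i" by (simp only: mult.assoc)
      also have "\<dots> = ?p i * Q i * (H i * ?p i)" by (simp only: QH[symmetric] mult.assoc)
      also have "\<dots> \<doteq> ?p i * Q i * (?p i * H i)" by (intro cong_mult_left p_mid)
      finally show ?thesis by (simp add: mult.assoc 2)
    next
      case 3
      have "H k * (?p i * Q i * ?p i) = H k * ?p i * (Q i * ?p i)" by (simp add: mult.assoc)
      also have "\<dots> \<doteq> 0 * (Q i * ?p i)" by (intro cong_mult_right p_above 3)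
      also have "\<dots> = ?p i * Q i * 0" by simp
      also have "\<dots> \<doteq> ?p i * Q i * (?p i * H k)" by (intro cong_mult_left cong_sym[OF r] p_above 3) simp
      finally show ?thesis by (simp add: mult.assoc)
    qed
  qed
  have part: "(\<Sum>i<n. ?p i * ?p i) = 1"
  proof -
    have "(\<Sum>i<n. ?p i * ?p i) = (\<Sum>i<n. ?F (\<lambda>x. ph i x * ph i x))" by (simp add: fc_mult[OF sa cph cph])
    also have "\<dots> = ?F (\<lambda>x. \<Sum>i<n. ph i x * ph i x)"
      by (rule fc_sum[OF sa, symmetric]) (intro continuous_on_mult cph)
    also have "\<dots> = ?F (\<lambda>x. 1)"
    proof (rule fc_cong[OF A lt])
      show "continuous_on UNIV (\<lambda>x. \<Sum>i<n. ph i x * ph i x)" by (intro continuous_on_sum continuous_on_mult cph)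
      fix x assume x: "x \<in> {1..2 * real n}"
      have "(\<Sum>i<n. ph i x * ph i x) = (\<Sum>i<n. clamp (x - real (2 * i)) - clamp (x - real (2 * Suc i)))"
        by (simp add: ph_sq)
      also have "\<dots> = clamp (x - real (2 * 0)) - clamp (x - real (2 * n))" by (rule sum_lessThan_telescope')
      also have "\<dots> = 1" using x by (simp add: clamp_simps)
      finally show "(\<Sum>i<n. ph i x * ph i x) = 1" .
    qed (rule continuous_on_const)
    finally show ?thesis by (simp add: fc_one[OF sa])
  qed
  have pQp: "y * ?G g \<doteq> s *\<^sub>R ?G g" if g: "continuous_on UNIV g" and Qg: "\<And>i. Q i * ?G g \<doteq> s *\<^sub>R ?G g" for g s
  proof -
    have "?p i * Q i * ?p i * ?G g \<doteq> s *\<^sub>R (?p i * ?p i * ?G g)" for i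
    proof -
      have "?p i * Q i * ?p i * ?G g = ?p i * Q i * (?p i * ?G g)" by (simp add: mult.assoc)
      also have "\<dots> \<doteq> ?p i * Q i * (?G g * ?p i)" by (intro cong_mult_left comm cph g)
      also have "\<dots> = ?p i * (Q i * ?G g) * ?p i" by (simp add: mult.assoc)
      also have "\<dots> \<doteq> ?p i * (s *\<^sub>R ?G g) * ?p i" by (intro cong_mult_left cong_mult_right Qg)
      also have "\<dots> = s *\<^sub>R (?p i * (?G g * ?p i))" by (simp add: mult.assoc)
      also have "\<dots> \<doteq> s *\<^sub>R (?p i * (?p i * ?G g))" by (intro cong_scaleR cong_mult_left cong_sym[OF comm] cph g)
      finally show ?thesis by (simp add: mult.assoc)
    qed
    then have "y * ?G g \<doteq> (\<Sum>i<n. s *\<^sub>R (?p i * ?p i * ?G g))"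
      unfolding y_def sum_distrib_right by (intro cong_sum)
    also have "\<dots> = s *\<^sub>R ((\<Sum>i<n. ?p i * ?p i) * ?G g)" by (simp add: sum_distrib_right scaleR_sum_right)
    finally show ?thesis by (simp add: part)
  qed
  let ?Fl = "flag_step n K"
  have Fl: "partition n ?Fl" by (rule partition_flag_step[OF K(1,3)])
  have Ky: "K i * y \<doteq> y * K i" if "i < n" for i
  proof -
    have "K i * y \<doteq> H i * y" by (intro cong_mult_right K(2) that)
    also have "\<dots> \<doteq> y * H i" by (rule yH)
    also have "\<dots> \<doteq> y * K i" by (intro cong_mult_left cong_sym[OF K(2)] that)
    finally show ?thesis .
  qed
  \<comment> \<open>Pinching along the exact flag K alters y only by a negligible operator and makes
    it commute exactly with K.\<close>
  define y' where "y' = pinch n ?Fl y"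
  have y': "y' \<doteq> y" unfolding y'_def by (intro pinch_cong Fl flag_step_cong Ky)
  have y'a: "adj y' = y'" unfolding y'_def by (rule adj_pinch[OF Fl ya])
  \<comment> \<open>\<open>neg X\<close> is the spectral projection of y' for values at least 1/2.
    Modulo the ideal y' acts as 1 on the part of B below the gap and as 0 on the part above, so 1/2
    separates the two.\<close>
  define X where "X = (1/2) *\<^sub>R 1 - y'"
  have Xa: "adj X = X" by (simp add: X_def y'a)
  have Xg: "X * ?G g \<doteq> (1/2 - s) *\<^sub>R ?G g" if g: "continuous_on UNIV g" and Qg: "\<And>i. Q i * ?G g \<doteq> s *\<^sub>R ?G g" for g s
  proof -
    have "X * ?G g = (1/2) *\<^sub>R ?G g - y' * ?G g" by (simp add: X_def left_diff_distrib)
    also have "\<dots> \<doteq> (1/2) *\<^sub>R ?G g - y * ?G g" by (intro cong_diff cong_refl cong_mult_right y')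
    also have "\<dots> \<doteq> (1/2) *\<^sub>R ?G g - s *\<^sub>R ?G g" by (intro cong_diff cong_refl pQp[OF g Qg])
    finally show ?thesis by (simp add: scaleR_left_diff_distrib)
  qed
  define P where "P = neg X"
  have P: "isproj P" by (simp add: P_def)
  have FlX: "?Fl l * X = X * ?Fl l" if "l \<le> n" for l
    using pinch_commute[OF Fl that, of y] by (simp add: X_def y'_def algebra_simps)
  have PK: "K i * P = P * K i" if "i < n" for i
  proof -
    have "P * ?Fl l = ?Fl l * P" if "l \<le> n" for l
      unfolding P_def by (rule neg_commute[OF Xa FlX[OF that, symmetric]])
    then show ?thesis by (rule flag_commute[OF sym that])
  qed
  have Plo: "(1 - P) * (1 - rung B j) \<doteq> 0"
  proof -
    let ?g = "\<lambda>x. 1 - clamp (x - real j)"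
    have "Q i * ?G ?g \<doteq> 1 *\<^sub>R ?G ?g" for i
      using rung_below[of j "j + 1"] by (simp, intro Q1 ccompl) (simp add: right_diff_distrib)
    then have "X * ?G ?g \<doteq> (1/2 - 1) *\<^sub>R ?G ?g" by (rule Xg[OF ccompl])
    then have "P * ?G ?g \<doteq> ?G ?g" unfolding P_def by (intro sign_neg_scalar[OF Xa, of "-1/2"]) auto
    then show ?thesis unfolding compl[OF B] left_diff_distrib[of 1 P] using cong_iff_diff cong_sym by simp
  qed
  have Pup: "P * rung B (j + 2) \<doteq> 0"
  proof -
    let ?g = "\<lambda>x. clamp (x - real (j + 2))"
    have "Q i * ?G ?g \<doteq> 0 *\<^sub>R ?G ?g" for i
      using rung_below[of "j + 1" "j + 2"] by (simp, intro Q0) (use continuous_rung[of "j + 2"] in \<open>simp_all add: mult.commute\<close>)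
    then have "X * ?G ?g \<doteq> (1/2 - 0) *\<^sub>R ?G ?g" by (rule Xg[OF continuous_rung])
    then show ?thesis unfolding P_def rung_def by (intro sign_pos_scalar[OF Xa, of "1/2"]) auto
  qed
  \<comment> \<open>The staircase over the flag K: it commutes with P and is within 2 of A modulo
    the ideal, so the commutator of P with A is at most 2 times 2.\<close>
  define A'' where "A'' = (\<Sum>i<n. 2 *\<^sub>R (1 - K i))"
  have "ebound 2 (A - A'')" unfolding A''_def
  proof (rule staircase_ebound[OF A n K(1)])
    show "K i * rung A (2 * i + 2) \<doteq> 0" if "i < n" for i
      by (rule cong_trans[OF cong_mult_right[OF K(2)[OF that]] Hup]) simp
    show "(1 - K i) * (1 - rung A (2 * i)) \<doteq> 0" if "i < n" for i
      by (rule cong_trans[OF cong_mult_right[OF cong_diff[OF cong_refl K(2)[OF that]]] Hlo]) simp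
  qed
  moreover have "P * A'' = A'' * P"
    unfolding A''_def sum_distrib_left sum_distrib_right
    by (intro sum.cong) (auto simp: algebra_simps PK)
  moreover have "P * A - A * P = P * (A - A'') - (A - A'') * P"
    using \<open>P * A'' = A'' * P\<close> by (simp add: algebra_simps)
  ultimately have "ebound 4 (P * A - A * P)" using ebound_commutator[of 2 "A - A''" P] isproj_norm[OF P] by simp
  then show thesis using that P Plo Pup by blast
qed

end

section \<open>Approximation by normal operators\<close>

definition normal_op :: "'a::complex_hilbert bop \<Rightarrow> bool" where
  "normal_op T \<longleftrightarrow> adj T * T = T * adj T"

text \<open>Measures A in units of eta and shifts it into the range [1, 2n] that the ladder
  covers.\<close>

lemma rescale_spec_in:
  assumes A: "adj A = A" and "\<eta> > 0"
  obtains n \<beta> where "n > 0" "spec_in 1 (2 * real n) ((1 / \<eta>) *\<^sub>R A + \<beta> *\<^sub>R 1)"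
proof -
  define c where "c = norm A / \<eta>"
  have c: "c \<ge> 0" using assms(2) by (simp add: c_def)
  obtain k :: nat where k: "1 + 2 * c \<le> real k" using real_arch_simple by blast
  have sp: "spec_in (- c) c ((1 / \<eta>) *\<^sub>R A)"
    using assms by (intro spec_in_norm) (auto simp: c_def)
  have "pos ((2 * real (Suc k) - 1 - 2 * c) *\<^sub>R 1 + (c *\<^sub>R 1 - (1 / \<eta>) *\<^sub>R A))"
    using sp k by (intro pos_add pos_scaleR pos_1) (auto simp: spec_in_def)
  also have "(2 * real (Suc k) - 1 - 2 * c) *\<^sub>R 1 + (c *\<^sub>R 1 - (1 / \<eta>) *\<^sub>R A) = (2 * real (Suc k)) *\<^sub>R 1 - ((1 / \<eta>) *\<^sub>R A + (1 + c) *\<^sub>R 1)"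
  proof -
    have "2 * real (Suc k) - 1 - 2 * c = 2 * real (Suc k) - (1 + c) - c" by simp
    then show ?thesis by (simp only: scaleR_left_diff_distrib) (simp add: algebra_simps)
  qed
  finally have 1: "pos ((2 * real (Suc k)) *\<^sub>R 1 - ((1 / \<eta>) *\<^sub>R A + (1 + c) *\<^sub>R 1))" .
  have "pos ((1 / \<eta>) *\<^sub>R A - (- c) *\<^sub>R 1)" using sp by (simp add: spec_in_def)
  also have "(1 / \<eta>) *\<^sub>R A - (- c) *\<^sub>R 1 = ((1 / \<eta>) *\<^sub>R A + (1 + c) *\<^sub>R 1) - 1 *\<^sub>R 1"
    by (simp add: algebra_simps)
  finally have "spec_in 1 (2 * real (Suc k)) ((1 / \<eta>) *\<^sub>R A + (1 + c) *\<^sub>R 1)"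
    using 1 unfolding spec_in_def by blast
  then show thesis using that[of "Suc k"] by blast
qed

lemma partition_mult:
  assumes F: "partition n F" and M: "\<And>l k. l \<le> n \<Longrightarrow> k \<le> n \<Longrightarrow> F k * L l = L l * F k"
  shows "(\<Sum>l\<le>n. M l * F l) * (\<Sum>l\<le>n. L l * F l) = (\<Sum>l\<le>n. M l * L l * F l)"
proof -
  have "M l * F l * (L k * F k) = (if k = l then M l * L l * F l else 0)" if "l \<le> n" "k \<le> n" for l k
  proof -
    have "M l * F l * (L k * F k) = M l * (F l * L k) * F k" by (simp add: mult.assoc)
    also have "\<dots> = M l * L k * (F l * F k)" using M[OF that(2,1)] by (simp add: mult.assoc)
    finally show ?thesis using F that by (auto simp: partition_def isproj_idem)
  qed
  then have "M l * F l * (\<Sum>k\<le>n. L k * F k) = M l * L l * F l" if "l \<le> n" for l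
    using that by (simp add: sum_distrib_left)
  then show ?thesis by (simp add: sum_distrib_right)
qed

lemma normal_op_partition:
  assumes F: "partition n F" and M: "\<And>l k. l \<le> n \<Longrightarrow> k \<le> n \<Longrightarrow> F k * M l = M l * F k"
    and N: "\<And>l. l \<le> n \<Longrightarrow> normal_op (M l)"
  shows "normal_op (\<Sum>l\<le>n. M l * F l)"
proof -
  have Fa: "adj (F k) = F k" if "k \<le> n" for k using F that by (auto simp: partition_def isproj_adj)
  have M': "F k * adj (M l) = adj (M l) * F k" if "l \<le> n" "k \<le> n" for l k
    using arg_cong[OF M[OF that], of adj] Fa[OF that(2)] by simp
  have a: "adj (\<Sum>l\<le>n. M l * F l) = (\<Sum>l\<le>n. adj (M l) * F l)"
    unfolding adj_sum by (intro sum.cong) (auto simp: Fa M')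
  show ?thesis unfolding normal_op_def a
    using N by (subst partition_mult[OF F M], simp, simp, subst partition_mult[OF F M'], simp, simp)
      (auto intro!: sum.cong simp: normal_op_def)
qed

context uncountable_cardinal
begin

lemma normal_approximation:
  assumes T: "adj T * T \<doteq> T * adj T" and g: "\<gamma> > 0"
  obtains N where "normal_op N" "ebound \<gamma> (T - N)"
proof -
  have iZ: "Z * (ii * W) = ii * (Z * W)" for Z W :: "'a bop" by (metis ii_commute mult.assoc)
  have ii2: "ii * (ii * W) = - W" for W :: "'a bop" by (simp add: ii_ii flip: mult.assoc)
  define A0 where "A0 = (1/2) *\<^sub>R (T + adj T)"
  define B0 where "B0 = (1/2) *\<^sub>R (ii * (adj T - T))"
  have A0: "adj A0 = A0" by (simp add: A0_def add.commute)
  have B0: "adj B0 = B0" by (simp add: B0_def algebra_simps ii_commute[of T] ii_commute[of "adj T"])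
  have T_eq: "T = A0 + ii * B0"
  proof -
    have "A0 + ii * B0 = (1/2) *\<^sub>R T + (1/2) *\<^sub>R T"
      by (simp add: A0_def B0_def algebra_simps ii2)
    then show ?thesis by (simp flip: scaleR_left_distrib)
  qed
  have AB0: "A0 * B0 \<doteq> B0 * A0"
  proof -
    have "A0 * B0 - B0 * A0 = (1/2) *\<^sub>R (ii * (T * adj T - adj T * T))"
    proof -
      have "A0 * B0 - B0 * A0 = (1/4) *\<^sub>R (ii * (T * adj T - adj T * T)) + (1/4) *\<^sub>R (ii * (T * adj T - adj T * T))"
        by (simp add: A0_def B0_def algebra_simps iZ[of T] iZ[of "adj T"] mult.assoc)
      then show ?thesis by (simp flip: scaleR_left_distrib)
    qed
    also have "\<dots> \<doteq> (1/2) *\<^sub>R (ii * (T * adj T - T * adj T))"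
      by (intro cong_scaleR cong_mult_left cong_diff cong_refl T)
    finally show ?thesis using cong_iff_diff by simp
  qed
  \<comment> \<open>Replacing B by its staircase costs 2 units of delta, that is half of
    gamma.\<close>
  define \<delta> where "\<delta> = \<gamma> / 4"
  have \<delta>: "\<delta> > 0" using g by (simp add: \<delta>_def)
  obtain N \<beta> where N: "N > 0" "spec_in 1 (2 * real N) ((1 / \<delta>) *\<^sub>R B0 + \<beta> *\<^sub>R 1)"
    by (rule rescale_spec_in[OF B0 \<delta>])
  \<comment> \<open>Chosen after N. A flag step is a difference of two cuts and has commutator at
    most 8 eta with A0; the N + 1 steps together give half of gamma.\<close>
  define \<eta> where "\<eta> = \<gamma> / (16 * real (Suc N))"
  have \<eta>: "\<eta> > 0" using g by (simp add: \<eta>_def)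
  obtain n \<alpha> where n: "n > 0" "spec_in 1 (2 * real n) ((1 / \<eta>) *\<^sub>R A0 + \<alpha> *\<^sub>R 1)"
    by (rule rescale_spec_in[OF A0 \<eta>])
  define A where "A = (1 / \<eta>) *\<^sub>R A0 + \<alpha> *\<^sub>R 1"
  define B where "B = (1 / \<delta>) *\<^sub>R B0 + \<beta> *\<^sub>R 1"
  have A: "spec_in 1 (2 * real n) A" and B: "spec_in 1 (2 * real N) B" using n N by (simp_all add: A_def B_def)
  have Ba: "adj B = B" by (rule spec_in_adj[OF B])
  have AB: "A * B \<doteq> B * A"
  proof -
    have "A * B - B * A = (1 / \<eta> * (1 / \<delta>)) *\<^sub>R (A0 * B0 - B0 * A0)"
      by (simp add: A_def B_def algebra_simps)
    also have "\<dots> \<doteq> (1 / \<eta> * (1 / \<delta>)) *\<^sub>R (A0 * B0 - A0 * B0)"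
      by (intro cong_scaleR cong_diff cong_refl cong_sym[OF AB0])
    finally show ?thesis using cong_iff_diff by simp
  qed
  \<comment> \<open>Even levels fit the steps of \<open>staircase_ebound\<close>; consecutive cuts
    are nested modulo the ideal through the rung that they share.\<close>
  define cut where "cut i P \<longleftrightarrow> isproj P \<and> (1 - P) * (1 - rung B (2 * i)) \<doteq> 0 \<and> P * rung B (2 * i + 2) \<doteq> 0 \<and> ebound 4 (P * A - A * P)" for i P
  have "\<exists>P. cut i P" for i
    using level_cut[OF A n(1) Ba AB, of "2 * i"] unfolding cut_def by metis
  then obtain P where "\<And>i. cut i (P i)" by metis
  note cut = this[unfolded cut_def]
  have P: "isproj (P i)" "(1 - P i) * (1 - rung B (2 * i)) \<doteq> 0" "P i * rung B (2 * i + 2) \<doteq> 0" "ebound 4 (P i * A - A * P i)" for i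
    using cut[of i] by blast+
  have PP: "P i * P (Suc i) \<doteq> P i" for i
    by (rule nested_of_rungs[OF P(1) adj_rung[OF Ba] P(3)]) (use P(2)[of "Suc i"] in simp)
  obtain K where K: "\<And>i. i < N \<Longrightarrow> isproj (K i)" "\<And>i. i < N \<Longrightarrow> K i \<doteq> P i" "\<And>i k. i \<le> k \<Longrightarrow> k < N \<Longrightarrow> K i * K k = K i"
    using lift_nested[of N P] P(1) PP by blast
  define B1 where "B1 = (\<Sum>i<N. 2 *\<^sub>R (1 - K i))"
  have eB: "ebound 2 (B - B1)" unfolding B1_def
  proof (rule staircase_ebound[OF B N(1) K(1)])
    show "K i * rung B (2 * i + 2) \<doteq> 0" if "i < N" for i
      by (rule cong_trans[OF cong_mult_right[OF K(2)[OF that]] P(3)])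
    show "(1 - K i) * (1 - rung B (2 * i)) \<doteq> 0" if "i < N" for i
      by (rule cong_trans[OF cong_mult_right[OF cong_diff[OF cong_refl K(2)[OF that]]] P(2)])
  qed
  let ?F = "flag_step N K"
  have F: "partition N ?F" by (rule partition_flag_step[OF K(1,3)])
  have eK: "ebound (4 * \<eta>) (A0 * K i - K i * A0)" if i: "i < N" for i
  proof -
    have "P i * A - A * P i \<doteq> K i * A - A * K i"
      by (intro cong_diff cong_mult_left cong_mult_right cong_sym[OF K(2)[OF i]])
    then have "ebound 4 (K i * A - A * K i)" using P(4) by (rule ebound_cong)
    then have "ebound (norm ((- \<eta>) *\<^sub>R 1 :: 'a bop) * 4) (((- \<eta>) *\<^sub>R 1) * (K i * A - A * K i))" by (rule ebound_mult_left)
    moreover have "norm ((- \<eta>) *\<^sub>R 1 :: 'a bop) * 4 \<le> 4 * \<eta>" using \<eta> norm_1_le[where 'a='a] by simp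
    moreover have "((- \<eta>) *\<^sub>R 1) * (K i * A - A * K i) = A0 * K i - K i * A0"
      using \<eta> by (simp add: A_def algebra_simps)
    ultimately show ?thesis using ebound_mono by metis
  qed
  have eF: "ebound (8 * \<eta>) (A0 * ?F l - ?F l * A0)" if l: "l \<le> N" for l
  proof -
    let ?a = "if l < N then K l else 1" and ?b = "if l = 0 then 0 else K (l - 1)"
    have "ebound (4 * \<eta>) (A0 * ?a - ?a * A0)" using eK[of l] \<eta> by (auto intro: ebound_norm)
    moreover have "ebound (4 * \<eta>) (?b * A0 - A0 * ?b)"
    proof (cases "l = 0")
      case False
      then have "ebound (norm (- 1 :: 'a bop) * (4 * \<eta>)) ((- 1) * (A0 * K (l - 1) - K (l - 1) * A0))"
        using l by (intro ebound_mult_left eK) auto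
      then have "ebound (norm (1 :: 'a bop) * (4 * \<eta>)) (K (l - 1) * A0 - A0 * K (l - 1))" by simp
      moreover have "norm (1 :: 'a bop) * (4 * \<eta>) \<le> 1 * (4 * \<eta>)" using \<eta> norm_1_le by (intro mult_right_mono) auto
      ultimately show ?thesis using False ebound_mono by auto
    qed (use \<eta> in \<open>auto intro: ebound_norm\<close>)
    ultimately have "ebound (4 * \<eta> + 4 * \<eta>) ((A0 * ?a - ?a * A0) + (?b * A0 - A0 * ?b))" by (rule ebound_add)
    moreover have "(A0 * ?a - ?a * A0) + (?b * A0 - A0 * ?b) = A0 * ?F l - ?F l * A0"
      unfolding flag_step_def by (simp only: algebra_simps)
    ultimately show ?thesis by simp
  qed
  define A1 where "A1 = pinch N ?F A0"
  have eA: "ebound (\<gamma> / 2) (A0 - A1)"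
  proof -
    have "ebound (8 * \<eta>) ((A0 * ?F l - ?F l * A0) * ?F l)" if "l \<le> N" for l
    proof -
      have "isproj (?F l)" using F that by (simp add: partition_def)
      then have "(8 * \<eta>) * norm (?F l) \<le> (8 * \<eta>) * 1" using \<eta> by (intro mult_left_mono isproj_norm) auto
      moreover have "ebound ((8 * \<eta>) * norm (?F l)) ((A0 * ?F l - ?F l * A0) * ?F l)"
        using \<eta> by (intro ebound_mult_right eF that) auto
      ultimately show ?thesis using ebound_mono by simp
    qed
    then have "ebound (\<Sum>l\<le>N. 8 * \<eta>) (\<Sum>l\<le>N. (A0 * ?F l - ?F l * A0) * ?F l)" by (intro ebound_sum) auto
    moreover have "(\<Sum>l\<le>N. 8 * \<eta>) = \<gamma> / 2" by (simp add: \<eta>_def field_simps)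
    ultimately show ?thesis unfolding A1_def pinch_diff[OF F] by (simp only:)
  qed
  have A1: "adj A1 = A1" unfolding A1_def by (rule adj_pinch[OF F A0])
  have B1: "adj B1 = B1" by (simp add: B1_def adj_sum isproj_adj[OF K(1)])
  have KA1: "K i * A1 = A1 * K i" if "i < N" for i
  proof (rule flag_commute[OF _ that])
    show "?F l * A1 = A1 * ?F l" if "l \<le> N" for l unfolding A1_def by (rule pinch_commute[OF F that])
  qed
  have AB1: "A1 * B1 = B1 * A1"
    unfolding B1_def sum_distrib_left sum_distrib_right
    by (intro sum.cong) (auto simp: algebra_simps KA1)
  define C where "C = \<delta> *\<^sub>R (B1 - \<beta> *\<^sub>R 1)"
  have C: "adj C = C" by (simp add: C_def B1)
  have AC: "A1 * C = C * A1" by (simp add: C_def algebra_simps AB1)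
  have AC': "A1 * (C * W) = C * (A1 * W)" for W by (simp only: AC mult.assoc[symmetric])
  have "normal_op (A1 + ii * C)"
    unfolding normal_op_def
    by (simp add: A1 C algebra_simps iZ[of A1] iZ[of C] ii_commute[of C] ii_commute[of A1] AC AC' mult.assoc)
  moreover have "ebound \<gamma> (T - (A1 + ii * C))"
  proof -
    have "ebound (norm (\<delta> *\<^sub>R ii :: 'a bop) * 2) ((\<delta> *\<^sub>R ii) * (B - B1))" by (rule ebound_mult_left[OF eB])
    moreover have "norm (\<delta> *\<^sub>R ii :: 'a bop) * 2 \<le> \<gamma> / 2"
    proof -
      have "norm (\<delta> *\<^sub>R ii :: 'a bop) = \<delta> * norm (ii :: 'a bop)" using \<delta> by simp
      also have "\<dots> \<le> \<delta> * 1" using \<delta> by (intro mult_left_mono norm_ii) auto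
      finally show ?thesis by (simp add: \<delta>_def)
    qed
    ultimately have "ebound (\<gamma> / 2) ((\<delta> *\<^sub>R ii) * (B - B1))" using ebound_mono by blast
    then have "ebound (\<gamma> / 2 + \<gamma> / 2) ((A0 - A1) + (\<delta> *\<^sub>R ii) * (B - B1))" by (rule ebound_add[OF eA])
    moreover have "T - (A1 + ii * C) = (A0 - A1) + (\<delta> *\<^sub>R ii) * (B - B1)"
      using \<delta> by (simp add: T_eq C_def B_def algebra_simps)
    moreover have "\<gamma> / 2 + \<gamma> / 2 = \<gamma>" by simp
    ultimately show ?thesis by (simp only:)
  qed
  ultimately show thesis by (rule that)
qed

section \<open>Exact lifting of normal elements\<close>

text \<open>The approximants are glued along an increasing sequence of small subspaces that reduce all of
  them; on the complement of each subspace the next approximant is already close to \<open>T\<close>.\<close>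

theorem normal_lift:
  assumes T: "adj T * T \<doteq> T * adj T"
  obtains N where "normal_op N" "N \<doteq> T"
proof -
  define \<delta> where "\<delta> k = (1/2::real) ^ k" for k :: nat
  have \<delta>: "\<delta> k > 0" for k by (simp add: \<delta>_def)
  \<comment> \<open>Closeness is required for every projection that fixes X, because the reducing
    projections can be formed only when all approximants are known.\<close>
  define good where "good k N X \<longleftrightarrow> normal_op N \<and> small X \<and>
      (\<forall>P. isproj P \<longrightarrow> (\<forall>x\<in>X. P \<cdot> x = x) \<longrightarrow> norm ((T - N) * (1 - P)) \<le> 2 * \<delta> k)" for k N X
  have "\<exists>N X. good k N X" for k
  proof -
    obtain N where N: "normal_op N" "ebound (\<delta> k) (T - N)" using normal_approximation[OF T \<delta>] by blast
    obtain X where "small X" "\<And>P. isproj P \<Longrightarrow> (\<And>x. x \<in> X \<Longrightarrow> P \<cdot> x = x) \<Longrightarrow> norm ((T - N) * (1 - P)) \<le> \<delta> k + \<delta> k"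
      using negl_cut[OF N(2) less_imp_le[OF \<delta>] \<delta>] by blast
    then have "good k N X" using N(1) unfolding good_def by auto
    then show ?thesis by blast
  qed
  then obtain N X where "\<And>k. good k (N k) (X k)" by metis
  note good = this[unfolded good_def]
  have N: "normal_op (N k)" and X: "small (X k)"
    and NT: "isproj P \<Longrightarrow> (\<And>x. x \<in> X k \<Longrightarrow> P \<cdot> x = x) \<Longrightarrow> norm ((T - N k) * (1 - P)) \<le> 2 * \<delta> k" for k P
    using good[of k] by blast+
  \<comment> \<open>Countable and closed under adjoints: a small set generates a negligible
    projection that reduces T and all approximants at once.\<close>
  define Ts where "Ts = {T, adj T} \<union> range N \<union> adj ` range N"
  have Ts: "adj S \<in> Ts" if "S \<in> Ts" for S using that unfolding Ts_def by auto
  have cTs: "countable Ts" by (simp add: Ts_def)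
  define Y where "Y k = (\<Union>i\<le>k. X i)" for k
  have Y: "small (Y k)" for k
  proof (induction k)
    case (Suc k)
    have "Y (Suc k) = Y k \<union> X (Suc k)" by (auto simp: Y_def atMost_Suc)
    then show ?case using Suc X by (simp add: small_Un)
  qed (simp add: Y_def X)
  have Ymono: "Y i \<subseteq> Y k" if "i \<le> k" for i k using that by (force simp: Y_def)
  define E where "E k = reduce Ts (Y k)" for k
  have E: "isproj (E k)" for k by (simp add: E_def)
  have EE: "E i * E k = E i" if "i \<le> k" for i k unfolding E_def by (rule reduce_mono(2)[OF Ymono[OF that]])
  have EE': "E k * E i = E i" if "i \<le> k" for i k unfolding E_def by (rule reduce_mono(1)[OF Ymono[OF that]])
  have EX: "E k \<cdot> x = x" if "x \<in> X k" for k x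
    unfolding E_def using that orbit_superset[of "Y k" Ts] by (intro reduce_app) (auto simp: Y_def)
  have ET: "E k * S = S * E k" if "S \<in> Ts" for k S unfolding E_def by (rule reduce_commute[OF Ts that])
  have En: "E k \<in> negl" for k unfolding E_def by (rule reduce_negl[OF cTs Y])
  \<comment> \<open>Shifted by one: block l lies off E (l - 1), where N (l - 1) is close to T. Block
    0 is negligible, and 0 is a normal choice there.\<close>
  define M where "M l = (case l of 0 \<Rightarrow> 0 | Suc k \<Rightarrow> N k)" for l
  have M: "normal_op (M l)" for l by (cases l) (simp_all add: M_def N normal_op_def[of 0])
  have EM: "E k * M l = M l * E k" for k l
    by (cases l) (auto simp: M_def Ts_def intro!: ET)
  define D where "D l = E l - (if l = 0 then 0 else E (l - 1))" for l
  define t where "t l = (M l - T) * D l" for l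
  let ?F = "\<lambda>n. flag_step n E"
  have F: "partition n (?F n)" for n by (rule partition_flag_step[OF E EE])
  have FM: "?F n k * M l = M l * ?F n k" for n k l
    by (simp add: flag_step_def algebra_simps EM)
  define G where "G n = (\<Sum>l\<le>n. M l * ?F n l)" for n
  have G: "normal_op (G n)" for n unfolding G_def by (rule normal_op_partition[OF F FM M])
  have tail: "norm ((M (Suc k) - T) * (1 - E k)) \<le> 2 * \<delta> k" for k
  proof -
    have "norm ((T - N k) * (1 - E k)) \<le> 2 * \<delta> k" by (rule NT[OF E EX])
    moreover have "(M (Suc k) - T) * (1 - E k) = - ((T - N k) * (1 - E k))" by (simp add: M_def algebra_simps)
    ultimately show ?thesis by (simp only: norm_minus_cancel)
  qed
  \<comment> \<open>The last term belongs to the open final block 1 - E n, on which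
    \<open>M (Suc n)\<close> stands in for all later approximants; it tends to 0.\<close>
  have G_eq: "G (Suc n) = T + (\<Sum>l\<le>n. t l) + (M (Suc n) - T) * (1 - E n)" for n
  proof -
    have f: "?F (Suc n) l = D l" if "l \<le> n" for l using that by (simp add: flag_step_def D_def)
    have "G (Suc n) = T * (\<Sum>l\<le>Suc n. ?F (Suc n) l) + (\<Sum>l\<le>Suc n. (M l - T) * ?F (Suc n) l)"
      by (simp only: G_def sum_distrib_left left_diff_distrib sum_subtractf) simp
    also have "(\<Sum>l\<le>Suc n. ?F (Suc n) l) = 1" using F[of "Suc n"] by (simp add: partition_def)
    also have "(\<Sum>l\<le>Suc n. (M l - T) * ?F (Suc n) l) = (\<Sum>l\<le>n. t l) + (M (Suc n) - T) * (1 - E n)"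
      by (simp add: t_def f) (simp add: flag_step_def)
    finally show ?thesis by (simp add: add.assoc)
  qed
  have tb: "norm (t (Suc k)) \<le> 2 * \<delta> k" for k
  proof -
    have "t (Suc k) = (M (Suc k) - T) * (1 - E k) * E (Suc k)"
      using EE[of k "Suc k"] by (simp add: t_def D_def mult.assoc left_diff_distrib[of 1 "E k"])
    also have "norm \<dots> \<le> norm ((M (Suc k) - T) * (1 - E k)) * norm (E (Suc k))" by (rule norm_mult_ineq)
    also have "\<dots> \<le> (2 * \<delta> k) * 1" using \<delta>[of k] by (intro mult_mono tail isproj_norm E) auto
    finally show ?thesis by simp
  qed
  have "summable (\<lambda>k. t (Suc k))"
  proof (rule summable_comparison_test'[of "\<lambda>k. 2 * \<delta> k" 0])
    show "summable (\<lambda>k. 2 * \<delta> k)" unfolding \<delta>_def by (intro summable_mult summable_geometric) simp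
  qed (use tb in auto)
  then have st: "summable t" by (simp only: summable_Suc_iff)
  define L where "L = T + suminf t"
  have lim: "(\<lambda>n. \<Sum>l\<le>n. t l) \<longlonglongrightarrow> suminf t" by (rule summable_LIMSEQ'[OF st])
  have "(\<lambda>n. (M (Suc n) - T) * (1 - E n)) \<longlonglongrightarrow> 0"
  proof (rule Lim_null_comparison[of _ "\<lambda>n. 2 * \<delta> n"])
    show "(\<lambda>n. 2 * \<delta> n) \<longlonglongrightarrow> 0"
      unfolding \<delta>_def using tendsto_mult_left[OF LIMSEQ_power_zero[of "1/2::real"], of 2] by simp
  qed (use tail in auto)
  then have "(\<lambda>n. G (Suc n)) \<longlonglongrightarrow> T + suminf t + 0"
    unfolding G_eq by (intro tendsto_add tendsto_const lim)
  then have GL: "(\<lambda>n. G (Suc n)) \<longlonglongrightarrow> L" by (simp add: L_def)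
  have GL': "(\<lambda>n. adj (G (Suc n))) \<longlonglongrightarrow> adj L" by (rule bounded_linear.tendsto[OF bounded_linear_adj GL])
  have "(\<lambda>n. adj (G (Suc n)) * G (Suc n)) \<longlonglongrightarrow> adj L * L" by (rule tendsto_mult[OF GL' GL])
  moreover have "(\<lambda>n. adj (G (Suc n)) * G (Suc n)) \<longlonglongrightarrow> L * adj L"
    using tendsto_mult[OF GL GL'] G by (simp add: normal_op_def)
  ultimately have "normal_op L" unfolding normal_op_def by (rule LIMSEQ_unique)
  moreover have "L \<doteq> T"
  proof -
    have "t l \<in> negl" for l
      unfolding t_def D_def using En I_rules(2,4,7) by simp
    then have "(\<Sum>l\<le>n. t l) \<in> negl" for n by (induction n) (simp_all add: I_rules(3))
    then have "suminf t \<in> negl" using lim by (rule closed_sequentially[OF closed_negl])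
    then show ?thesis by (simp add: L_def cong_def)
  qed
  ultimately show thesis by (rule that)
qed

end

section \<open>The Calkin algebra\<close>

lemma bounded_ops_obtain: assumes "T \<in> carrier bounded_ops" obtains T' where "T = blin T'"
  using Bop_inverse[OF assms] by metis

lemma bounded_ops_simps: "mult bounded_ops S T = S o\<^sub>L T" "add bounded_ops S T = S + T"
  by (simp_all add: bounded_ops_def)

text \<open>Real parts already determine the adjoint, which gives the uniqueness that
  \<open>THE\<close> demands.\<close>

lemma cadjoint_blin: "cadjoint (blin T) = blin (adj T)"
  unfolding cadjoint_def
proof (rule the_equality)
  show "blin (adj T) \<in> carrier bounded_ops \<and> (\<forall>x y. cinner (blinfun_apply (blin T) x) y = cinner x (blinfun_apply (blin (adj T)) y))"
    using blin by (simp add: blin_simps adj_cinner)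
next
  fix S assume S: "S \<in> carrier bounded_ops \<and> (\<forall>x y. cinner (blinfun_apply (blin T) x) y = cinner x (blinfun_apply S y))"
  then obtain S' where S': "S = blin S'" using bounded_ops_obtain by metis
  have "(T \<cdot> x) \<bullet> y = x \<bullet> (S' \<cdot> y)" for x y using S by (simp add: S' blin_simps inner_eq_Re_cinner)
  then have "adj T = S'" by (rule adj_unique)
  then show "S = blin (adj T)" by (simp add: S')
qed

lemma closed_csub_closure_range: "closed_csub (closure (range (app T)))"
proof -
  have "complex_vector.subspace (range (app T))"
    unfolding complex_vector.subspace_def
  proof (intro conjI ballI allI)
    show "0 \<in> range (app T)" using rangeI[of "app T" 0] by simp
    show "x + y \<in> range (app T)" if "x \<in> range (app T)" "y \<in> range (app T)" for x y
      using that by (auto simp flip: app_add)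
    show "c *\<^sub>C x \<in> range (app T)" if "x \<in> range (app T)" for c x
      using that by (auto simp flip: app_scaleC)
  qed
  then have "cspan (range (app T)) = range (app T)" by (simp only: complex_vector.span_eq_iff)
  then show ?thesis using closed_csub_closure_cspan[of "range (app T)"] by (simp only:)
qed

lemma rank_op_onb:
  obtains B where "rank_op (blin T) = |B|" "orthonormal B" "closure (cspan B) = closure (range (app T))"
proof -
  let ?S = "closure (range (app T))"
  have "is_onb ?S (SOME B. is_onb ?S B)" by (rule onb_some[OF closed_csub_closure_range])
  then have "orthonormal (SOME B. is_onb ?S B)" "closure (cspan (SOME B. is_onb ?S B)) = ?S"
    unfolding is_onb_iff[OF closed_csub_closure_range] by blast+
  moreover have "rank_op (blin T) = |SOME B. is_onb ?S B|"
    by (simp add: rank_op_def hdim_def blin_simps cong: image_cong)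
  ultimately show thesis using that by blast
qed

context uncountable_cardinal
begin

lemma small_rank_negl: assumes "rank_op (blin T) <o m" shows "T \<in> negl"
proof -
  obtain B where B: "rank_op (blin T) = |B|" "closure (cspan B) = closure (range (app T))"
    using rank_op_onb by metis
  show ?thesis
  proof (rule small_range_negl)
    show "small B" using assms unfolding B(1) small_def .
    show "T \<cdot> v \<in> closure (cspan B)" for v unfolding B(2) by (rule subsetD[OF closure_subset]) simp
  qed
qed

text \<open>An orthonormal basis of the closed range injects into the product of X with the natural
  numbers, which is small because m is uncountable.\<close>

lemma small_range_rank:
  assumes X: "small X" and T: "\<And>v. T \<cdot> v \<in> closure (cspan X)" shows "rank_op (blin T) <o m"
proof -
  obtain B where B: "rank_op (blin T) = |B|" "orthonormal B" "closure (cspan B) = closure (range (app T))"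
    by (rule rank_op_onb)
  have "closure (range (app T)) \<subseteq> closure (cspan X)" using T by (intro closure_minimal) auto
  then have "B \<subseteq> closure (cspan X)" using B(3) closure_cspan_superset by blast
  then have "|B| \<le>o |X \<times> (UNIV :: nat set)|" by (rule card_of_orthonormal[OF B(2)])
  moreover have "small (X \<times> (UNIV :: nat set))"
  proof -
    have "small (prod.swap ` ((UNIV :: nat set) \<times> X))" by (intro small_image small_times X) simp
    then show ?thesis by (simp add: product_swap)
  qed
  ultimately have "small B" using small_ordLeq by blast
  then show ?thesis unfolding B(1) small_def .
qed

text \<open>Operators of small rank are negligible and \<open>negl\<close> is closed. Conversely, a
  negligible T is approximated by T P, where P projects onto the span of a small set, and T P has
  small rank.\<close>

lemma m_compact_ops_eq: "m_compact_ops m = blin ` negl"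
proof
  show "m_compact_ops m \<subseteq> blin ` negl"
    unfolding m_compact_ops_def
  proof (rule closure_minimal)
    show "small_rank_ops m \<subseteq> blin ` negl"
    proof
      fix S :: "'a \<Rightarrow>\<^sub>L 'a" assume S: "S \<in> small_rank_ops m"
      then obtain S' where S': "S = blin S'" using bounded_ops_obtain by (auto simp: small_rank_ops_def)
      then show "S \<in> blin ` negl" using S small_rank_negl by (auto simp: small_rank_ops_def)
    qed
    show "closed (blin ` negl)"
      unfolding closed_sequential_limits
    proof (intro allI impI)
      fix X L assume XL: "(\<forall>n. X n \<in> blin ` negl) \<and> X \<longlonglongrightarrow> L"
      then have "\<forall>n. \<exists>y. y \<in> negl \<and> X n = blin y" by blast
      then obtain Y where "\<forall>n. Y n \<in> negl \<and> X n = blin (Y n)" by (rule choice[THEN exE])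
      then have Y: "\<And>n. Y n \<in> negl" "\<And>n. X n = blin (Y n)" by simp_all
      have "L \<in> carrier bounded_ops"
        by (rule closed_sequentially[OF closed_carrier_bounded_ops, of X]) (use XL Y blin in auto)
      then obtain L' where L': "L = blin L'" by (rule bounded_ops_obtain)
      have "Y \<longlonglongrightarrow> L'" using XL by (simp add: tendsto_iff dist_bop.rep_eq flip: L' Y(2))
      then have "L' \<in> negl" by (rule closed_sequentially[OF closed_negl, of Y, OF Y(1)])

      then show "L \<in> blin ` negl" using L' by blast
    qed
  qed
next
  show "blin ` negl \<subseteq> m_compact_ops m"
  proof
    fix S assume "S \<in> blin ` negl"
    then obtain T where T: "T \<in> negl" "S = blin T" by blast
    show "S \<in> m_compact_ops m"
      unfolding m_compact_ops_def closure_approachable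
    proof (intro allI impI)
      fix e :: real assume "e > 0"
      then have e: "e / 2 > 0" by simp
      have "ebound 0 T" using T(1) by (simp add: negl_def)
      then obtain X where X: "small X" "\<And>P. isproj P \<Longrightarrow> (\<And>x. x \<in> X \<Longrightarrow> P \<cdot> x = x) \<Longrightarrow> norm (T * (1 - P)) \<le> 0 + e / 2"
        using negl_cut[OF _ order_refl e] by blast
      define P where "P = proj (closure (cspan X))"
      have "norm (T * (1 - P)) \<le> 0 + e / 2"
        using closure_cspan_superset[of X] by (intro X(2)) (auto simp: P_def isproj_proj intro!: proj_id)
      then have "dist (blin (T * P)) S < e"
        using \<open>e > 0\<close> unfolding T(2) dist_bop.rep_eq[symmetric] by (simp add: dist_norm norm_minus_commute right_diff_distrib)
      moreover have "blin (T * P) \<in> small_rank_ops m"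
      proof -
        have "closure (cspan X) \<subseteq> {x. T \<cdot> x \<in> closure (cspan (app T ` X))}"
          using closure_cspan_superset[of "app T ` X"] by (intro closure_cspan_minimal closed_csub_vimage) auto
        then have "(T * P) \<cdot> v \<in> closure (cspan (app T ` X))" for v
          using proj_in[of "closure (cspan X)" v] by (auto simp: P_def)
        then have "rank_op (blin (T * P)) <o m" by (rule small_range_rank[OF small_image[OF X(1)]])
        then show ?thesis using blin by (simp add: small_rank_ops_def)
      qed
      ultimately show "\<exists>y\<in>small_rank_ops m. dist y S < e" by blast
    qed
  qed
qed

lemma calkin_proj_eq: "calkin_proj m (blin T) = blin ` {S. S \<doteq> T}"
proof -
  have "calkin_proj m (blin T) = {blin (h + T) |h. h \<in> negl}"
    by (auto simp: calkin_proj_def a_r_coset_def' bounded_ops_simps m_compact_ops_eq blin_simps)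
  also have "\<dots> = blin ` {S. S \<doteq> T}"
  proof (intro subset_antisym subsetI)
    fix x assume "x \<in> {blin (h + T) |h. h \<in> negl}"
    then obtain h where "x = blin (h + T)" "h \<in> negl" by blast
    then show "x \<in> blin ` {S. S \<doteq> T}" by (intro image_eqI[of _ _ "h + T"]) (auto simp: cong_def)
  next
    fix x assume "x \<in> blin ` {S. S \<doteq> T}"
    then obtain S where "x = blin ((S - T) + T)" "S - T \<in> negl" by (auto simp: cong_def)
    then show "x \<in> {blin (h + T) |h. h \<in> negl}" by blast
  qed
  finally show ?thesis .
qed

lemma calkin_carrier_obtain:
  assumes "t \<in> carrier (calkin m)" obtains T :: "'a bop" where "t = calkin_proj m (blin T)"
proof -
  have "t \<in> a_rcosets\<^bsub>bounded_ops\<^esub> (m_compact_ops m)" using assms by (simp add: calkin_def FactRing_def)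
  then obtain T where "T \<in> carrier bounded_ops" "t = calkin_proj m T"
    by (auto simp: A_RCOSETS_def' calkin_proj_def)
  then show thesis using that bounded_ops_obtain by metis
qed

text \<open>A product in the quotient is a union of cosets over all representatives, so the equation
  only yields some S and S' congruent to T; congruence then replaces both by T.\<close>

lemma calkin_normal:
  assumes "calkin_star (calkin_proj m (blin T)) \<otimes>\<^bsub>calkin m\<^esub> calkin_proj m (blin T)
    = calkin_proj m (blin T) \<otimes>\<^bsub>calkin m\<^esub> calkin_star (calkin_proj m (blin T))"
  shows "adj T * T \<doteq> T * adj T"
proof -
  let ?t = "calkin_proj m (blin T)"
  have star: "calkin_star ?t = blin ` adj ` {S. S \<doteq> T}"
    by (simp add: calkin_star_def calkin_proj_eq image_image cadjoint_blin)
  have mult: "A \<otimes>\<^bsub>calkin m\<^esub> B = (\<Union>a\<in>A. \<Union>b\<in>B. calkin_proj m (a o\<^sub>L b))" for A B :: "('a \<Rightarrow>\<^sub>L 'a) set"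
    by (simp add: calkin_def FactRing_def rcoset_mult_def calkin_proj_def bounded_ops_simps)
  have "blin (adj T * T) \<in> calkin_proj m (blin (adj T) o\<^sub>L blin T)"
    by (simp flip: blin_simps) (simp add: calkin_proj_eq)
  moreover have "blin (adj T) \<in> calkin_star ?t" "blin T \<in> ?t" unfolding star by (auto simp: calkin_proj_eq)
  ultimately have "blin (adj T * T) \<in> calkin_star ?t \<otimes>\<^bsub>calkin m\<^esub> ?t" unfolding mult by blast
  then have "blin (adj T * T) \<in> ?t \<otimes>\<^bsub>calkin m\<^esub> calkin_star ?t" by (simp only: assms)
  then obtain S S' where S: "S \<doteq> T" "S' \<doteq> T" "blin (adj T * T) \<in> calkin_proj m (blin S o\<^sub>L blin (adj S'))"
    unfolding mult star by (auto simp: calkin_proj_eq)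
  then have "blin (adj T * T) \<in> blin ` {R. R \<doteq> S * adj S'}" by (simp flip: blin_simps calkin_proj_eq)
  then have "adj T * T \<doteq> S * adj S'" by (auto simp: blin_inject)
  also have "\<dots> \<doteq> T * adj T" by (intro cong_mult cong_adj S)
  finally show ?thesis .
qed

end

theorem theorem1:
  fixes m :: "'m rel"
    and t :: "('a::complex_hilbert \<Rightarrow>\<^sub>L 'a) set"
  assumes "natLeq \<le>o hdim (UNIV :: 'a set)"
    and "Card_order m"
    and "natLeq <o m"
    and "m \<le>o hdim (UNIV :: 'a set)"
    and "countably_cofinal m"
    and "t \<in> carrier (calkin m)"
    and "calkin_star t \<otimes>\<^bsub>calkin m\<^esub> t = t \<otimes>\<^bsub>calkin m\<^esub> calkin_star t"
  shows "\<exists>T \<in> carrier bounded_ops.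
           cadjoint T \<otimes>\<^bsub>bounded_ops\<^esub> T = T \<otimes>\<^bsub>bounded_ops\<^esub> cadjoint T \<and> calkin_proj m T = t"
proof -
  interpret uncountable_cardinal m "TYPE('a)"
    by standard (fact assms)+
  obtain T :: "'a bop" where T: "t = calkin_proj m (blin T)"
    using calkin_carrier_obtain[OF assms(6)] .
  have "adj T * T \<doteq> T * adj T" using assms(7) unfolding T by (rule calkin_normal)
  then obtain N where N: "normal_op N" "N \<doteq> T" by (rule normal_lift)
  have "calkin_proj m (blin N) = t"
    unfolding T calkin_proj_eq using N(2) cong_trans cong_sym by blast
  moreover have "cadjoint (blin N) \<otimes>\<^bsub>bounded_ops\<^esub> blin N = blin N \<otimes>\<^bsub>bounded_ops\<^esub> cadjoint (blin N)"
    using N(1) by (simp add: normal_op_def bounded_ops_simps cadjoint_blin flip: blin_simps)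
  ultimately show ?thesis using blin by blast
qed

end
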